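(* Let $u\in H^\infty(\mathbb{D})$ be a nonconstant inner function. There exists a nonzero operator $X\in\mathcal{B}(\mathcal{Q}_u)$ satisfying $S_u^*X=XS_u$ if and only if \[ \gcd\{u, \overline{Ju}\}\ne 1 . \]
   Context: $\mathbb{T}$ is the unit circle, $\mathbb{D}$ the open unit disc, and $\mathcal{B}(\mathcal{H})$ the bounded linear operators on a Hilbert space $\mathcal{H}$. $H^2\subseteq L^2(\mathbb{T})$ is the Hardy space (functions whose negative Fourier coefficients vanish), and $T_z$ is the shift on $H^2$, $T_zf=zf$. $H^\infty(\mathbb{D})$ is the algebra of bounded analytic functions on $\mathbb{D}$; $u\in H^\infty(\mathbb{D})$ is inner if its radial limits satisfy $|u|=1$ a.e. on $\mathbb{T}$. For $u$ inner, the model space is $\mathcal{Q}_u=H^2\ominus uH^2$ and the model operator is $S_u=P_{\mathcal{Q}_u}T_z|_{\mathcal{Q}_u}\in\mathcal{B}(\mathcal{Q}_u)$, where $P_{\mathcal{Q}_u}$ is the orthogonal projection onto $\mathcal{Q}_u$. $J$ is defined by $(Jf)(z)=f(\bar z)$, so for $u=\sum_{n\ge 0}a_nz^n$ one has $\overline{Ju}=\sum_{n\ge0}\bar a_nz^n$, again an inner function. An inner function $u$ divides an inner function $v$ if $v=wu$ for some $w\in H^\infty(\mathbb{D})$. The greatest common divisor $\gcd\{u_1,u_2\}$ of inner functions $u_1,u_2$ is an inner function dividing both and divisible by every inner function dividing both; it is unique up to a unimodular constant, and $\gcd\neq 1$ means that it is nonconstant. *)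

theory Defs
  imports "HOL-Complex_Analysis.Complex_Analysis"
begin

section \<open>The space $L^2$ of the unit circle\<close>

definition circle_measure :: "complex measure" where
  "circle_measure =
     distr (uniform_measure lborel {0..2 * pi}) (restrict_space borel (sphere 0 1)) cis"

lemma space_circle_measure [simp]: "space circle_measure = sphere 0 1"
  by (simp add: circle_measure_def space_restrict_space)

lemma sets_circle_measure [measurable_cong]:
  "sets circle_measure = sets (restrict_space borel (sphere 0 1))"
  by (simp add: circle_measure_def)

lemma finite_measure_circle_measure: "finite_measure circle_measure"
proof (rule finite_measureI)
  have [measurable]: "cis \<in> borel \<rightarrow>\<^sub>M restrict_space borel (sphere 0 1)"
    by (intro measurable_restrict_space2 borel_measurable_continuous_onI continuous_intros) auto
  have "emeasure (uniform_measure lborel {0..2 * pi}) (space lborel) = 1"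
    by (subst emeasure_uniform_measure) (auto simp: divide_ennreal)
  then show "emeasure circle_measure (space circle_measure) \<noteq> \<infinity>"
    unfolding circle_measure_def
    using sets.top[of "restrict_space borel (sphere 0 1 :: complex set)"]
    by (subst emeasure_distr) (auto simp: space_restrict_space vimage_def)
qed

lemma borel_measurable_cnj [measurable]: "cnj \<in> borel_measurable borel"
  by (intro borel_measurable_continuous_onI continuous_intros)

definition square_integrable :: "(complex \<Rightarrow> complex) \<Rightarrow> bool" where
  "square_integrable f \<longleftrightarrow>
     f \<in> borel_measurable circle_measure \<and> integrable circle_measure (\<lambda>z. (cmod (f z))\<^sup>2)"

definition l2_eq :: "(complex \<Rightarrow> complex) \<Rightarrow> (complex \<Rightarrow> complex) \<Rightarrow> bool" where
  "l2_eq f g \<longleftrightarrow>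
     square_integrable f \<and> square_integrable g \<and> (AE z in circle_measure. f z = g z)"

lemma square_integrable_zero: "square_integrable (\<lambda>z. 0)"
  by (simp add: square_integrable_def)

lemma square_integrable_add:
  assumes "square_integrable f" "square_integrable g"
  shows "square_integrable (\<lambda>z. f z + g z)"
proof -
  have [measurable]: "f \<in> borel_measurable circle_measure" "g \<in> borel_measurable circle_measure"
    using assms by (auto simp: square_integrable_def)
  have le: "(cmod (a + b))\<^sup>2 \<le> 2 * (cmod a)\<^sup>2 + 2 * (cmod b)\<^sup>2" for a b
  proof -
    have "(cmod (a + b))\<^sup>2 \<le> (cmod a + cmod b)\<^sup>2"
      by (intro power_mono norm_triangle_ineq) auto
    also have "\<dots> \<le> 2 * (cmod a)\<^sup>2 + 2 * (cmod b)\<^sup>2"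
      using sum_squares_bound[of "cmod a" "cmod b"] by (simp add: power2_sum)
    finally show ?thesis .
  qed
  have "integrable circle_measure (\<lambda>z. (cmod (f z + g z))\<^sup>2)"
  proof (rule Bochner_Integration.integrable_bound)
    show "integrable circle_measure (\<lambda>z. 2 * (cmod (f z))\<^sup>2 + 2 * (cmod (g z))\<^sup>2)"
      using assms by (auto simp: square_integrable_def)
    show "AE z in circle_measure. norm ((cmod (f z + g z))\<^sup>2)
            \<le> norm (2 * (cmod (f z))\<^sup>2 + 2 * (cmod (g z))\<^sup>2)"
      using le by (intro AE_I2) auto
  qed measurable
  then show ?thesis
    by (simp add: square_integrable_def)
qed

lemma square_integrable_mult:
  assumes "\<phi> \<in> borel_measurable circle_measure"
    and "AE z in circle_measure. cmod (\<phi> z) \<le> K" and "square_integrable f"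
  shows "square_integrable (\<lambda>z. \<phi> z * f z)"
proof -
  have [measurable]: "f \<in> borel_measurable circle_measure" "\<phi> \<in> borel_measurable circle_measure"
    using assms by (auto simp: square_integrable_def)
  have "integrable circle_measure (\<lambda>z. (cmod (\<phi> z * f z))\<^sup>2)"
  proof (rule Bochner_Integration.integrable_bound)
    show "integrable circle_measure (\<lambda>z. K\<^sup>2 * (cmod (f z))\<^sup>2)"
      using assms by (auto simp: square_integrable_def)
    show "AE z in circle_measure. norm ((cmod (\<phi> z * f z))\<^sup>2) \<le> norm (K\<^sup>2 * (cmod (f z))\<^sup>2)"
      using assms(2) by eventually_elim
        (auto simp: norm_mult power_mult_distrib intro!: mult_right_mono power_mono)
  qed measurable
  then show ?thesis
    by (simp add: square_integrable_def)
qed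

lemma square_integrable_scale:
  "square_integrable f \<Longrightarrow> square_integrable (\<lambda>z. c * f z)"
  by (rule square_integrable_mult[where K = "cmod c"]) auto

lemma square_integrable_scaleR:
  "square_integrable f \<Longrightarrow> square_integrable (\<lambda>z. (r::real) *\<^sub>R f z)"
  using square_integrable_scale[of f "of_real r"] by (simp add: scaleR_conv_of_real)

lemma square_integrable_minus:
  "square_integrable f \<Longrightarrow> square_integrable (\<lambda>z. - f z)"
  using square_integrable_scale[of f "-1"] by simp

lemma square_integrable_diff:
  "square_integrable f \<Longrightarrow> square_integrable g \<Longrightarrow> square_integrable (\<lambda>z. f z - g z)"
  using square_integrable_add[of f "\<lambda>z. - g z"] square_integrable_minus[of g] by simp

lemma square_integrable_times_cnj:
  assumes "square_integrable f" "square_integrable g"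
  shows "integrable circle_measure (\<lambda>z. f z * cnj (g z))"
proof -
  have [measurable]: "f \<in> borel_measurable circle_measure" "g \<in> borel_measurable circle_measure"
    using assms by (auto simp: square_integrable_def)
  show ?thesis
  proof (rule Bochner_Integration.integrable_bound)
    show "integrable circle_measure (\<lambda>z. (cmod (f z))\<^sup>2 + (cmod (g z))\<^sup>2)"
      using assms by (auto simp: square_integrable_def)
    have le: "a * b \<le> a\<^sup>2 + b\<^sup>2" if "a \<ge> 0" "b \<ge> 0" for a b :: real
      using sum_squares_bound[of a b] mult_nonneg_nonneg[OF that] by linarith
    show "AE z in circle_measure. norm (f z * cnj (g z)) \<le> norm ((cmod (f z))\<^sup>2 + (cmod (g z))\<^sup>2)"
      by (intro AE_I2) (auto simp: norm_mult intro!: le)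
  qed measurable
qed

quotient_type l2_circle = "complex \<Rightarrow> complex" / partial: l2_eq
proof (rule part_equivpI)
  show "\<exists>f. l2_eq f f"
    using square_integrable_zero by (auto simp: l2_eq_def)
  show "symp l2_eq"
    by (auto simp: symp_def l2_eq_def elim: eventually_mono)
  show "transp l2_eq"
    by (auto simp: transp_def l2_eq_def elim: eventually_elim2)
qed

lift_definition cinner :: "l2_circle \<Rightarrow> l2_circle \<Rightarrow> complex" is
  "\<lambda>f g. \<integral>z. f z * cnj (g z) \<partial>circle_measure"
proof -
  fix f f' g g' assume *: "l2_eq f f'" "l2_eq g g'"
  have [measurable]: "f \<in> borel_measurable circle_measure" "g \<in> borel_measurable circle_measure"
     "f' \<in> borel_measurable circle_measure" "g' \<in> borel_measurable circle_measure"
    using * by (auto simp: square_integrable_def l2_eq_def)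
  from * have "AE z in circle_measure. f z = f' z" "AE z in circle_measure. g z = g' z"
    by (auto simp: l2_eq_def)
  then have "AE z in circle_measure. f z * cnj (g z) = f' z * cnj (g' z)"
    by eventually_elim simp
  then show "(\<integral>z. f z * cnj (g z) \<partial>circle_measure) = (\<integral>z. f' z * cnj (g' z) \<partial>circle_measure)"
    by (intro integral_cong_AE) auto
qed

lift_definition scaleC :: "complex \<Rightarrow> l2_circle \<Rightarrow> l2_circle" (infixr \<open>*\<^sub>C\<close> 75) is "\<lambda>c f z. c * f z"
  by (auto simp: l2_eq_def square_integrable_scale elim: eventually_mono)

instantiation l2_circle :: real_vector
begin

lift_definition zero_l2_circle :: l2_circle is "\<lambda>z. 0"
  by (simp add: l2_eq_def square_integrable_zero)

lift_definition plus_l2_circle :: "l2_circle \<Rightarrow> l2_circle \<Rightarrow> l2_circle" is "\<lambda>f g z. f z + g z"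
  by (auto simp: l2_eq_def square_integrable_add elim: eventually_elim2)

lift_definition minus_l2_circle :: "l2_circle \<Rightarrow> l2_circle \<Rightarrow> l2_circle" is "\<lambda>f g z. f z - g z"
  by (auto simp: l2_eq_def square_integrable_diff elim: eventually_elim2)

lift_definition uminus_l2_circle :: "l2_circle \<Rightarrow> l2_circle" is "\<lambda>f z. - f z"
  by (auto simp: l2_eq_def square_integrable_minus elim: eventually_mono)

lift_definition scaleR_l2_circle :: "real \<Rightarrow> l2_circle \<Rightarrow> l2_circle" is "\<lambda>r f z. r *\<^sub>R f z"
  by (auto simp: l2_eq_def square_integrable_scaleR elim: eventually_mono)

instance
proof
  fix f g h :: l2_circle and r s :: real
  show "f + g + h = f + (g + h)"
    by transfer (auto simp: l2_eq_def add.assoc intro!: square_integrable_add)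
  show "f + g = g + f"
    by transfer (auto simp: l2_eq_def add.commute intro!: square_integrable_add)
  show "0 + f = f"
    by transfer (auto simp: l2_eq_def)
  show "- f + f = 0"
    by transfer (auto simp: l2_eq_def square_integrable_zero)
  show "f - g = f + - g"
    by transfer (auto simp: l2_eq_def intro!: square_integrable_diff)
  show "r *\<^sub>R (f + g) = r *\<^sub>R f + r *\<^sub>R g"
    by transfer (auto simp: l2_eq_def scaleR_add_right
      intro!: square_integrable_add square_integrable_scaleR)
  show "(r + s) *\<^sub>R f = r *\<^sub>R f + s *\<^sub>R f"
    by transfer (auto simp: l2_eq_def scaleR_add_left
      intro!: square_integrable_add square_integrable_scaleR)
  show "r *\<^sub>R s *\<^sub>R f = (r * s) *\<^sub>R f"
    by transfer (auto simp: l2_eq_def intro!: square_integrable_scaleR)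
  show "1 *\<^sub>R f = f"
    by transfer (auto simp: l2_eq_def)
qed

end

lemma cinner_add_left: "cinner (f + g) h = cinner f h + cinner g h"
proof transfer
  fix f g h assume "l2_eq f f" "l2_eq g g" "l2_eq h h"
  then have "integrable circle_measure (\<lambda>z. f z * cnj (h z))"
      "integrable circle_measure (\<lambda>z. g z * cnj (h z))"
    by (auto simp: l2_eq_def intro: square_integrable_times_cnj)
  then show "(\<integral>z. (f z + g z) * cnj (h z) \<partial>circle_measure) =
       (\<integral>z. f z * cnj (h z) \<partial>circle_measure) + (\<integral>z. g z * cnj (h z) \<partial>circle_measure)"
    by (simp add: distrib_right)
qed

lemma cinner_scaleC_left: "cinner (c *\<^sub>C f) g = c * cinner f g"
  by transfer (simp add: mult.assoc)

lemma cinner_commute: "cinner f g = cnj (cinner g f)"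
  by transfer (simp add: mult.commute flip: Bochner_Integration.integral_cnj)

lemma scaleR_conv_scaleC: "r *\<^sub>R f = complex_of_real r *\<^sub>C f"
  by transfer (auto simp: scaleR_conv_of_real l2_eq_def square_integrable_scale)

lemma Re_cinner_self_nonneg: "0 \<le> Re (cinner f f)"
proof transfer
  fix f
  have "(\<integral>z. f z * cnj (f z) \<partial>circle_measure) = of_real (\<integral>z. (cmod (f z))\<^sup>2 \<partial>circle_measure)"
    by (simp flip: integral_of_real complex_norm_square of_real_power)
  then show "0 \<le> Re (\<integral>z. f z * cnj (f z) \<partial>circle_measure)"
    by simp
qed

lemma Re_cinner_self_eq_0: "Re (cinner f f) = 0 \<longleftrightarrow> f = 0"
proof transfer
  fix f assume f: "l2_eq f f"
  then have int: "integrable circle_measure (\<lambda>z. (cmod (f z))\<^sup>2)"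
    by (simp add: l2_eq_def square_integrable_def)
  have "(\<integral>z. f z * cnj (f z) \<partial>circle_measure) = of_real (\<integral>z. (cmod (f z))\<^sup>2 \<partial>circle_measure)"
    by (simp flip: integral_of_real complex_norm_square of_real_power)
  then have "Re (\<integral>z. f z * cnj (f z) \<partial>circle_measure) = 0 \<longleftrightarrow>
      (\<integral>z. (cmod (f z))\<^sup>2 \<partial>circle_measure) = 0"
    by simp
  also have "\<dots> \<longleftrightarrow> (AE z in circle_measure. (cmod (f z))\<^sup>2 = 0)"
    by (rule integral_nonneg_eq_0_iff_AE[OF int]) auto
  finally show "Re (\<integral>z. f z * cnj (f z) \<partial>circle_measure) = 0 \<longleftrightarrow> l2_eq f (\<lambda>z. 0)"
    using f square_integrable_zero by (auto simp: l2_eq_def)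
qed

instantiation l2_circle :: real_inner
begin

definition inner_l2_circle :: "l2_circle \<Rightarrow> l2_circle \<Rightarrow> real" where
  "inner_l2_circle f g = Re (cinner f g)"

definition norm_l2_circle :: "l2_circle \<Rightarrow> real" where
  "norm_l2_circle f = sqrt (inner f f)"

definition sgn_l2_circle :: "l2_circle \<Rightarrow> l2_circle" where
  "sgn_l2_circle f = f /\<^sub>R norm f"

definition dist_l2_circle :: "l2_circle \<Rightarrow> l2_circle \<Rightarrow> real" where
  "dist_l2_circle f g = norm (f - g)"

definition uniformity_l2_circle :: "(l2_circle \<times> l2_circle) filter" where
  "uniformity_l2_circle = (INF e\<in>{0<..}. principal {(f, g). dist f g < e})"

definition open_l2_circle :: "l2_circle set \<Rightarrow> bool" where
  "open_l2_circle U \<longleftrightarrow> (\<forall>f\<in>U. eventually (\<lambda>(f', g). f' = f \<longrightarrow> g \<in> U) uniformity)"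

instance
proof
  fix f g h :: l2_circle and r :: real and U :: "l2_circle set"
  show "dist f g = norm (f - g)" by (rule dist_l2_circle_def)
  show "sgn f = f /\<^sub>R norm f" by (rule sgn_l2_circle_def)
  show "(uniformity :: (l2_circle \<times> l2_circle) filter) =
      (INF e\<in>{0<..}. principal {(f, g). dist f g < e})"
    by (rule uniformity_l2_circle_def)
  show "open U \<longleftrightarrow> (\<forall>f\<in>U. eventually (\<lambda>(f', g). f' = f \<longrightarrow> g \<in> U) uniformity)"
    by (rule open_l2_circle_def)
  show "inner f g = inner g f"
    unfolding inner_l2_circle_def by (subst cinner_commute) simp
  show "inner (f + g) h = inner f h + inner g h"
    by (simp add: inner_l2_circle_def cinner_add_left)
  show "inner (r *\<^sub>R f) g = r * inner f g"
    by (simp add: inner_l2_circle_def scaleR_conv_scaleC cinner_scaleC_left)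
  show "0 \<le> inner f f"
    by (simp add: inner_l2_circle_def Re_cinner_self_nonneg)
  show "inner f f = 0 \<longleftrightarrow> f = 0"
    by (simp add: inner_l2_circle_def Re_cinner_self_eq_0)
  show "norm f = sqrt (inner f f)" by (rule norm_l2_circle_def)
qed

end

text \<open>
  The product of an element of $L^2$ with a function on the circle.  The definition is meaningful
  for measurable, essentially bounded \<open>\<phi>\<close>, by the lemma that follows it.
\<close>

definition mult_op :: "(complex \<Rightarrow> complex) \<Rightarrow> l2_circle \<Rightarrow> l2_circle" where
  "mult_op \<phi> f = abs_l2_circle (\<lambda>z. \<phi> z * rep_l2_circle f z)"

lemma mult_op_abs:
  assumes "\<phi> \<in> borel_measurable circle_measure" "AE z in circle_measure. cmod (\<phi> z) \<le> K"
    and "square_integrable f"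
  shows "mult_op \<phi> (abs_l2_circle f) = abs_l2_circle (\<lambda>z. \<phi> z * f z)"
proof -
  have "l2_eq f f" using assms by (simp add: l2_eq_def)
  then have "l2_eq (rep_l2_circle (abs_l2_circle f)) f"
    by (rule rep_abs_rsp_left[OF Quotient3_l2_circle])
  then have "l2_eq (\<lambda>z. \<phi> z * rep_l2_circle (abs_l2_circle f) z) (\<lambda>z. \<phi> z * f z)"
    using assms by (auto simp: l2_eq_def intro: square_integrable_mult elim: eventually_mono)
  then show ?thesis
    by (simp add: mult_op_def Quotient3_rel_abs[OF Quotient3_l2_circle])
qed


section \<open>Bounded operators, adjoints and projections on subspaces of $L^2$\<close>

text \<open>
  An operator on a closed complex subspace \<open>M\<close> is a function on all of \<^typ>\<open>l2_circle\<close> whose values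
  outside \<open>M\<close> are irrelevant.
\<close>

definition bounded_operators :: "l2_circle set \<Rightarrow> (l2_circle \<Rightarrow> l2_circle) set" where
  "bounded_operators M = {X.
     (\<forall>f\<in>M. X f \<in> M) \<and>
     (\<forall>f\<in>M. \<forall>g\<in>M. X (f + g) = X f + X g) \<and>
     (\<forall>c. \<forall>f\<in>M. X (c *\<^sub>C f) = c *\<^sub>C X f) \<and>
     (\<exists>K. \<forall>f\<in>M. norm (X f) \<le> K * norm f)}"

definition orth_proj :: "l2_circle set \<Rightarrow> l2_circle \<Rightarrow> l2_circle" where
  "orth_proj M f = (THE g. g \<in> M \<and> (\<forall>h\<in>M. cinner (f - g) h = 0))"

definition adjoint_on :: "l2_circle set \<Rightarrow> (l2_circle \<Rightarrow> l2_circle) \<Rightarrow> l2_circle \<Rightarrow> l2_circle" where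
  "adjoint_on M X g = (THE h. h \<in> M \<and> (\<forall>f\<in>M. cinner (X f) g = cinner f h))"


section \<open>Hardy spaces, inner functions and model operators\<close>

lemma square_integrable_powi: "square_integrable (\<lambda>z. z powi n)"
proof -
  interpret finite_measure circle_measure by (rule finite_measure_circle_measure)
  have "continuous_on (sphere 0 1) (\<lambda>z::complex. z powi n)"
    by (intro continuous_intros) auto
  then have [measurable]: "(\<lambda>z. z powi n) \<in> borel_measurable circle_measure"
    by (simp add: borel_measurable_continuous_on_restrict measurable_cong_sets[OF sets_circle_measure refl])
  have "integrable circle_measure (\<lambda>z. (cmod (z powi n))\<^sup>2)"
  proof (rule integrable_const_bound[where B = 1])
    show "AE z in circle_measure. norm ((cmod (z powi n))\<^sup>2) \<le> 1"
      by (intro AE_I2) (auto simp: norm_power_int)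
  qed measurable
  then show ?thesis
    by (simp add: square_integrable_def)
qed

definition fourier_coeff :: "l2_circle \<Rightarrow> int \<Rightarrow> complex" where
  "fourier_coeff f n = cinner f (abs_l2_circle (\<lambda>z. z powi n))"

definition hardy2 :: "l2_circle set" where
  "hardy2 = {f. \<forall>n<0. fourier_coeff f n = 0}"

definition shift :: "l2_circle \<Rightarrow> l2_circle" where
  "shift = mult_op (\<lambda>z. z)"

definition hardy_inf :: "(complex \<Rightarrow> complex) set" where
  "hardy_inf = {u. u holomorphic_on ball 0 1 \<and> bounded (u ` ball 0 1)}"

definition radial_limit :: "(complex \<Rightarrow> complex) \<Rightarrow> complex \<Rightarrow> complex" where
  "radial_limit u z = Lim (at_left 1) (\<lambda>r::real. u (of_real r * z))"

definition inner_function :: "(complex \<Rightarrow> complex) \<Rightarrow> bool" where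
  "inner_function u \<longleftrightarrow> u \<in> hardy_inf \<and>
     (AE z in circle_measure.
        \<exists>l. ((\<lambda>r::real. u (of_real r * z)) \<longlongrightarrow> l) (at_left 1) \<and> cmod l = 1)"

definition model_space :: "(complex \<Rightarrow> complex) \<Rightarrow> l2_circle set" where
  "model_space u =
     {f \<in> hardy2. \<forall>g \<in> mult_op (radial_limit u) ` hardy2. cinner f g = 0}"

definition model_operator :: "(complex \<Rightarrow> complex) \<Rightarrow> l2_circle \<Rightarrow> l2_circle" where
  "model_operator u f = orth_proj (model_space u) (shift f)"

definition flip :: "(complex \<Rightarrow> complex) \<Rightarrow> complex \<Rightarrow> complex" where
  "flip f z = f (cnj z)"

text \<open>
  Elements of $H^\infty$ are functions on the whole plane of which only the values on the open unit
  disc matter, so identities between them are required on the disc only.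
\<close>

definition inner_divides :: "(complex \<Rightarrow> complex) \<Rightarrow> (complex \<Rightarrow> complex) \<Rightarrow> bool" where
  "inner_divides u v \<longleftrightarrow> (\<exists>w\<in>hardy_inf. \<forall>z\<in>ball 0 1. v z = w z * u z)"

definition is_inner_gcd ::
    "(complex \<Rightarrow> complex) \<Rightarrow> (complex \<Rightarrow> complex) \<Rightarrow> (complex \<Rightarrow> complex) \<Rightarrow> bool" where
  "is_inner_gcd d u v \<longleftrightarrow> inner_function d \<and> inner_divides d u \<and> inner_divides d v \<and>
     (\<forall>w. inner_function w \<and> inner_divides w u \<and> inner_divides w v \<longrightarrow> inner_divides w d)"

end

theory Submission
  imports Defs
begin

text \<open>
  Write $v(z) = \overline{u(\bar z)}$. On $Q_u$ the operator $S_u$ differs from multiplication by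
  $z$ only by elements of $uH^2$, and $S_u^*$ is the backward shift $f \mapsto (f - f(0))/z$.
  So if $S_u^* X = X S_u$, then $\Gamma = X P_{Q_u}$ is a Hankel operator: it vanishes on $uH^2$ and
  $\langle \Gamma(zf), h\rangle = \langle \Gamma f, zh\rangle$ for $f, h$ in $H^2$.

  An intertwining operator forces a common divisor. For a Hankel operator multiplication by any
  analytic $q$ can be moved across the inner product, where it turns into multiplication by
  $\overline{q(\bar z)}$ (\<open>hankel_range_orthogonal\<close>). For $q = u$ the left-hand side is zero, so the
  range of $X$ is orthogonal to $vH^2$; it lies in $Q_u$, so it is orthogonal to $uH^2$ too. By
  Beurling's theorem (\<open>beurling\<close>) the closure of $uH^2 + vH^2$ is $dH^2$ for an inner function $d$,
  and this $d$ is the greatest common divisor of $u$ and $v$ (\<open>inner_gcd_exists\<close>). If $d$ were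
  constant, the range of $X$ would be orthogonal to all of $H^2$, so $X$ would be zero.

  A common divisor yields an intertwining operator. If $d$ is a nonconstant inner divisor of $u$
  and $v$, then $\psi = 1 - \overline{d(0)}\,d$ is a nonzero bounded element of $Q_d$, and
  $X f = P_{H^2}(\psi(z) f(\bar z))$ is the required operator
  (\<open>intertwining_if_nonconstant_divisor\<close>): it vanishes on $uH^2$ because $d$ divides $v$, it maps into
  $Q_u$ because $d$ divides $u$, and it sends $1 - \overline{u(0)}\,u \in Q_u$ to $\psi$.

  The analytic substance is the passage between the circle and the disc. Beurling's theorem
  produces $d$ only as a unimodular element of $L^2$, while an inner function is a holomorphic
  function on the disc with radial limits almost everywhere. That the bounded extension of $d$ has
  such limits is Fatou's theorem (\<open>AE_radial_limit_disc_ext\<close>), which follows from a weak type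
  estimate for the radial maximal function (\<open>radial_maximal_inequality\<close>). Projections exist
  because $L^2$ is complete, and functions are determined by their Fourier coefficients because
  trigonometric polynomials are uniformly dense in the continuous functions. Both facts together
  give the principle used all over: a closed subspace of $L^2$ that contains every $z^n$ with
  $n \ge 0$ contains $H^2$ (\<open>hardy2_subset_closed_csubspace\<close>).
\<close>

section \<open>Fourier uniqueness on the circle\<close>

abbreviation circle_measure_notation (\<open>\<sigma>\<close>) where
  "\<sigma> \<equiv> circle_measure"

lemma continuous_imp_measurable_circle:
  fixes f :: "complex \<Rightarrow> 'b :: {second_countable_topology, real_normed_vector}"
  assumes "continuous_on (sphere 0 1) f" "sets \<mu> = sets \<sigma>"
  shows "f \<in> borel_measurable \<mu>"
  using borel_measurable_continuous_on_restrict[OF assms(1)] assms(2) sets_circle_measure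
  by (metis measurable_cong_sets)

lemma continuous_imp_integrable_circle:
  fixes f :: "complex \<Rightarrow> 'b :: {second_countable_topology, banach}"
  assumes "continuous_on (sphere 0 1) f" "sets \<mu> = sets \<sigma>" "finite_measure \<mu>"
  shows "integrable \<mu> f"
proof -
  interpret finite_measure \<mu> by fact
  have "bounded (f ` sphere 0 1)"
    by (intro compact_imp_bounded compact_continuous_image assms) auto
  then obtain B where B: "\<And>x. x \<in> sphere 0 1 \<Longrightarrow> norm (f x) \<le> B"
    unfolding bounded_iff by blast
  have "space \<mu> = sphere 0 1"
    using sets_eq_imp_space_eq[OF assms(2)] by simp
  then show ?thesis
    by (intro integrable_const_bound[where B = B] continuous_imp_measurable_circle assms AE_I2)
       (use B in auto)
qed

text \<open>
  On the circle $\bar z = z^{-1}$, so a real linear function of $z$ is $cz + \bar c z^{-1}$, and multiplying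
  by it only shifts the moments. The factor \<open>f\<close> and the quantification over \<open>k\<close> make the claim stable
  under products of polynomials.
\<close>

lemma integral_polynomial_eq_if_moments_eq:
  fixes p :: "complex \<Rightarrow> real"
  assumes fin: "finite_measure \<mu>" "finite_measure \<nu>"
    and sets: "sets \<mu> = sets \<sigma>" "sets \<nu> = sets \<sigma>"
    and p: "real_polynomial_function p"
    and f: "continuous_on (sphere 0 1) f"
    and eq: "\<And>k::int. (\<integral>z. f z * z powi k \<partial>\<mu>) = (\<integral>z. f z * z powi k \<partial>\<nu>)"
  shows "(\<integral>z. of_real (p z) * f z * z powi k \<partial>\<mu>) = (\<integral>z. of_real (p z) * f z * z powi k \<partial>\<nu>)"
  using p f eq
proof (induction p arbitrary: f k)
  case (linear g f k)
  interpret g: bounded_linear g by fact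
  define c where "c = Complex (g 1) (- g \<i>) / 2"
  have gz: "of_real (g z) = c * z + cnj c * cnj z" for z
  proof -
    have "z = Re z *\<^sub>R 1 + Im z *\<^sub>R \<i>"
      by (simp add: complex_eq_iff)
    then have "g z = g (Re z *\<^sub>R 1 + Im z *\<^sub>R \<i>)"
      by simp
    also have "\<dots> = Re z * g 1 + Im z * g \<i>"
      by (simp add: g.add g.scaleR)
    finally show ?thesis
      by (simp add: c_def complex_eq_iff field_simps)
  qed
  have cts: "continuous_on (sphere 0 1) (\<lambda>z. f z * z powi j)" for j
    by (intro continuous_intros linear) auto
  have "(\<integral>z. of_real (g z) * f z * z powi k \<partial>\<mu>')
       = c * (\<integral>z. f z * z powi (k+1) \<partial>\<mu>') + cnj c * (\<integral>z. f z * z powi (k-1) \<partial>\<mu>')"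
    if "finite_measure \<mu>'" "sets \<mu>' = sets \<sigma>" for \<mu>'
  proof -
    have sp: "space \<mu>' = sphere 0 1"
      using sets_eq_imp_space_eq[OF that(2)] by simp
    have "(\<integral>z. of_real (g z) * f z * z powi k \<partial>\<mu>')
       = (\<integral>z. c * (f z * z powi (k+1)) + cnj c * (f z * z powi (k-1)) \<partial>\<mu>')"
    proof (intro Bochner_Integration.integral_cong refl)
      fix z assume "z \<in> space \<mu>'"
      then have z: "cmod z = 1" by (simp add: sp)
      then have z0: "z \<noteq> 0" by auto
      from z have "cnj z = inverse z"
        using complex_div_cnj[of 1 z] by (simp add: divide_inverse)
      then show "of_real (g z) * f z * z powi k = c * (f z * z powi (k+1)) + cnj c * (f z * z powi (k-1))"
        using z0 by (simp add: gz power_int_add power_int_diff field_simps)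
    qed
    also have "\<dots> = c * (\<integral>z. f z * z powi (k+1) \<partial>\<mu>') + cnj c * (\<integral>z. f z * z powi (k-1) \<partial>\<mu>')"
      by (subst Bochner_Integration.integral_add)
         (auto intro!: integrable_mult_right continuous_imp_integrable_circle cts that)
    finally show ?thesis .
  qed
  then show ?case
    using fin sets linear by simp
next
  case (const c f k)
  then show ?case by (simp add: mult.assoc)
next
  case (add g h f k)
  have cts: "continuous_on (sphere 0 1) (\<lambda>z. of_real (p z) * f z * z powi k)"
    if "real_polynomial_function p" for p
    using that by (intro continuous_intros add continuous_on_subset[OF continuous_on_polymonial_function])
      (auto simp: real_polynomial_function_eq)
  show ?case
    using add.IH[OF add.prems] fin sets
    by (simp add: distrib_right Bochner_Integration.integral_add continuous_imp_integrable_circle cts add.hyps)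
next
  case (mult g h f k)
  have cts: "continuous_on (sphere 0 1) (\<lambda>z. of_real (h z) * f z)"
    using mult.hyps by (intro continuous_intros mult continuous_on_subset[OF continuous_on_polymonial_function])
      (auto simp: real_polynomial_function_eq)
  show ?case
    using mult.IH(1)[OF cts mult.IH(2)[OF mult.prems]]
    by (simp add: mult_ac)
qed

text \<open>
  Continuous functions approximate the indicator of a closed set from above, polynomials approximate the
  continuous functions uniformly, and polynomials have equal integrals. So the measures agree on
  closed sets, which generate the Borel sets.
\<close>

lemma circle_measure_eqI:
  assumes fin: "finite_measure \<mu>" "finite_measure \<nu>"
    and sets: "sets \<mu> = sets \<sigma>" "sets \<nu> = sets \<sigma>"
    and moments: "\<And>k::int. (\<integral>z. z powi k \<partial>\<mu>) = (\<integral>z. z powi k \<partial>\<nu>)"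
  shows "\<mu> = \<nu>"
proof -
  have sp: "space \<mu> = sphere 0 1" "space \<nu> = sphere 0 1"
    using sets_eq_imp_space_eq[OF sets(1)] sets_eq_imp_space_eq[OF sets(2)] by auto
  interpret \<mu>: finite_measure \<mu> by fact
  interpret \<nu>: finite_measure \<nu> by fact
  have poly: "(\<integral>z. p z \<partial>\<mu>) = (\<integral>z. p z \<partial>\<nu>)" if "real_polynomial_function p" for p :: "complex \<Rightarrow> real"
  proof -
    have "(\<integral>z. complex_of_real (p z) \<partial>\<mu>) = (\<integral>z. complex_of_real (p z) \<partial>\<nu>)"
      using integral_polynomial_eq_if_moments_eq[OF fin sets that, of "\<lambda>_. 1" 0] moments by simp
    then show ?thesis by simp
  qed
  have closed: "measure \<mu> (C \<inter> sphere 0 1) = measure \<nu> (C \<inter> sphere 0 1)" if C: "closed C" for C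
  proof (cases "C = {}")
    case False
    define f where "f n z = max 0 (1 - real n * infdist z C)" for n :: nat and z
    have cf: "continuous_on (sphere 0 1) (f n)" for n
      unfolding f_def by (intro continuous_intros)
    have f_lim: "(\<lambda>n. f n z) \<longlonglongrightarrow> indicator C z" for z
    proof (cases "z \<in> C")
      case True
      then show ?thesis by (simp add: f_def)
    next
      case zC: False
      then have pos: "infdist z C > 0"
        using C False by (metis in_closed_iff_infdist_zero infdist_nonneg less_eq_real_def)
      obtain N where N: "1 < real N * infdist z C"
        using reals_Archimedean3[OF pos] by blast
      have "f n z = 0" if "N \<le> n" for n
      proof -
        have "real N * infdist z C \<le> real n * infdist z C"
          using pos that by (intro mult_right_mono) auto
        then show ?thesis using N by (simp add: f_def)
      qed
      then have "eventually (\<lambda>n. f n z = 0) sequentially"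
        by (rule eventually_sequentiallyI)
      then show ?thesis using zC by (simp add: tendsto_eventually)
    qed
    have "\<exists>p. real_polynomial_function p \<and> (\<forall>z\<in>sphere 0 1. \<bar>f n z - p z\<bar> < inverse (real (Suc n)))" for n
      by (rule Stone_Weierstrass_real_polynomial_function[OF _ cf[of n], of "inverse (real (Suc n))"]) auto
    then obtain p where p: "\<And>n. real_polynomial_function (p n)"
      "\<And>n z. z \<in> sphere 0 1 \<Longrightarrow> \<bar>f n z - p n z\<bar> < inverse (real (Suc n))"
      by metis
    have cp: "continuous_on (sphere 0 1) (p n)" for n
      using p(1)[of n] by (intro continuous_on_subset[OF continuous_on_polymonial_function])
        (auto simp: real_polynomial_function_eq)
    have p_lim: "(\<lambda>n. p n z) \<longlonglongrightarrow> indicator C z" if "z \<in> sphere 0 1" for z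
    proof -
      have "(\<lambda>n. f n z - p n z) \<longlonglongrightarrow> 0"
        by (rule Lim_null_comparison[OF _ LIMSEQ_inverse_real_of_nat])
           (use p(2)[OF that] in \<open>auto intro!: always_eventually less_imp_le\<close>)
      from tendsto_diff[OF f_lim[of z] this] show ?thesis by simp
    qed
    have p_bound: "\<bar>p n z\<bar> \<le> 2" if "z \<in> sphere 0 1" for n z
    proof -
      have "0 \<le> f n z" "f n z \<le> 1" "inverse (real (Suc n)) \<le> 1"
        by (auto simp: f_def infdist_nonneg inverse_le_1_iff)
      then show ?thesis using p(2)[OF that, of n] by linarith
    qed
    have conv: "(\<lambda>n. \<integral>z. p n z \<partial>\<mu>') \<longlonglongrightarrow> measure \<mu>' (C \<inter> sphere 0 1)"
      if "finite_measure \<mu>'" "sets \<mu>' = sets \<sigma>" for \<mu>'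
    proof -
      interpret finite_measure \<mu>' by fact
      have sp: "space \<mu>' = sphere 0 1"
        using sets_eq_imp_space_eq[OF that(2)] by simp
      have CS: "C \<inter> sphere 0 1 \<in> sets \<mu>'"
        using C that(2) by (simp add: sets_circle_measure sets_restrict_space image_iff) (metis borel_closed inf_commute)
      have "(\<lambda>n. \<integral>z. p n z \<partial>\<mu>') \<longlonglongrightarrow> (\<integral>z. indicator (C \<inter> sphere 0 1) z \<partial>\<mu>')"
      proof (rule integral_dominated_convergence[where w = "\<lambda>_. 2"])
        show "AE z in \<mu>'. (\<lambda>n. p n z) \<longlonglongrightarrow> indicat_real (C \<inter> sphere 0 1) z"
          using p_lim by (intro AE_I2) (auto simp: sp indicator_def)
        show "AE z in \<mu>'. norm (p n z) \<le> 2" for n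
          using p_bound by (intro AE_I2) (auto simp: sp)
      qed (use CS that in \<open>auto intro!: continuous_imp_measurable_circle cp\<close>)
      then show ?thesis using CS by simp
    qed
    have "(\<lambda>n. \<integral>z. p n z \<partial>\<mu>) = (\<lambda>n. \<integral>z. p n z \<partial>\<nu>)"
      using poly p(1) by auto
    with conv[OF fin(1) sets(1)] conv[OF fin(2) sets(2)] show ?thesis
      using LIMSEQ_unique by metis
  qed auto
  have meas: "(\<lambda>z. z) \<in> borel_measurable \<mu>" "(\<lambda>z. z) \<in> borel_measurable \<nu>"
    using sets by (auto intro!: continuous_imp_measurable_circle)
  have "distr \<mu> borel (\<lambda>z. z) = distr \<nu> borel (\<lambda>z. z)"
  proof (rule measure_eqI_generator_eq[where E = "Collect closed" and \<Omega> = UNIV and A = "\<lambda>_. UNIV"])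
    show "Int_stable (Collect (closed :: complex set \<Rightarrow> bool))"
      by (auto simp: Int_stable_def)
    fix X :: "complex set" assume "X \<in> Collect closed"
    then have "closed X" by simp
    then show "emeasure (distr \<mu> borel (\<lambda>z. z)) X = emeasure (distr \<nu> borel (\<lambda>z. z)) X"
      using closed[of X] meas by (simp add: emeasure_distr sp \<mu>.emeasure_eq_measure \<nu>.emeasure_eq_measure)
  next
    show "emeasure (distr \<mu> borel (\<lambda>z. z)) UNIV \<noteq> \<infinity>" for i :: nat
      using meas by (simp add: emeasure_distr)
  qed (auto simp: borel_eq_closed sets_measure_of_conv)
  moreover have "emeasure \<mu>' A = emeasure (distr \<mu>' borel (\<lambda>z. z)) A"
    if "A \<in> sets \<sigma>" "sets \<mu>' = sets \<sigma>" for A \<mu>'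
  proof -
    have sp: "space \<mu>' = sphere 0 1"
      using sets_eq_imp_space_eq[OF that(2)] by simp
    have "A \<in> sets borel"
      using that by (auto simp: sets_circle_measure sets_restrict_space)
    moreover have "A \<subseteq> space \<mu>'"
      using that sets.sets_into_space by blast
    ultimately show ?thesis
      using that by (subst emeasure_distr) (auto intro!: continuous_imp_measurable_circle simp: Int_absorb2)
  qed
  ultimately show ?thesis
    using sets by (intro measure_eqI) auto
qed

lemma integral_circle_measure:
  fixes f :: "complex \<Rightarrow> 'b :: {banach, second_countable_topology}"
  assumes "f \<in> borel_measurable \<sigma>"
  shows "(\<integral>z. f z \<partial>\<sigma>) = (1 / (2 * pi)) *\<^sub>R (LINT t:{0..2*pi}|lborel. f (cis t))"
proof -
  have [measurable]: "cis \<in> borel \<rightarrow>\<^sub>M restrict_space borel (sphere 0 1)"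
    by (intro measurable_restrict_space2 borel_measurable_continuous_onI continuous_intros) auto
  have [measurable]: "f \<in> borel_measurable (restrict_space borel (sphere 0 1))"
    using assms by (simp add: measurable_cong_sets[OF sets_circle_measure refl])
  have "(\<integral>z. f z \<partial>\<sigma>) = (\<integral>t. f (cis t) \<partial>uniform_measure lborel {0..2 * pi})"
    unfolding circle_measure_def by (subst integral_distr) auto
  also have "uniform_measure lborel {0..2 * pi} = density lborel (\<lambda>x. ennreal (indicator {0..2 * pi} x / (2 * pi)))"
    unfolding uniform_measure_def
    by (intro arg_cong2[where f = density] ext refl) (auto simp: indicator_def divide_ennreal ennreal_1[symmetric] simp del: ennreal_1)
  also have "(\<integral>t. f (cis t) \<partial>\<dots>) = (1 / (2 * pi)) *\<^sub>R (LINT t:{0..2*pi}|lborel. f (cis t))"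
    unfolding set_lebesgue_integral_def
    by (subst integral_density) (auto simp flip: integral_scaleR_right)
  finally show ?thesis .
qed

lemma emeasure_circle_measure:
  assumes "A \<in> sets borel"
  shows "emeasure \<sigma> (A \<inter> sphere 0 1) = emeasure lborel ({0..2*pi} \<inter> cis -` A) / ennreal (2 * pi)"
proof -
  have [measurable]: "cis \<in> borel \<rightarrow>\<^sub>M restrict_space borel (sphere 0 1)"
    by (intro measurable_restrict_space2 borel_measurable_continuous_onI continuous_intros) auto
  have A: "A \<inter> sphere 0 1 \<in> sets (restrict_space borel (sphere 0 1))"
    using assms by (auto simp: sets_restrict_space)
  have c: "cis -` A \<in> sets borel"
    using assms measurable_sets[of cis borel borel A] borel_measurable_continuous_onI[OF continuous_on_cis[OF continuous_on_id]]
    by auto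
  have "emeasure \<sigma> (A \<inter> sphere 0 1) = emeasure (uniform_measure lborel {0..2 * pi}) (cis -` A)"
    unfolding circle_measure_def using A by (subst emeasure_distr) (auto simp: vimage_def)
  also have "\<dots> = emeasure lborel ({0..2*pi} \<inter> cis -` A) / ennreal (2 * pi)"
    using c by (subst emeasure_uniform_measure) auto
  finally show ?thesis .
qed

lemma circle_integral_cong:
  assumes "\<And>z. cmod z = 1 \<Longrightarrow> f z = g z"
  shows "(\<integral>z. f z \<partial>\<sigma>) = (\<integral>z. g z \<partial>\<sigma>)"
  by (rule Bochner_Integration.integral_cong) (auto simp: assms)

lemma integrable_powi_circle: "integrable \<sigma> (\<lambda>z. z powi k)"
  by (intro continuous_imp_integrable_circle finite_measure_circle_measure continuous_intros) auto

lemma measurable_powi_circle [measurable]: "(\<lambda>z. z powi k) \<in> borel_measurable \<sigma>"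
  using integrable_powi_circle[of k] by (rule borel_measurable_integrable)

lemma integral_powi_circle: "(\<integral>z. z powi k \<partial>\<sigma>) = (if k = 0 then 1 else 0)"
proof -
  have "(\<integral>z. z powi k \<partial>\<sigma>) = (1 / (2 * pi)) *\<^sub>R (LINT t:{0..2*pi}|lborel. cis t powi k)"
    by (rule integral_circle_measure) (use square_integrable_powi[of k] in \<open>simp add: square_integrable_def\<close>)
  also have "(LINT t:{0..2*pi}|lborel. cis t powi k) = (LINT t:{0..2*pi}|lborel. cis (of_int k * t))"
    by (simp add: cis_power_int)
  also have "\<dots> = (if k = 0 then 2 * pi else 0)"
  proof (cases "k = 0")
    case True
    then show ?thesis by (simp add: set_lebesgue_integral_def scaleR_conv_of_real)
  next
    case False
    have "(LINT t:{0..2*pi}|lborel. cis (of_int k * t)) =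
        cis (of_int k * (2 * pi)) / (\<i> * of_int k) - cis (of_int k * 0) / (\<i> * of_int k)"
      unfolding set_lebesgue_integral_def
    proof (rule integral_FTC_Icc)
      show "((\<lambda>t. cis (of_int k * t) / (\<i> * of_int k)) has_vector_derivative cis (of_int k * t)) (at t within {0..2*pi})" for t
      proof -
        have "((\<lambda>w. exp (\<i> * of_int k * w) / (\<i> * of_int k)) has_field_derivative exp (\<i> * of_int k * of_real t)) (at (of_real t))"
          using False by (auto intro!: derivative_eq_intros)
        from has_vector_derivative_real_field[OF this]
        have "((\<lambda>t. exp (\<i> * of_int k * of_real t) / (\<i> * of_int k)) has_vector_derivative exp (\<i> * of_int k * of_real t)) (at t within {0..2*pi})" .
        then show ?thesis by (simp add: cis_conv_exp mult.assoc)
      qed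
    qed (auto intro!: continuous_intros)
    also have "\<dots> = 0"
      using cis_multiple_2pi[of "of_int k"] by (simp add: mult.commute mult.assoc)
    finally show ?thesis using False by simp
  qed
  finally show ?thesis by (simp add: scaleR_conv_of_real)
qed

lemma measurable_circle_self:
  assumes "continuous_on (sphere 0 1) \<phi>" "\<And>z. cmod z = 1 \<Longrightarrow> cmod (\<phi> z) = 1"
  shows "\<phi> \<in> \<sigma> \<rightarrow>\<^sub>M \<sigma>"
proof -
  have "\<phi> \<in> \<sigma> \<rightarrow>\<^sub>M restrict_space borel (sphere 0 1)"
    using assms by (intro measurable_restrict_space2 continuous_imp_measurable_circle) auto
  then show ?thesis by (simp add: measurable_cong_sets[OF refl sets_circle_measure])
qed

text \<open>
  Rotation multiplies the $k$-th moment by $w^k$, and only the moment with $k = 0$ is nonzero.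
\<close>

lemma distr_rotation_circle:
  assumes w: "cmod w = 1"
  shows "distr \<sigma> \<sigma> (\<lambda>z. w * z) = \<sigma>"
proof -
  interpret finite_measure \<sigma> by (rule finite_measure_circle_measure)
  have m [measurable]: "(\<lambda>z. w * z) \<in> \<sigma> \<rightarrow>\<^sub>M \<sigma>"
    using w by (intro measurable_circle_self continuous_intros) (auto simp: norm_mult)
  show ?thesis
  proof (rule circle_measure_eqI)
    fix k :: int
    have "(\<integral>z. z powi k \<partial>distr \<sigma> \<sigma> (\<lambda>z. w * z)) = w powi k * (\<integral>z. z powi k \<partial>\<sigma>)"
      by (subst integral_distr) (auto simp: power_int_mult_distrib)
    then show "(\<integral>z. z powi k \<partial>distr \<sigma> \<sigma> (\<lambda>z. w * z)) = (\<integral>z. z powi k \<partial>\<sigma>)"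
      by (simp add: integral_powi_circle)
  qed (auto intro!: finite_measure_distr finite_measure_circle_measure)
qed

lemma distr_cnj_circle: "distr \<sigma> \<sigma> cnj = \<sigma>"
proof -
  interpret finite_measure \<sigma> by (rule finite_measure_circle_measure)
  have m [measurable]: "cnj \<in> \<sigma> \<rightarrow>\<^sub>M \<sigma>"
    by (intro measurable_circle_self continuous_intros) auto
  show ?thesis
  proof (rule circle_measure_eqI)
    fix k :: int
    have "(\<integral>z. z powi k \<partial>distr \<sigma> \<sigma> cnj) = cnj (\<integral>z. z powi k \<partial>\<sigma>)"
      by (subst integral_distr) (auto simp flip: Bochner_Integration.integral_cnj)
    then show "(\<integral>z. z powi k \<partial>distr \<sigma> \<sigma> cnj) = (\<integral>z. z powi k \<partial>\<sigma>)"
      by (simp add: integral_powi_circle)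
  qed (auto intro!: finite_measure_distr finite_measure_circle_measure)
qed

text \<open>
  The measures with densities $f^+$ and $f^-$ have the same moments, so they are equal.
\<close>

lemma AE_eq_0_if_fourier_coeffs_0_real:
  fixes f :: "complex \<Rightarrow> real"
  assumes f: "integrable \<sigma> f"
    and coeffs: "\<And>k::int. (\<integral>z. of_real (f z) * z powi k \<partial>\<sigma>) = 0"
  shows "AE z in \<sigma>. f z = 0"
proof -
  interpret finite_measure \<sigma> by (rule finite_measure_circle_measure)
  have [measurable]: "f \<in> borel_measurable \<sigma>"
    using f by auto
  have int: "integrable \<sigma> (\<lambda>z. g z *\<^sub>R z powi k)" if g: "integrable \<sigma> g" for g :: "complex \<Rightarrow> real" and k
  proof (rule Bochner_Integration.integrable_bound[OF g])
    show "AE z in \<sigma>. norm (g z *\<^sub>R z powi k) \<le> norm (g z)"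
      by (intro AE_I2) (auto simp: norm_power_int)
  qed (use g in measurable)
  have ip: "integrable \<sigma> (\<lambda>z. max 0 (f z))" and im: "integrable \<sigma> (\<lambda>z. max 0 (- f z))"
    using f by auto
  have "density \<sigma> (\<lambda>z. ennreal (max 0 (f z))) = density \<sigma> (\<lambda>z. ennreal (max 0 (- f z)))"
  proof (rule circle_measure_eqI)
    fix k :: int
    have "(\<integral>z. max 0 (f z) *\<^sub>R z powi k \<partial>\<sigma>) - (\<integral>z. max 0 (- f z) *\<^sub>R z powi k \<partial>\<sigma>)
        = (\<integral>z. of_real (f z) * z powi k \<partial>\<sigma>)"
      by (subst Bochner_Integration.integral_diff[symmetric, OF int[OF ip] int[OF im]])
         (auto intro!: Bochner_Integration.integral_cong simp: max_def scaleR_conv_of_real)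
    then show "(\<integral>z. z powi k \<partial>density \<sigma> (\<lambda>z. ennreal (max 0 (f z)))) =
        (\<integral>z. z powi k \<partial>density \<sigma> (\<lambda>z. ennreal (max 0 (- f z))))"
      by (simp add: integral_density coeffs)
  next
    show "finite_measure (density \<sigma> (\<lambda>z. ennreal (max 0 (f z))))"
      "finite_measure (density \<sigma> (\<lambda>z. ennreal (max 0 (- f z))))"
      using ip im
      by (auto intro!: finite_measureI simp del: space_circle_measure
          simp: emeasure_density[OF _ sets.top] integrable_iff_bounded less_top cong: nn_integral_cong)
  qed auto
  then have "AE z in \<sigma>. ennreal (max 0 (f z)) = ennreal (max 0 (- f z))"
    by (subst (asm) density_unique_iff) auto
  then show ?thesis
    by eventually_elim (auto simp: max_def split: if_splits)
qed

lemma AE_eq_0_if_fourier_coeffs_0: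
  fixes f :: "complex \<Rightarrow> complex"
  assumes f: "integrable \<sigma> f"
    and coeffs: "\<And>k::int. (\<integral>z. f z * z powi k \<partial>\<sigma>) = 0"
  shows "AE z in \<sigma>. f z = 0"
proof -
  have [measurable]: "f \<in> borel_measurable \<sigma>"
    using f by auto
  have int: "integrable \<sigma> (\<lambda>z. f z * z powi k)" for k
  proof (rule Bochner_Integration.integrable_bound[OF f])
    show "AE z in \<sigma>. norm (f z * z powi k) \<le> norm (f z)"
      by (intro AE_I2) (auto simp: norm_mult norm_power_int)
  qed measurable
  have int': "integrable \<sigma> (\<lambda>z. cnj (f z) * z powi k)" for k
  proof (rule Bochner_Integration.integrable_bound[OF f])
    show "AE z in \<sigma>. norm (cnj (f z) * z powi k) \<le> norm (f z)"
      by (intro AE_I2) (auto simp: norm_mult norm_power_int)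
  qed measurable
  have coeffs': "(\<integral>z. cnj (f z) * z powi k \<partial>\<sigma>) = 0" for k
  proof -
    have "(\<integral>z. cnj (f z) * z powi k \<partial>\<sigma>) = (\<integral>z. cnj (f z * z powi (-k)) \<partial>\<sigma>)"
    proof (rule circle_integral_cong)
      fix z :: complex assume "cmod z = 1"
      then have "cnj z = inverse z"
        using complex_div_cnj[of 1 z] by (simp add: divide_inverse)
      then show "cnj (f z) * z powi k = cnj (f z * z powi (-k))"
        by (simp add: complex_cnj_power_int power_int_minus power_int_inverse)
    qed
    also have "\<dots> = cnj (\<integral>z. f z * z powi (-k) \<partial>\<sigma>)"
      by (rule Bochner_Integration.integral_cnj)
    also have "\<dots> = 0" by (simp only: coeffs complex_cnj_zero)
    finally show ?thesis .
  qed
  have "AE z in \<sigma>. Re (f z) = 0"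
  proof (rule AE_eq_0_if_fourier_coeffs_0_real)
    have "(\<integral>z. of_real (Re (f z)) * z powi k \<partial>\<sigma>)
        = (\<integral>z. (f z * z powi k + cnj (f z) * z powi k) / 2 \<partial>\<sigma>)" for k
      by (intro Bochner_Integration.integral_cong refl) (simp add: complex_add_cnj flip: distrib_right)
    then show "(\<integral>z. of_real (Re (f z)) * z powi k \<partial>\<sigma>) = 0" for k
      by (simp add: int int' coeffs coeffs')
  qed (use f in auto)
  moreover have "AE z in \<sigma>. Im (f z) = 0"
  proof (rule AE_eq_0_if_fourier_coeffs_0_real)
    have "(\<integral>z. of_real (Im (f z)) * z powi k \<partial>\<sigma>)
        = (\<integral>z. (f z * z powi k - cnj (f z) * z powi k) / (2 * \<i>) \<partial>\<sigma>)" for k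
      by (intro Bochner_Integration.integral_cong refl) (simp add: complex_diff_cnj field_simps flip: left_diff_distrib)
    then show "(\<integral>z. of_real (Im (f z)) * z powi k \<partial>\<sigma>) = 0" for k
      by (simp add: int int' coeffs coeffs')
  qed (use f in auto)
  ultimately show ?thesis
    by eventually_elim (simp add: complex_eq_iff)
qed

interpretation circle: finite_measure \<sigma>
  by (rule finite_measure_circle_measure)

lemma measure_circle [simp]: "measure \<sigma> (sphere 0 1) = 1"
proof -
  have "complex_of_real (measure \<sigma> (sphere 0 1)) = (\<integral>z. z powi 0 \<partial>\<sigma>)"
    by (simp add: scaleR_conv_of_real)
  then show ?thesis
    by (simp only: integral_powi_circle) simp
qed

section \<open>The Hilbert space $L^2$\<close>

subsection \<open>Representatives\<close>

abbreviation rep :: "l2_circle \<Rightarrow> complex \<Rightarrow> complex" where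
  "rep \<equiv> rep_l2_circle"

lemma abs_rep_l2 [simp]: "abs_l2_circle (rep f) = f"
  by (rule Quotient3_abs_rep[OF Quotient3_l2_circle])

lemma square_integrable_rep [simp]: "square_integrable (rep f)"
  using Quotient3_rep_reflp[OF Quotient3_l2_circle, of f] by (simp add: l2_eq_def)

lemma measurable_rep_l2 [measurable]: "rep f \<in> borel_measurable \<sigma>"
  using square_integrable_rep[of f] by (simp add: square_integrable_def)

lemma l2_eq_refl_iff [simp]: "l2_eq f f \<longleftrightarrow> square_integrable f"
  by (simp add: l2_eq_def)

lemma abs_l2_eq_iff:
  "square_integrable f \<Longrightarrow> square_integrable g \<Longrightarrow>
     abs_l2_circle f = abs_l2_circle g \<longleftrightarrow> (AE z in \<sigma>. f z = g z)"
  using Quotient3_rel[OF Quotient3_l2_circle, of f g] by (simp add: l2_eq_def)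

lemma rep_abs_l2: "square_integrable f \<Longrightarrow> AE z in \<sigma>. rep (abs_l2_circle f) z = f z"
  using abs_l2_eq_iff[of "rep (abs_l2_circle f)" f] by simp

lemma l2_eqI: "(AE z in \<sigma>. rep f z = rep g z) \<Longrightarrow> f = g"
  using abs_l2_eq_iff[of "rep f" "rep g"] by simp

lemma rep_add_l2: "AE z in \<sigma>. rep (f + g) z = rep f z + rep g z"
  using rep_abs_l2[OF square_integrable_add[of "rep f" "rep g"]]
    plus_l2_circle.abs_eq[of "rep f" "rep g"] by simp

lemma rep_diff_l2: "AE z in \<sigma>. rep (f - g) z = rep f z - rep g z"
  using rep_abs_l2[OF square_integrable_diff[of "rep f" "rep g"]]
    minus_l2_circle.abs_eq[of "rep f" "rep g"] by simp

lemma rep_scaleC_l2: "AE z in \<sigma>. rep (c *\<^sub>C f) z = c * rep f z"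
  using rep_abs_l2[OF square_integrable_scale[of "rep f" c]]
    scaleC.abs_eq[of "rep f" c] by simp

lemma rep_zero_l2: "AE z in \<sigma>. rep 0 z = 0"
  using rep_abs_l2[OF square_integrable_zero] by (simp add: zero_l2_circle_def)

text \<open>
  Elements of $L^2$ are handled through their representatives, each operation being known only almost
  everywhere; this turns such information into a formula for the inner product.
\<close>

lemma cinner_eq_integral:
  assumes "AE z in \<sigma>. rep f z = F z" "AE z in \<sigma>. rep g z = G z"
    and [measurable]: "F \<in> borel_measurable \<sigma>" "G \<in> borel_measurable \<sigma>"
  shows "cinner f g = (\<integral>z. F z * cnj (G z) \<partial>\<sigma>)"
proof -
  have "cinner f g = (\<integral>z. rep f z * cnj (rep g z) \<partial>\<sigma>)"
    using cinner.abs_eq[of "rep f" "rep g"] by simp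
  also have "\<dots> = (\<integral>z. F z * cnj (G z) \<partial>\<sigma>)"
    using assms(1,2) by (intro integral_cong_AE) (auto elim: eventually_elim2)
  finally show ?thesis .
qed

lemma cinner_rep:
  "cinner f g = (\<integral>z. rep f z * cnj (rep g z) \<partial>\<sigma>)"
  by (rule cinner_eq_integral) auto

subsection \<open>The inner product\<close>

lemma scaleC_add_right: "c *\<^sub>C (f + g) = c *\<^sub>C f + c *\<^sub>C g"
  using rep_scaleC_l2[of c "f + g"] rep_add_l2[of f g] rep_add_l2[of "c *\<^sub>C f" "c *\<^sub>C g"]
    rep_scaleC_l2[of c f] rep_scaleC_l2[of c g]
  by (intro l2_eqI, eventually_elim) (simp add: algebra_simps)

lemma scaleC_scaleC [simp]: "c *\<^sub>C d *\<^sub>C f = (c * d) *\<^sub>C f"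
  using rep_scaleC_l2[of c "d *\<^sub>C f"] rep_scaleC_l2[of d f] rep_scaleC_l2[of "c * d" f]
  by (intro l2_eqI, eventually_elim) simp

lemma scaleC_1 [simp]: "1 *\<^sub>C f = f"
  using scaleR_conv_scaleC[of 1 f] by simp

lemma scaleC_0_left [simp]: "0 *\<^sub>C f = 0"
  using scaleR_conv_scaleC[of 0 f] by simp

lemma scaleC_minus1: "(-1) *\<^sub>C f = - f"
  using scaleR_conv_scaleC[of "-1" f] by simp

lemma cinner_zero_left [simp]: "cinner 0 g = 0"
  using cinner_scaleC_left[of 0 0 g] by simp

lemma cinner_zero_right [simp]: "cinner f 0 = 0"
  using cinner_commute[of f 0] by simp

lemma cinner_minus_left: "cinner (- f) g = - cinner f g"
  using cinner_scaleC_left[of "-1" f g] by (simp add: scaleC_minus1)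

lemma cinner_diff_left: "cinner (f - g) h = cinner f h - cinner g h"
  using cinner_add_left[of f "-g" h] by (simp add: cinner_minus_left)

lemma cinner_add_right: "cinner f (g + h) = cinner f g + cinner f h"
  by (subst (1 2 3) cinner_commute) (simp add: cinner_add_left)

lemma cinner_diff_right: "cinner f (g - h) = cinner f g - cinner f h"
  by (subst (1 2 3) cinner_commute) (simp add: cinner_diff_left)

lemma cinner_scaleC_right: "cinner f (c *\<^sub>C g) = cnj c * cinner f g"
  by (subst (1 2) cinner_commute) (simp add: cinner_scaleC_left)

lemma cinner_self: "cinner f f = of_real ((norm f)\<^sup>2)"
proof -
  have "cnj (cinner f f) = cinner f f"
    using cinner_commute[of f f] by simp
  then have "Im (cinner f f) = 0"
    by (simp add: complex_eq_iff)
  then show ?thesis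
    by (simp add: complex_eq_iff power2_norm_eq_inner inner_l2_circle_def)
qed

lemma norm_l2_sq: "(norm f)\<^sup>2 = (\<integral>z. (cmod (rep f z))\<^sup>2 \<partial>\<sigma>)"
proof -
  have "complex_of_real ((norm f)\<^sup>2) = (\<integral>z. of_real ((cmod (rep f z))\<^sup>2) \<partial>\<sigma>)"
    unfolding cinner_self[symmetric] cinner_rep by (simp add: complex_norm_square del: of_real_power)
  also have "\<dots> = of_real (\<integral>z. (cmod (rep f z))\<^sup>2 \<partial>\<sigma>)"
    using square_integrable_rep[of f] by (intro integral_of_real) (simp add: square_integrable_def)
  finally show ?thesis by (simp only: of_real_eq_iff)
qed

lemma norm_scaleC [simp]: "norm (c *\<^sub>C f) = cmod c * norm f"
proof -
  have "complex_of_real ((norm (c *\<^sub>C f))\<^sup>2) = of_real ((cmod c * norm f)\<^sup>2)"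
    unfolding cinner_self[symmetric] of_real_mult power_mult_distrib complex_norm_square
    by (simp add: cinner_scaleC_left cinner_scaleC_right)
  then show ?thesis
    by (simp only: of_real_eq_iff) (metis abs_norm_cancel mult_nonneg_nonneg norm_ge_zero power2_eq_iff_nonneg)
qed

text \<open>
  Rotating \<open>f\<close> by a unimodular constant makes the inner product real, and then the real Cauchy-Schwarz
  inequality applies.
\<close>

lemma cmod_cinner_le: "cmod (cinner f g) \<le> norm f * norm g"
proof (cases "cinner f g = 0")
  case False
  \<comment> \<open>the unimodular constant that makes the product real and nonnegative\<close>
  define a where "a = cnj (cinner f g) / of_real (cmod (cinner f g))"
  have a: "cmod a = 1" using False by (simp add: a_def norm_divide)
  have "cmod (cinner f g) = Re (a * cinner f g)"
    using False by (simp add: a_def complex_norm_square[symmetric] mult.commute[of "cnj _"] power2_eq_square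
       flip: of_real_mult of_real_divide)
  also have "\<dots> = inner (a *\<^sub>C f) g"
    by (simp add: inner_l2_circle_def cinner_scaleC_left)
  also have "\<dots> \<le> norm (a *\<^sub>C f) * norm g"
    by (rule norm_cauchy_schwarz)
  finally show ?thesis by (simp add: a)
qed auto

lemma bounded_linear_cinner_left: "bounded_linear (\<lambda>f. cinner f g)"
  by (rule bounded_linear_intro[where K = "norm g"])
     (auto simp: cinner_add_left scaleR_conv_scaleC cinner_scaleC_left scaleR_conv_of_real cmod_cinner_le)

lemma bounded_linear_cinner_right: "bounded_linear (\<lambda>g. cinner f g)"
  by (rule bounded_linear_intro[where K = "norm f"])
     (auto simp: cinner_add_right scaleR_conv_scaleC cinner_scaleC_right scaleR_conv_of_real mult.commute
       intro: order.trans[OF cmod_cinner_le])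

text \<open>
  The circle has total mass 1, so the $L^1$ norm is bounded by the $L^2$ norm: pair $|f|$ with the constant 1.
\<close>

lemma integrable_rep: "integrable \<sigma> (rep f)"
  "(\<integral>z. cmod (rep f z) \<partial>\<sigma>) \<le> norm f"
proof -
  define a where "a = abs_l2_circle (\<lambda>z. of_real (cmod (rep f z)))"
  define b where "b = abs_l2_circle (\<lambda>z. 1)"
  have sq: "square_integrable (\<lambda>z. of_real (cmod (rep f z)))" "square_integrable (\<lambda>z. 1)"
    using square_integrable_rep[of f] by (auto simp: square_integrable_def)
  note a = rep_abs_l2[OF sq(1), folded a_def] and b = rep_abs_l2[OF sq(2), folded b_def]
  show "integrable \<sigma> (rep f)"
    using square_integrable_times_cnj[OF square_integrable_rep[of f] sq(2)] by simp
  have "(norm a)\<^sup>2 = (norm f)\<^sup>2" unfolding norm_l2_sq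
    using a by (intro integral_cong_AE) (auto elim: eventually_mono)
  then have na: "norm a = norm f" by simp
  have "(norm b)\<^sup>2 = (\<integral>z. 1 \<partial>\<sigma>)" unfolding norm_l2_sq
    using b by (intro integral_cong_AE) (auto elim: eventually_mono)
  then have nb: "norm b = 1" by (simp add: power2_eq_1_iff)  (metis norm_ge_zero not_one_le_zero neg_0_le_iff_le power2_eq_1_iff)
  have "cinner a b = of_real (\<integral>z. cmod (rep f z) \<partial>\<sigma>)"
    by (subst cinner_eq_integral[OF a b]) auto
  then have "\<bar>\<integral>z. cmod (rep f z) \<partial>\<sigma>\<bar> \<le> norm f"
    using cmod_cinner_le[of a b] by (simp add: na nb)
  then show "(\<integral>z. cmod (rep f z) \<partial>\<sigma>) \<le> norm f"
    by simp
qed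

subsection \<open>Completeness\<close>

text \<open>
  The increments are summable in $L^1$, hence summable almost everywhere, which gives a pointwise limit;
  Fatou's lemma then bounds its $L^2$ distance to the terms of the sequence.
\<close>

lemma l2_rapidly_Cauchy_convergent:
  fixes X :: "nat \<Rightarrow> l2_circle"
  assumes X: "\<And>m n. m \<le> n \<Longrightarrow> norm (X n - X m) \<le> 2 * (1/2) ^ m"
  shows "convergent X"
proof -
  define F where "F n = rep (X n)" for n
  have [measurable]: "F n \<in> borel_measurable \<sigma>" for n
    by (simp add: F_def)
  have intF: "integrable \<sigma> (F n)" for n
    by (simp add: F_def integrable_rep)
  have diff: "AE z in \<sigma>. rep (X n - X m) z = F n z - F m z" for m n
    unfolding F_def by (rule rep_diff_l2)
  have L1: "(\<integral>\<^sup>+z. ennreal (cmod (F (Suc n) z - F n z)) \<partial>\<sigma>) \<le> ennreal (2 * (1/2)^n)" for n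
  proof -
    have "(\<integral>z. cmod (F (Suc n) z - F n z) \<partial>\<sigma>)
        = (\<integral>z. cmod (rep (X (Suc n) - X n) z) \<partial>\<sigma>)"
      using diff[of "Suc n" n] by (intro integral_cong_AE) (auto elim: eventually_mono)
    also have "\<dots> \<le> 2 * (1/2)^n"
      using integrable_rep(2)[of "X (Suc n) - X n"] X[of n "Suc n"] by simp
    finally show ?thesis
      using intF by (subst nn_integral_eq_integral) auto
  qed
  have "(\<integral>\<^sup>+z. (\<Sum>n. ennreal (cmod (F (Suc n) z - F n z))) \<partial>\<sigma>)
      = (\<Sum>n. \<integral>\<^sup>+z. ennreal (cmod (F (Suc n) z - F n z)) \<partial>\<sigma>)"
    by (rule nn_integral_suminf) auto
  also have "\<dots> \<le> (\<Sum>n. ennreal (2 * (1/2)^n))"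
    by (intro suminf_le L1) auto
  also have "\<dots> = ennreal (\<Sum>n. 2 * (1/2)^n)"
    by (intro suminf_ennreal2 summable_mult summable_geometric) auto
  finally have "(\<integral>\<^sup>+z. (\<Sum>n. ennreal (cmod (F (Suc n) z - F n z))) \<partial>\<sigma>) \<noteq> \<infinity>"
    by (auto simp: top_unique)
  then have "AE z in \<sigma>. (\<Sum>n. ennreal (cmod (F (Suc n) z - F n z))) \<noteq> \<infinity>"
    by (intro nn_integral_noteq_infinite) auto
  then have conv: "AE z in \<sigma>. convergent (\<lambda>n. F n z)"
  proof eventually_elim
    fix z assume "(\<Sum>n. ennreal (cmod (F (Suc n) z - F n z))) \<noteq> \<infinity>"
    then have "summable (\<lambda>n. cmod (F (Suc n) z - F n z))"
      by (intro summable_suminf_not_top) auto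
    then have "summable (\<lambda>n. F (Suc n) z - F n z)"
      by (rule summable_norm_cancel)
    then have "convergent (\<lambda>n. \<Sum>i<n. F (Suc i) z - F i z)"
      by (simp add: summable_iff_convergent)
    moreover have "(\<lambda>n. \<Sum>i<n. F (Suc i) z - F i z) = (\<lambda>n. F n z - F 0 z)"
      using sum_lessThan_telescope[of "\<lambda>i. F i z"] by blast
    ultimately have "convergent (\<lambda>n. F n z - F 0 z)"
      by (simp only:)
    then show "convergent (\<lambda>n. F n z)"
      using convergent_add[OF _ convergent_const[of "F 0 z"], of "\<lambda>n. F n z - F 0 z"] by simp
  qed
  define G where "G z = lim (\<lambda>n. F n z)" for z
  have [measurable]: "G \<in> borel_measurable \<sigma>"
    unfolding G_def by measurable
  have lim: "AE z in \<sigma>. (\<lambda>n. F n z) \<longlonglongrightarrow> G z"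
    using conv by eventually_elim (simp add: G_def convergent_LIMSEQ_iff)
  have bound: "(\<integral>\<^sup>+z. ennreal ((cmod (G z - F m z))\<^sup>2) \<partial>\<sigma>) \<le> ennreal ((2 * (1/2)^m)\<^sup>2)" for m
  proof -
    have "(\<integral>\<^sup>+z. ennreal ((cmod (G z - F m z))\<^sup>2) \<partial>\<sigma>)
        = (\<integral>\<^sup>+z. liminf (\<lambda>n. ennreal ((cmod (F n z - F m z))\<^sup>2)) \<partial>\<sigma>)"
    proof (rule nn_integral_cong_AE)
      show "AE z in \<sigma>. ennreal ((cmod (G z - F m z))\<^sup>2) = liminf (\<lambda>n. ennreal ((cmod (F n z - F m z))\<^sup>2))"
        using lim
      proof eventually_elim
        case (elim z)
        then have "(\<lambda>n. ennreal ((cmod (F n z - F m z))\<^sup>2)) \<longlonglongrightarrow> ennreal ((cmod (G z - F m z))\<^sup>2)"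
          by (intro tendsto_ennrealI tendsto_intros)
        then show ?case by (intro lim_imp_Liminf[symmetric]) auto
      qed
    qed
    also have "\<dots> \<le> liminf (\<lambda>n. \<integral>\<^sup>+z. ennreal ((cmod (F n z - F m z))\<^sup>2) \<partial>\<sigma>)"
      by (rule nn_integral_liminf) auto
    also have "\<dots> \<le> ennreal ((2 * (1/2)^m)\<^sup>2)"
    proof (rule Liminf_le)
      show "eventually (\<lambda>n. (\<integral>\<^sup>+z. ennreal ((cmod (F n z - F m z))\<^sup>2) \<partial>\<sigma>) \<le> ennreal ((2 * (1/2)^m)\<^sup>2)) sequentially"
      proof (rule eventually_sequentiallyI[of m])
        fix n assume "m \<le> n"
        have "(\<integral>\<^sup>+z. ennreal ((cmod (F n z - F m z))\<^sup>2) \<partial>\<sigma>)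
          = (\<integral>\<^sup>+z. ennreal ((cmod (rep (X n - X m) z))\<^sup>2) \<partial>\<sigma>)"
          using diff[of n m] by (intro nn_integral_cong_AE) (auto elim: eventually_mono)
        also have "\<dots> = ennreal ((norm (X n - X m))\<^sup>2)"
          unfolding norm_l2_sq using square_integrable_rep[of "X n - X m"]
          by (subst nn_integral_eq_integral) (auto simp: square_integrable_def)
        also have "\<dots> \<le> ennreal ((2 * (1/2)^m)\<^sup>2)"
          using X[OF \<open>m \<le> n\<close>] by (intro ennreal_leI power_mono) auto
        finally show "(\<integral>\<^sup>+z. ennreal ((cmod (F n z - F m z))\<^sup>2) \<partial>\<sigma>) \<le> ennreal ((2 * (1/2)^m)\<^sup>2)" .
      qed
    qed auto
    finally show ?thesis .
  qed
  have sqd: "square_integrable (\<lambda>z. G z - F m z)" for m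
    using bound[of m] unfolding square_integrable_def
    by (auto intro!: integrableI_bounded simp: le_less_trans[OF _ ennreal_less_top])
  have sqG: "square_integrable G"
    using square_integrable_add[OF sqd[of 0] square_integrable_rep[of "X 0"]] by (simp add: F_def)
  define g where "g = abs_l2_circle G"
  have repg: "AE z in \<sigma>. rep g z = G z"
    unfolding g_def by (rule rep_abs_l2[OF sqG])
  have "norm (X m - g) \<le> 2 * (1/2)^m" for m
  proof -
    have "(norm (g - X m))\<^sup>2 = (\<integral>z. (cmod (G z - F m z))\<^sup>2 \<partial>\<sigma>)"
      unfolding norm_l2_sq using rep_diff_l2[of g "X m"] repg
      by (intro integral_cong_AE) (auto simp: F_def elim: eventually_elim2)
    then have "ennreal ((norm (g - X m))\<^sup>2) \<le> ennreal ((2 * (1/2)^m)\<^sup>2)"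
      using bound[of m] sqd[of m] by (subst (asm) nn_integral_eq_integral) (auto simp: square_integrable_def)
    then have "(norm (g - X m))\<^sup>2 \<le> (2 * (1/2)^m)\<^sup>2"
      by (subst (asm) ennreal_le_iff) auto
    then show ?thesis
      by (subst norm_minus_commute) (rule power2_le_imp_le, auto)
  qed
  moreover have "(\<lambda>m. 2 * (1/2::real)^m) \<longlonglongrightarrow> 0"
    using tendsto_mult_right_zero[OF LIMSEQ_power_zero[of "1/2::real"], of 2] by simp
  ultimately have "(\<lambda>m. X m - g) \<longlonglongrightarrow> 0"
    by (intro Lim_null_comparison[of "\<lambda>m. X m - g" "\<lambda>m. 2 * (1/2::real)^m"]) auto
  then have "X \<longlonglongrightarrow> g" by (simp add: LIM_zero_iff)
  then show ?thesis by (auto simp: convergent_def)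
qed

lemma l2_circle_Cauchy_convergent:
  fixes X :: "nat \<Rightarrow> l2_circle"
  assumes X: "Cauchy X"
  shows "convergent X"
proof -
  have "\<forall>k. \<exists>N. \<forall>m\<ge>N. \<forall>n\<ge>N. norm (X m - X n) < (1/2)^k"
    using X by (auto simp: Cauchy_iff)
  then obtain N where N: "\<And>k m n. m \<ge> N k \<Longrightarrow> n \<ge> N k \<Longrightarrow> norm (X m - X n) < (1/2)^k"
    by metis
  \<comment> \<open>a strictly increasing choice of indices with $s_k \ge N_k$\<close>
  define s where "s k = (\<Sum>i\<le>k. Suc (N i))" for k
  have s: "strict_mono s" by (rule strict_monoI_Suc) (simp add: s_def)
  have sN: "N k \<le> s k" for k
    unfolding s_def by (rule order.trans[OF _ member_le_sum[of k]]) auto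
  have "norm (X (s n) - X (s m)) \<le> 2 * (1/2)^m" if "m \<le> n" for m n
  proof -
    have "s m \<le> s n" using s that by (simp add: strict_mono_less_eq)
    then have "norm (X (s n) - X (s m)) < (1/2)^m"
      using sN[of m] by (intro N) auto
    then show ?thesis by (simp add: order.trans[OF less_imp_le])
  qed
  then have "convergent (X \<circ> s)"
    by (intro l2_rapidly_Cauchy_convergent) auto
  then show ?thesis
    using Cauchy_converges_subseq[OF X s] by (auto simp: convergent_def)
qed

instance l2_circle :: complete_space
  by standard (rule l2_circle_Cauchy_convergent)

subsection \<open>Closed subspaces\<close>

definition closed_csubspace :: "l2_circle set \<Rightarrow> bool" where
  "closed_csubspace S \<longleftrightarrow> closed S \<and> 0 \<in> S \<and> (\<forall>f\<in>S. \<forall>g\<in>S. f + g \<in> S) \<and> (\<forall>c. \<forall>f\<in>S. c *\<^sub>C f \<in> S)"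

lemma closed_csubspaceD:
  assumes "closed_csubspace S"
  shows "closed S" "0 \<in> S" "f \<in> S \<Longrightarrow> g \<in> S \<Longrightarrow> f + g \<in> S" "f \<in> S \<Longrightarrow> c *\<^sub>C f \<in> S"
    "f \<in> S \<Longrightarrow> g \<in> S \<Longrightarrow> f - g \<in> S"
proof -
  show add: "f + g \<in> S" if "f \<in> S" "g \<in> S" for f g
    using assms that by (auto simp: closed_csubspace_def)
  show scale: "c *\<^sub>C f \<in> S" if "f \<in> S" for c f
    using assms that by (auto simp: closed_csubspace_def)
  show "f - g \<in> S" if "f \<in> S" "g \<in> S"
    using add[OF that(1) scale[OF that(2), of "-1"]] by (simp add: scaleC_minus1)
qed (use assms in \<open>auto simp: closed_csubspace_def\<close>)

text \<open>
  The condition on scalars is weaker than complex linearity so that it also covers conjugate linear functionals.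
\<close>

lemma closed_csubspace_kernel:
  fixes L :: "l2_circle \<Rightarrow> complex"
  assumes "bounded_linear L" "\<And>c f. L f = 0 \<Longrightarrow> L (c *\<^sub>C f) = 0"
  shows "closed_csubspace {f. L f = 0}"
proof -
  interpret bounded_linear L by fact
  have "closed {f. L f = 0}"
    by (intro closed_Collect_eq continuous_on continuous_on_id continuous_on_const)
  then show ?thesis
    using assms(2) by (auto simp: closed_csubspace_def add zero)
qed

lemma closed_csubspace_Int: "closed_csubspace S \<Longrightarrow> closed_csubspace T \<Longrightarrow> closed_csubspace (S \<inter> T)"
  by (auto simp: closed_csubspace_def)

lemma closed_csubspace_INT: "(\<And>i. closed_csubspace (S i)) \<Longrightarrow> closed_csubspace (\<Inter>i\<in>A. S i)"
  by (auto simp: closed_csubspace_def intro!: closed_INT)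

text \<open>
  A sequence in \<open>S\<close> that minimizes the distance to \<open>f\<close> is Cauchy by the parallelogram law. The residual of its
  limit is orthogonal to \<open>S\<close>, for otherwise a step along \<open>S\<close> would decrease the distance.
\<close>

lemma orthogonal_projection_exists:
  assumes S: "closed_csubspace S"
  obtains g where "g \<in> S" "\<And>h. h \<in> S \<Longrightarrow> cinner (f - g) h = 0"
proof -
  note S' = closed_csubspaceD[OF S]
  define \<delta> where "\<delta> = infdist f S"
  have d0: "\<delta> \<ge> 0" by (simp add: \<delta>_def infdist_nonneg)
  have ld: "\<delta> \<le> norm (f - h)" if "h \<in> S" for h
    using infdist_le[OF that, of f] by (simp add: \<delta>_def dist_norm)
  have "\<exists>g\<in>S. norm (f - g) < \<delta> + inverse (real (Suc n))" for n
  proof (rule ccontr)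
    assume "\<not> ?thesis"
    then have "\<delta> + inverse (real (Suc n)) \<le> norm (f - g)" if "g \<in> S" for g
      using that by force
    then have "\<delta> + inverse (real (Suc n)) \<le> infdist f S"
      using S'(2) by (subst infdist_notempty) (auto intro!: cINF_greatest simp: dist_norm)
    then show False by (simp add: \<delta>_def)
  qed
  then obtain G where G: "\<And>n. G n \<in> S" "\<And>n. norm (f - G n) < \<delta> + inverse (real (Suc n))"
    by metis
  have par: "(norm (G m - G n))\<^sup>2 \<le> 2 * (norm (f - G m))\<^sup>2 + 2 * (norm (f - G n))\<^sup>2 - 4 * \<delta>\<^sup>2" for m n
  proof -
    define a b where "a = f - G m" and "b = f - G n"
    \<comment> \<open>the midpoint lies in \<open>S\<close>, so its distance to \<open>f\<close> is at least \<open>\<delta>\<close>\<close>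
    define h where "h = (1/2) *\<^sub>C (G m + G n)"
    have h: "h \<in> S" using G S' by (simp add: h_def)
    have "h = (1/2) *\<^sub>R (G m + G n)" by (simp add: h_def scaleR_conv_scaleC)
    then have ab: "a + b = 2 *\<^sub>R (f - h)"
      by (simp add: a_def b_def algebra_simps scaleR_2)
    have "(norm (a + b))\<^sup>2 = 4 * (norm (f - h))\<^sup>2"
      unfolding ab by (simp add: power_mult_distrib)
    moreover have "(norm (f - h))\<^sup>2 \<ge> \<delta>\<^sup>2"
      using ld[OF h] d0 by (intro power_mono) auto
    moreover have "(norm (a + b))\<^sup>2 + (norm (a - b))\<^sup>2 = 2 * (norm a)\<^sup>2 + 2 * (norm b)\<^sup>2"
      by (simp add: power2_norm_eq_inner inner_add_left inner_add_right inner_diff_left inner_diff_right)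
    moreover have "norm (G m - G n) = norm (a - b)"
      by (simp add: a_def b_def norm_minus_commute)
    ultimately show ?thesis by (simp add: a_def b_def)
  qed
  have lim: "(\<lambda>n. norm (f - G n)) \<longlonglongrightarrow> \<delta>"
  proof (rule tendsto_sandwich[of "\<lambda>_. \<delta>" _ _ "\<lambda>n. \<delta> + inverse (real (Suc n))"])
    show "(\<lambda>n. \<delta> + inverse (real (Suc n))) \<longlonglongrightarrow> \<delta>"
      using tendsto_add[OF tendsto_const LIMSEQ_inverse_real_of_nat, of \<delta>] by simp
  qed (use ld G in \<open>auto intro!: always_eventually less_imp_le\<close>)
  have "Cauchy G"
  proof (rule metric_CauchyI)
    fix e :: real assume "e > 0"
    then have e4: "e\<^sup>2 / 4 > 0" by simp
    have "(\<lambda>n. (norm (f - G n))\<^sup>2) \<longlonglongrightarrow> \<delta>\<^sup>2"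
      by (intro tendsto_intros lim)
    from order_tendstoD(2)[OF this, of "\<delta>\<^sup>2 + e\<^sup>2 / 4"] obtain N where
      N: "\<And>n. n \<ge> N \<Longrightarrow> (norm (f - G n))\<^sup>2 < \<delta>\<^sup>2 + e\<^sup>2 / 4"
      using e4 by (auto simp: eventually_sequentially)
    have "dist (G m) (G n) < e" if "m \<ge> N" "n \<ge> N" for m n
    proof -
      have "(norm (G m - G n))\<^sup>2 < e\<^sup>2"
        using par[of m n] N[OF that(1)] N[OF that(2)] by (simp add: field_simps)
      then show ?thesis
        using \<open>e > 0\<close> by (simp add: dist_norm power2_less_imp_less)
    qed
    then show "\<exists>M. \<forall>m\<ge>M. \<forall>n\<ge>M. dist (G m) (G n) < e" by blast
  qed
  then obtain g where g: "G \<longlonglongrightarrow> g"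
    using Cauchy_convergent_iff convergent_def by blast
  have gS: "g \<in> S"
    using closed_sequentially[OF S'(1) _ g] G by blast
  have "(\<lambda>n. norm (f - G n)) \<longlonglongrightarrow> norm (f - g)"
    by (intro tendsto_intros g)
  then have nd: "norm (f - g) = \<delta>"
    using lim LIMSEQ_unique by blast
  have inner0: "inner (f - g) h = 0" if h: "h \<in> S" for h
  proof (cases "h = 0")
    case False
    \<comment> \<open>the minimizer of the distance along the line through \<open>g\<close> in direction \<open>h\<close>\<close>
    define t where "t = inner (f - g) h / (norm h)\<^sup>2"
    have expand: "(norm (a - t *\<^sub>R h))\<^sup>2 = (norm a)\<^sup>2 - 2 * t * inner a h + t\<^sup>2 * (norm h)\<^sup>2" for a
      unfolding power2_norm_eq_inner
      by (simp add: inner_diff_left inner_diff_right inner_commute[of h a] power2_eq_square algebra_simps)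
    have "g + complex_of_real t *\<^sub>C h \<in> S" using S' gS h by auto
    from ld[OF this] have "norm (f - g) \<le> norm ((f - g) - t *\<^sub>R h)"
      by (simp add: nd scaleR_conv_scaleC algebra_simps)
    then have "(norm (f - g))\<^sup>2 \<le> (norm ((f - g) - t *\<^sub>R h))\<^sup>2"
      by (intro power_mono) auto
    also have "\<dots> = (norm (f - g))\<^sup>2 - 2 * t * inner (f - g) h + t\<^sup>2 * (norm h)\<^sup>2"
      by (rule expand)
    also have "\<dots> = (norm (f - g))\<^sup>2 - (inner (f - g) h)\<^sup>2 / (norm h)\<^sup>2"
      using False by (simp add: t_def field_simps power2_eq_square)
    finally have "(inner (f - g) h)\<^sup>2 / (norm h)\<^sup>2 \<le> 0" by simp
    then have "(inner (f - g) h)\<^sup>2 \<le> 0"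
      using False by (simp add: divide_le_0_iff)
    then show ?thesis by simp
  qed auto
  have "cinner (f - g) h = 0" if h: "h \<in> S" for h
  proof -
    have "Re (cinner (f - g) h) = 0"
      using inner0[OF h] by (simp add: inner_l2_circle_def)
    moreover have "Im (cinner (f - g) h) = 0"
      using inner0[OF S'(4)[OF h, of \<i>]] by (simp add: inner_l2_circle_def cinner_scaleC_right)
    ultimately show ?thesis by (simp add: complex_eq_iff)
  qed
  with gS that show thesis by blast
qed

lemma eq_if_cinner_eq:
  assumes "closed_csubspace S" "f \<in> S" "g \<in> S" "\<And>h. h \<in> S \<Longrightarrow> cinner f h = cinner g h"
  shows "f = g"
proof -
  have "f - g \<in> S" using closed_csubspaceD(5)[OF assms(1-3)] .
  then have "cinner (f - g) (f - g) = 0"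
    using assms(4) by (simp add: cinner_diff_left)
  then show ?thesis by (simp add: cinner_self)
qed

lemma orth_proj_eqI:
  assumes S: "closed_csubspace S" and g: "g \<in> S" "\<And>h. h \<in> S \<Longrightarrow> cinner (f - g) h = 0"
  shows "orth_proj S f = g"
  unfolding orth_proj_def
proof (rule the_equality)
  fix g' assume g': "g' \<in> S \<and> (\<forall>h\<in>S. cinner (f - g') h = 0)"
  then show "g' = g"
    using g by (intro eq_if_cinner_eq[OF S]) (auto simp: cinner_diff_left)
qed (use g in auto)

lemma orth_proj:
  assumes S: "closed_csubspace S"
  shows "orth_proj S f \<in> S" "h \<in> S \<Longrightarrow> cinner (orth_proj S f) h = cinner f h"
proof -
  obtain g where g: "g \<in> S" "\<And>h. h \<in> S \<Longrightarrow> cinner (f - g) h = 0"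
    using orthogonal_projection_exists[OF S, of f] by blast
  have "orth_proj S f = g" by (rule orth_proj_eqI[OF S g])
  then show "orth_proj S f \<in> S" "h \<in> S \<Longrightarrow> cinner (orth_proj S f) h = cinner f h"
    using g by (auto simp: cinner_diff_left)
qed

lemma adjoint_on_eqI:
  assumes S: "closed_csubspace S" and h: "h \<in> S" "\<And>f. f \<in> S \<Longrightarrow> cinner (X f) g = cinner f h"
  shows "adjoint_on S X g = h"
  unfolding adjoint_on_def
proof (rule the_equality)
  fix h' assume h': "h' \<in> S \<and> (\<forall>f\<in>S. cinner (X f) g = cinner f h')"
  show "h' = h"
  proof (rule eq_if_cinner_eq[OF S])
    fix f assume f: "f \<in> S"
    then have "cinner f h' = cinner f h" using h' h by simp
    then show "cinner h' f = cinner h f"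
      by (subst (1 2) cinner_commute) simp
  qed (use h h' in auto)
qed (use h in auto)

lemma orth_proj_add:
  assumes S: "closed_csubspace S"
  shows "orth_proj S (f + g) = orth_proj S f + orth_proj S g"
  by (rule orth_proj_eqI[OF S]) (auto simp: closed_csubspaceD[OF S] orth_proj[OF S] cinner_diff_left cinner_add_left)

lemma orth_proj_scaleC:
  assumes S: "closed_csubspace S"
  shows "orth_proj S (c *\<^sub>C f) = c *\<^sub>C orth_proj S f"
  by (rule orth_proj_eqI[OF S]) (auto simp: closed_csubspaceD[OF S] orth_proj[OF S] cinner_diff_left cinner_scaleC_left)

lemma norm_orth_proj_le:
  assumes S: "closed_csubspace S"
  shows "norm (orth_proj S f) \<le> norm f"
proof -
  have "of_real ((norm (orth_proj S f))\<^sup>2) = cinner f (orth_proj S f)"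
    using orth_proj(2)[OF S orth_proj(1)[OF S], of f f] by (simp only: cinner_self)
  then have "(norm (orth_proj S f))\<^sup>2 = cmod (cinner f (orth_proj S f))"
    by (metis abs_power2 norm_of_real)
  also have "\<dots> \<le> norm f * norm (orth_proj S f)" by (rule cmod_cinner_le)
  finally show ?thesis
    by (cases "norm (orth_proj S f) = 0") (auto simp: power2_eq_square)
qed

subsection \<open>Multiplication operators\<close>

definition bounded_multiplier :: "(complex \<Rightarrow> complex) \<Rightarrow> bool" where
  "bounded_multiplier \<phi> \<longleftrightarrow> \<phi> \<in> borel_measurable \<sigma> \<and> (\<exists>K. AE z in \<sigma>. cmod (\<phi> z) \<le> K)"

lemma bounded_multiplierI:
  "\<phi> \<in> borel_measurable \<sigma> \<Longrightarrow> AE z in \<sigma>. cmod (\<phi> z) \<le> K \<Longrightarrow> bounded_multiplier \<phi>"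
  by (auto simp: bounded_multiplier_def)

lemma bounded_multiplier_unimodular:
  assumes "\<phi> \<in> borel_measurable \<sigma>" "AE z in \<sigma>. cmod (\<phi> z) = 1"
  shows "bounded_multiplier \<phi>"
  using assms(1) by (rule bounded_multiplierI[where K = 1]) (use assms(2) in \<open>auto elim: eventually_mono\<close>)

lemma bounded_multiplier_measurable: "bounded_multiplier \<phi> \<Longrightarrow> \<phi> \<in> borel_measurable \<sigma>"
  by (simp add: bounded_multiplier_def)

lemma bounded_multiplier_square_integrable:
  "bounded_multiplier \<phi> \<Longrightarrow> square_integrable f \<Longrightarrow> square_integrable (\<lambda>z. \<phi> z * f z)"
  by (auto simp: bounded_multiplier_def intro: square_integrable_mult)

lemma bounded_multiplier_powi [simp]: "bounded_multiplier (\<lambda>z. z powi n)"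
  by (rule bounded_multiplierI[where K = 1]) (auto intro!: AE_I2 simp: norm_power_int)

lemma bounded_multiplier_id [simp]: "bounded_multiplier (\<lambda>z. z)"
  using bounded_multiplier_powi[of 1] by simp

lemma bounded_multiplier_cnj: "bounded_multiplier \<phi> \<Longrightarrow> bounded_multiplier (\<lambda>z. cnj (\<phi> z))"
  by (auto simp: bounded_multiplier_def)

lemma bounded_multiplier_mult:
  assumes "bounded_multiplier \<phi>" "bounded_multiplier \<psi>"
  shows "bounded_multiplier (\<lambda>z. \<phi> z * \<psi> z)"
proof -
  obtain K L where KL: "AE z in \<sigma>. cmod (\<phi> z) \<le> K" "AE z in \<sigma>. cmod (\<psi> z) \<le> L"
    using assms by (auto simp: bounded_multiplier_def)
  have "AE z in \<sigma>. cmod (\<phi> z * \<psi> z) \<le> K * L"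
    using KL
  proof eventually_elim
    case (elim z)
    then have "0 \<le> K" using norm_ge_zero[of "\<phi> z"] by linarith
    then show ?case using elim by (simp add: norm_mult mult_mono)
  qed
  then show ?thesis
    using assms by (auto simp: bounded_multiplier_def)
qed

lemma bounded_multiplier_const [simp]: "bounded_multiplier (\<lambda>z. c)"
  by (rule bounded_multiplierI[where K = "cmod c"]) auto

lemma bounded_multiplier_square_integrable_self: "bounded_multiplier \<phi> \<Longrightarrow> square_integrable \<phi>"
  using bounded_multiplier_square_integrable[of \<phi> "\<lambda>_. 1"] square_integrable_powi[of 0] by simp

lemma rep_mult_op:
  assumes "bounded_multiplier \<phi>"
  shows "AE z in \<sigma>. rep (mult_op \<phi> f) z = \<phi> z * rep f z"
  unfolding mult_op_def
  by (rule rep_abs_l2) (simp add: bounded_multiplier_square_integrable assms)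

lemma mult_op_add:
  assumes "bounded_multiplier \<phi>"
  shows "mult_op \<phi> (f + g) = mult_op \<phi> f + mult_op \<phi> g"
  using rep_mult_op[OF assms, of "f + g"] rep_mult_op[OF assms, of f] rep_mult_op[OF assms, of g]
    rep_add_l2[of f g] rep_add_l2[of "mult_op \<phi> f" "mult_op \<phi> g"]
  by (intro l2_eqI, eventually_elim) (simp add: algebra_simps)

lemma mult_op_scaleC:
  assumes "bounded_multiplier \<phi>"
  shows "mult_op \<phi> (c *\<^sub>C f) = c *\<^sub>C mult_op \<phi> f"
  using rep_mult_op[OF assms, of "c *\<^sub>C f"] rep_mult_op[OF assms, of f]
    rep_scaleC_l2[of c f] rep_scaleC_l2[of c "mult_op \<phi> f"]
  by (intro l2_eqI, eventually_elim) (simp add: algebra_simps)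

lemma mult_op_diff:
  assumes "bounded_multiplier \<phi>"
  shows "mult_op \<phi> (f - g) = mult_op \<phi> f - mult_op \<phi> g"
  using rep_mult_op[OF assms, of "f - g"] rep_mult_op[OF assms, of f] rep_mult_op[OF assms, of g]
    rep_diff_l2[of f g] rep_diff_l2[of "mult_op \<phi> f" "mult_op \<phi> g"]
  by (intro l2_eqI, eventually_elim) (simp add: right_diff_distrib)

lemma mult_op_mult_op:
  assumes "bounded_multiplier \<phi>" "bounded_multiplier \<psi>"
  shows "mult_op \<phi> (mult_op \<psi> f) = mult_op (\<lambda>z. \<phi> z * \<psi> z) f"
  using rep_mult_op[OF assms(1), of "mult_op \<psi> f"] rep_mult_op[OF assms(2), of f]
    rep_mult_op[OF bounded_multiplier_mult[OF assms], of f]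
  by (intro l2_eqI, eventually_elim) simp

lemma mult_op_cong:
  assumes "bounded_multiplier \<phi>" "bounded_multiplier \<psi>" "AE z in \<sigma>. \<phi> z = \<psi> z"
  shows "mult_op \<phi> f = mult_op \<psi> f"
  using rep_mult_op[OF assms(1), of f] rep_mult_op[OF assms(2), of f] assms(3)
  by (intro l2_eqI, eventually_elim) simp

lemma mult_op_1 [simp]: "mult_op (\<lambda>z. 1) f = f"
  by (simp add: mult_op_def)

lemma cinner_mult_op_left:
  assumes "bounded_multiplier \<phi>"
  shows "cinner (mult_op \<phi> f) g = cinner f (mult_op (\<lambda>z. cnj (\<phi> z)) g)"
proof -
  note [measurable] = bounded_multiplier_measurable[OF assms]
  have "cinner (mult_op \<phi> f) g = (\<integral>z. (\<phi> z * rep f z) * cnj (rep g z) \<partial>\<sigma>)"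
    by (rule cinner_eq_integral[OF rep_mult_op]) (use assms in auto)
  also have "\<dots> = (\<integral>z. rep f z * cnj (cnj (\<phi> z) * rep g z) \<partial>\<sigma>)"
    by (simp add: mult_ac)
  also have "\<dots> = cinner f (mult_op (\<lambda>z. cnj (\<phi> z)) g)"
    by (rule cinner_eq_integral[OF _ rep_mult_op, symmetric]) (use assms bounded_multiplier_cnj in auto)
  finally show ?thesis .
qed

lemma norm_mult_op_le:
  assumes "bounded_multiplier \<phi>" "AE z in \<sigma>. cmod (\<phi> z) \<le> K" "K \<ge> 0"
  shows "norm (mult_op \<phi> f) \<le> K * norm f"
proof (rule power2_le_imp_le)
  note [measurable] = bounded_multiplier_measurable[OF assms(1)]
  have "(norm (mult_op \<phi> f))\<^sup>2 \<le> (\<integral>z. K\<^sup>2 * (cmod (rep f z))\<^sup>2 \<partial>\<sigma>)"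
    unfolding norm_l2_sq
  proof (rule integral_mono_AE)
    show "AE z in \<sigma>. (cmod (rep (mult_op \<phi> f) z))\<^sup>2 \<le> K\<^sup>2 * (cmod (rep f z))\<^sup>2"
      using rep_mult_op[OF assms(1), of f] assms(2)
      by eventually_elim (auto simp: norm_mult power_mult_distrib intro!: mult_right_mono power_mono)
  qed (use square_integrable_rep[of f] square_integrable_rep[of "mult_op \<phi> f"] in \<open>auto simp: square_integrable_def\<close>)
  also have "\<dots> = (K * norm f)\<^sup>2"
    by (simp add: norm_l2_sq power_mult_distrib)
  finally show "(norm (mult_op \<phi> f))\<^sup>2 \<le> (K * norm f)\<^sup>2" .
qed (use assms in auto)

lemma bounded_linear_mult_op:
  assumes "bounded_multiplier \<phi>"
  shows "bounded_linear (mult_op \<phi>)"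
proof -
  obtain K where K: "AE z in \<sigma>. cmod (\<phi> z) \<le> K"
    using assms by (auto simp: bounded_multiplier_def)
  then have "AE z in \<sigma>. cmod (\<phi> z) \<le> max K 0"
    by (auto elim: eventually_mono)
  then have "norm (mult_op \<phi> f) \<le> max K 0 * norm f" for f
    by (rule norm_mult_op_le[OF assms]) auto
  then show ?thesis
    by (intro bounded_linear_intro[where K = "max K 0"])
       (auto simp: mult_op_add assms mult_op_scaleC scaleR_conv_scaleC mult.commute)
qed

lemma cinner_mult_op_unimodular:
  assumes "\<phi> \<in> borel_measurable \<sigma>" "AE z in \<sigma>. cmod (\<phi> z) = 1"
  shows "cinner (mult_op \<phi> f) (mult_op \<phi> g) = cinner f g"
    and "mult_op (\<lambda>z. cnj (\<phi> z)) (mult_op \<phi> f) = f" "mult_op \<phi> (mult_op (\<lambda>z. cnj (\<phi> z)) f) = f"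
proof -
  have b: "bounded_multiplier \<phi>" using assms by (rule bounded_multiplier_unimodular)
  have "AE z in \<sigma>. cnj (\<phi> z) * \<phi> z = 1"
    using assms(2) by eventually_elim (simp add: complex_norm_square[symmetric] mult.commute)
  then have eq: "mult_op (\<lambda>z. cnj (\<phi> z) * \<phi> z) f = f" for f
    using mult_op_cong[OF bounded_multiplier_mult[OF bounded_multiplier_cnj[OF b] b] bounded_multiplier_const[of 1]]
    by simp
  then show 1: "mult_op (\<lambda>z. cnj (\<phi> z)) (mult_op \<phi> f) = f" for f
    by (simp add: mult_op_mult_op b bounded_multiplier_cnj)
  show "mult_op \<phi> (mult_op (\<lambda>z. cnj (\<phi> z)) f) = f"
    using eq[of f] by (simp add: mult_op_mult_op b bounded_multiplier_cnj mult.commute)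
  show "cinner (mult_op \<phi> f) (mult_op \<phi> g) = cinner f g"
    by (simp add: cinner_mult_op_left b 1)
qed

lemma norm_mult_op_unimodular:
  assumes "\<phi> \<in> borel_measurable \<sigma>" "AE z in \<sigma>. cmod (\<phi> z) = 1"
  shows "norm (mult_op \<phi> f) = norm f"
  using cinner_mult_op_unimodular(1)[OF assms, of f f] by (simp add: cinner_self flip: of_real_power)

section \<open>Fourier coefficients and the Hardy space\<close>

definition monomial :: "int \<Rightarrow> l2_circle" where
  "monomial n = abs_l2_circle (\<lambda>z. z powi n)"

lemma rep_monomial: "AE z in \<sigma>. rep (monomial n) z = z powi n"
  unfolding monomial_def by (rule rep_abs_l2[OF square_integrable_powi])

lemma fourier_coeff_monomial_cinner: "fourier_coeff f n = cinner f (monomial n)"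
  by (simp add: fourier_coeff_def monomial_def)

lemma cnj_powi_circle: "cmod z = 1 \<Longrightarrow> cnj (z powi n) = z powi (- n)"
  using complex_div_cnj[of 1 z] by (simp add: divide_inverse power_int_minus flip: power_int_inverse)

lemma fourier_coeff_eq_integral:
  assumes "AE z in \<sigma>. rep f z = F z" "F \<in> borel_measurable \<sigma>"
  shows "fourier_coeff f n = (\<integral>z. F z * z powi (- n) \<partial>\<sigma>)"
proof -
  have "fourier_coeff f n = (\<integral>z. F z * cnj (z powi n) \<partial>\<sigma>)"
    unfolding fourier_coeff_monomial_cinner by (rule cinner_eq_integral[OF assms(1) rep_monomial assms(2)]) measurable
  also have "\<dots> = (\<integral>z. F z * z powi (- n) \<partial>\<sigma>)"
    by (intro Bochner_Integration.integral_cong) (auto simp: cnj_powi_circle simp del: complex_cnj_power_int)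
  finally show ?thesis .
qed

lemma fourier_coeff_add: "fourier_coeff (f + g) n = fourier_coeff f n + fourier_coeff g n"
  and fourier_coeff_diff: "fourier_coeff (f - g) n = fourier_coeff f n - fourier_coeff g n"
  and fourier_coeff_scaleC: "fourier_coeff (c *\<^sub>C f) n = c * fourier_coeff f n"
  and fourier_coeff_0 [simp]: "fourier_coeff 0 n = 0"
  by (simp_all add: fourier_coeff_def cinner_add_left cinner_diff_left cinner_scaleC_left)

lemma mult_op_powi_monomial: "mult_op (\<lambda>z. z powi k) (monomial n) = monomial (n + k)"
proof -
  have "AE z in \<sigma>. z \<noteq> 0"
    by (intro AE_I2) auto
  then show ?thesis
    using rep_mult_op[OF bounded_multiplier_powi[of k], of "monomial n"] rep_monomial[of n] rep_monomial[of "n + k"]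
    by (intro l2_eqI, eventually_elim) (simp add: power_int_add mult.commute)
qed

lemma fourier_coeff_monomial: "fourier_coeff (monomial m) n = (if m = n then 1 else 0)"
proof -
  have "fourier_coeff (monomial m) n = (\<integral>z. z powi m * z powi (- n) \<partial>\<sigma>)"
    by (rule fourier_coeff_eq_integral[OF rep_monomial]) measurable
  also have "\<dots> = (\<integral>z. z powi (m - n) \<partial>\<sigma>)"
  proof (rule circle_integral_cong)
    fix z :: complex assume "cmod z = 1"
    then have "z \<noteq> 0" by auto
    then show "z powi m * z powi (- n) = z powi (m - n)"
      by (simp add: power_int_diff power_int_minus field_simps)
  qed
  also have "\<dots> = (if m = n then 1 else 0)" by (simp add: integral_powi_circle)
  finally show ?thesis .
qed

lemma fourier_coeff_mult_powi: "fourier_coeff (mult_op (\<lambda>z. z powi k) f) n = fourier_coeff f (n - k)"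
proof -
  have "fourier_coeff (mult_op (\<lambda>z. z powi k) f) n = cinner f (mult_op (\<lambda>z. cnj (z powi k)) (monomial n))"
    by (simp add: fourier_coeff_monomial_cinner cinner_mult_op_left del: complex_cnj_power_int)
  also have "mult_op (\<lambda>z. cnj (z powi k)) (monomial n) = mult_op (\<lambda>z. z powi (- k)) (monomial n)"
    by (rule mult_op_cong) (auto intro!: bounded_multiplier_cnj AE_I2 simp: cnj_powi_circle simp del: complex_cnj_power_int)
  also have "\<dots> = monomial (n - k)" by (simp add: mult_op_powi_monomial)
  finally show ?thesis by (simp add: fourier_coeff_monomial_cinner)
qed

lemma eq_0_if_fourier_coeff_0:
  assumes "\<And>n. fourier_coeff f n = 0"
  shows "f = 0"
proof -
  have "AE z in \<sigma>. rep f z = 0"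
  proof (rule AE_eq_0_if_fourier_coeffs_0)
    show "(\<integral>z. rep f z * z powi k \<partial>\<sigma>) = 0" for k
      using fourier_coeff_eq_integral[of f "rep f" "-k"] assms by simp
  qed (rule integrable_rep)
  then show ?thesis
    using rep_zero_l2 by (intro l2_eqI, eventually_elim) simp
qed

lemma fourier_coeff_eqI: "(\<And>n. fourier_coeff f n = fourier_coeff g n) \<Longrightarrow> f = g"
  using eq_0_if_fourier_coeff_0[of "f - g"] by (simp add: fourier_coeff_diff)

lemma hardy2_closed_csubspace: "closed_csubspace hardy2"
proof -
  have "closed_csubspace {f. fourier_coeff f n = 0}" for n
    unfolding fourier_coeff_monomial_cinner
    by (rule closed_csubspace_kernel[OF bounded_linear_cinner_left]) (simp add: cinner_scaleC_left)
  then have "closed_csubspace (\<Inter>n\<in>{..<0}. {f. fourier_coeff f n = 0})"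
    by (rule closed_csubspace_INT)
  also have "(\<Inter>n\<in>{..<0}. {f. fourier_coeff f n = 0}) = hardy2"
    by (auto simp: hardy2_def)
  finally show ?thesis .
qed

lemma monomial_in_hardy2: "n \<ge> 0 \<Longrightarrow> monomial n \<in> hardy2"
  by (auto simp: hardy2_def fourier_coeff_monomial)

text \<open>
  The residual of projecting $f$ onto $S \cap H^2$ lies in $H^2$ and is orthogonal to every $z^n$ with $n \ge 0$, so
  all its Fourier coefficients vanish. This serves as an induction principle for $H^2$.
\<close>

lemma hardy2_subset_closed_csubspace:
  assumes S: "closed_csubspace S" and mon: "\<And>n. n \<ge> 0 \<Longrightarrow> monomial n \<in> S"
  shows "hardy2 \<subseteq> S"
proof
  fix f assume f: "f \<in> hardy2"
  have S2: "closed_csubspace (S \<inter> hardy2)"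
    by (rule closed_csubspace_Int[OF S hardy2_closed_csubspace])
  define e where "e = f - orth_proj (S \<inter> hardy2) f"
  have p: "orth_proj (S \<inter> hardy2) f \<in> S \<inter> hardy2"
    by (rule orth_proj(1)[OF S2])
  have "e \<in> hardy2"
    unfolding e_def using f p by (intro closed_csubspaceD(5)[OF hardy2_closed_csubspace]) auto
  have "fourier_coeff e n = 0" for n
  proof (cases "n < 0")
    case True
    then show ?thesis using \<open>e \<in> hardy2\<close> by (simp add: hardy2_def)
  next
    case False
    then have "monomial n \<in> S \<inter> hardy2" using mon monomial_in_hardy2 by auto
    then show ?thesis
      using orth_proj(2)[OF S2, of "monomial n" f]
      by (simp add: e_def fourier_coeff_monomial_cinner cinner_diff_left)
  qed
  then have "e = 0" by (rule eq_0_if_fourier_coeff_0)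
  then show "f \<in> S" using p by (simp add: e_def)
qed

lemma mult_powi_hardy2: "f \<in> hardy2 \<Longrightarrow> k \<ge> 0 \<Longrightarrow> mult_op (\<lambda>z. z powi k) f \<in> hardy2"
  by (auto simp: hardy2_def fourier_coeff_mult_powi)

lemma shift_eq: "shift = mult_op (\<lambda>z. z powi 1)"
  by (simp add: shift_def)

section \<open>Holomorphic extension\<close>

text \<open>
  For $f \in H^2$ this is the holomorphic function on the disc with boundary values $f$.
\<close>

definition disc_ext :: "l2_circle \<Rightarrow> complex \<Rightarrow> complex" where
  "disc_ext f w = (\<Sum>n. fourier_coeff f (int n) * w ^ n)"

lemma norm_monomial [simp]: "norm (monomial n) = 1"
proof -
  have "complex_of_real ((norm (monomial n))\<^sup>2) = 1"
    unfolding cinner_self[symmetric] fourier_coeff_monomial_cinner[symmetric] by (simp add: fourier_coeff_monomial)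
  then have "(norm (monomial n))\<^sup>2 = 1" by (simp only: of_real_eq_1_iff)
  then show ?thesis by (simp add: power2_eq_1_iff) (use norm_ge_zero[of "monomial n"] in linarith)
qed

lemma cmod_fourier_coeff_le: "cmod (fourier_coeff f n) \<le> norm f"
  using cmod_cinner_le[of f "monomial n"] by (simp add: fourier_coeff_monomial_cinner)

lemma disc_ext_summable:
  assumes "cmod w < 1"
  shows "summable (\<lambda>n. cmod (fourier_coeff f (int n) * w ^ n))"
proof (rule summable_comparison_test'[where g = "\<lambda>n. norm f * cmod w ^ n" and N = 0])
  show "summable (\<lambda>n. norm f * cmod w ^ n)"
    using assms by (intro summable_mult summable_geometric) auto
  show "norm (cmod (fourier_coeff f (int n) * w ^ n)) \<le> norm f * cmod w ^ n" for n
    by (simp add: norm_mult norm_power mult_right_mono cmod_fourier_coeff_le)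
qed

lemma disc_ext_sums: "cmod w < 1 \<Longrightarrow> (\<lambda>n. fourier_coeff f (int n) * w ^ n) sums disc_ext f w"
  unfolding disc_ext_def by (rule summable_sums[OF summable_norm_cancel[OF disc_ext_summable]])

lemma disc_ext_holomorphic: "disc_ext f holomorphic_on ball 0 1"
  by (rule power_series_holomorphic[of 0 1 "\<lambda>n. fourier_coeff f (int n)"]) (use disc_ext_sums in auto)

lemma disc_ext_add: "cmod w < 1 \<Longrightarrow> disc_ext (f + g) w = disc_ext f w + disc_ext g w"
  using sums_add[OF disc_ext_sums[of w f] disc_ext_sums[of w g]]
  by (intro sums_unique2[OF disc_ext_sums]) (simp_all add: fourier_coeff_add distrib_right)

lemma disc_ext_scaleC: "cmod w < 1 \<Longrightarrow> disc_ext (c *\<^sub>C f) w = c * disc_ext f w"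
  using sums_mult[OF disc_ext_sums[of w f], of c]
  by (intro sums_unique2[OF disc_ext_sums]) (simp_all add: fourier_coeff_scaleC mult.assoc)

lemma disc_ext_diff: "cmod w < 1 \<Longrightarrow> disc_ext (f - g) w = disc_ext f w - disc_ext g w"
  using sums_diff[OF disc_ext_sums[of w f] disc_ext_sums[of w g]]
  by (intro sums_unique2[OF disc_ext_sums]) (simp_all add: fourier_coeff_diff left_diff_distrib)

lemma cmod_disc_ext_le:
  assumes w: "cmod w < 1"
  shows "cmod (disc_ext f w) \<le> norm f * (1 / (1 - cmod w))"
proof -
  have geo: "(\<lambda>n. norm f * cmod w ^ n) sums (norm f * (1 / (1 - cmod w)))"
    using w by (intro sums_mult geometric_sums) auto
  have "cmod (disc_ext f w) \<le> (\<Sum>n. norm f * cmod w ^ n)"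
    unfolding disc_ext_def
  proof (rule norm_suminf_le)
    show "norm (fourier_coeff f (int n) * w ^ n) \<le> norm f * cmod w ^ n" for n
      by (simp add: norm_mult norm_power mult_right_mono cmod_fourier_coeff_le)
  qed (use geo in \<open>auto simp: sums_iff\<close>)
  also have "\<dots> = norm f * (1 / (1 - cmod w))" using geo by (simp add: sums_iff)
  finally show ?thesis .
qed

lemma bounded_linear_disc_ext: "cmod w < 1 \<Longrightarrow> bounded_linear (\<lambda>f. disc_ext f w)"
  by (rule bounded_linear_intro[where K = "1 / (1 - cmod w)"])
     (use cmod_disc_ext_le in \<open>auto simp: disc_ext_add scaleR_conv_scaleC disc_ext_scaleC scaleR_conv_of_real\<close>)

text \<open>
  Multiplication by $z$ moves the coefficients one place up. Membership in $H^2$ ensures that the coefficient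
  with index $-1$, which would move to index $0$, is zero.
\<close>

lemma disc_ext_shift:
  assumes "f \<in> hardy2" "cmod w < 1"
  shows "disc_ext (shift f) w = w * disc_ext f w"
proof (rule sums_unique2[OF disc_ext_sums[OF assms(2)]])
  have c: "fourier_coeff (shift f) n = fourier_coeff f (n - 1)" for n
    by (simp add: shift_eq fourier_coeff_mult_powi del: power_int_1_right)
  have "(\<lambda>n. fourier_coeff (shift f) (int (Suc n)) * w ^ Suc n) sums (w * disc_ext f w)"
    using sums_mult[OF disc_ext_sums[OF assms(2), of f], of w] by (simp add: c mult_ac)
  moreover have "fourier_coeff (shift f) (int 0) * w ^ 0 = 0"
    using assms(1) by (simp add: c hardy2_def)
  ultimately show "(\<lambda>n. fourier_coeff (shift f) (int n) * w ^ n) sums (w * disc_ext f w)"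
    using sums_Suc_iff[of "\<lambda>n. fourier_coeff (shift f) (int n) * w ^ n"] by simp
qed

lemma shift_hardy2: "f \<in> hardy2 \<Longrightarrow> shift f \<in> hardy2"
  using mult_powi_hardy2[of f 1] by (simp add: shift_def)

lemma shift_monomial: "shift (monomial n) = monomial (n + 1)"
  using mult_op_powi_monomial[of 1 n] by (simp add: shift_def)

lemma monomial_Suc: "monomial (int (Suc n)) = shift (monomial (int n))"
  by (simp add: shift_monomial add.commute)

lemma mult_op_commute:
  assumes "bounded_multiplier \<phi>" "bounded_multiplier \<psi>"
  shows "mult_op \<phi> (mult_op \<psi> f) = mult_op \<psi> (mult_op \<phi> f)"
  using assms by (simp add: mult_op_mult_op mult.commute)

lemma mult_op_shift: "bounded_multiplier \<phi> \<Longrightarrow> mult_op \<phi> (shift f) = shift (mult_op \<phi> f)"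
  unfolding shift_def by (rule mult_op_commute) auto

lemma mult_op_monomial_0: "bounded_multiplier \<phi> \<Longrightarrow> mult_op \<phi> (monomial 0) = abs_l2_circle \<phi>"
  using mult_op_abs[of \<phi> _ "\<lambda>z. z powi 0"] square_integrable_powi[of 0]
  by (auto simp: bounded_multiplier_def monomial_def)

lemma disc_ext_monomial: "cmod w < 1 \<Longrightarrow> disc_ext (monomial (int n)) w = w ^ n"
proof (induction n)
  case 0
  have "(\<lambda>n. fourier_coeff (monomial 0) (int n) * w ^ n) sums (fourier_coeff (monomial 0) (int 0) * w ^ 0)"
    using sums_finite[of "{0}" "\<lambda>n. fourier_coeff (monomial 0) (int n) * w ^ n"] by (simp add: fourier_coeff_monomial)
  from sums_unique2[OF disc_ext_sums[OF 0] this] show ?case by (simp add: fourier_coeff_monomial)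
next
  case (Suc n)
  then show ?case
    by (simp only: monomial_Suc disc_ext_shift monomial_in_hardy2 of_nat_0_le_iff power_Suc)
qed

lemma closed_csubspace_preimage_mult_op:
  assumes "bounded_multiplier \<phi>" "closed_csubspace S"
  shows "closed_csubspace {f. mult_op \<phi> f \<in> S}"
proof -
  note S = closed_csubspaceD[OF assms(2)]
  have "closed (mult_op \<phi> -` S)"
    using bounded_linear_mult_op[OF assms(1)] S(1)
    by (intro closed_vimage) (auto intro: bounded_linear.continuous_on continuous_on_id)
  moreover have "mult_op \<phi> 0 = 0"
    using mult_op_scaleC[OF assms(1), of 0 0] by simp
  ultimately show ?thesis
    using S by (auto simp: closed_csubspace_def vimage_def mult_op_add mult_op_scaleC assms(1))
qed

text \<open>
  For $h = z^n$ the product $\phi h$ is an iterated shift of $\phi$, and the monomials determine $H^2$.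
\<close>

lemma mult_op_hardy2_subset:
  assumes \<phi>: "bounded_multiplier \<phi>" and S: "closed_csubspace S" "\<And>f. f \<in> S \<Longrightarrow> shift f \<in> S"
    and 1: "abs_l2_circle \<phi> \<in> S" and h: "h \<in> hardy2"
  shows "mult_op \<phi> h \<in> S"
proof -
  have "mult_op \<phi> (monomial (int n)) \<in> S" for n
    by (induction n) (use 1 S in \<open>auto simp only: mult_op_monomial_0[OF \<phi>] of_nat_0 monomial_Suc mult_op_shift[OF \<phi>]\<close>)
  then have "hardy2 \<subseteq> {f. mult_op \<phi> f \<in> S}"
    by (intro hardy2_subset_closed_csubspace closed_csubspace_preimage_mult_op \<phi> S) (metis mem_Collect_eq nonneg_int_cases)
  with h show ?thesis by auto
qed

lemma mult_op_hardy2: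
  "bounded_multiplier \<phi> \<Longrightarrow> abs_l2_circle \<phi> \<in> hardy2 \<Longrightarrow> h \<in> hardy2 \<Longrightarrow> mult_op \<phi> h \<in> hardy2"
  by (rule mult_op_hardy2_subset) (auto intro: shift_hardy2 hardy2_closed_csubspace)

text \<open>
  Both sides are continuous and linear in $h$, so it is enough to compare them for $h = z^n$, where the
  product is an iterated shift.
\<close>

lemma disc_ext_mult_op:
  assumes \<phi>: "bounded_multiplier \<phi>" "abs_l2_circle \<phi> \<in> hardy2" and h: "h \<in> hardy2" and w: "cmod w < 1"
  shows "disc_ext (mult_op \<phi> h) w = disc_ext (abs_l2_circle \<phi>) w * disc_ext h w"
proof -
  define S where "S = {h. disc_ext (mult_op \<phi> h) w - disc_ext (abs_l2_circle \<phi>) w * disc_ext h w = 0}"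
  have S: "closed_csubspace S"
    unfolding S_def
    by (intro closed_csubspace_kernel bounded_linear_sub bounded_linear_const_mult
          bounded_linear_compose[OF bounded_linear_disc_ext[OF w] bounded_linear_mult_op[OF \<phi>(1)]] bounded_linear_disc_ext[OF w])
       (simp add: mult_op_scaleC disc_ext_scaleC w \<phi> algebra_simps)
  have "mult_op \<phi> (monomial (int n)) \<in> hardy2 \<and> monomial (int n) \<in> S" for n
  proof (induction n)
    case 0
    then show ?case
      using disc_ext_monomial[OF w, of 0] \<phi> by (simp add: S_def mult_op_monomial_0)
  next
    case (Suc n)
    have m: "monomial (int n) \<in> hardy2" by (simp add: monomial_in_hardy2)
    from Suc have n: "mult_op \<phi> (monomial (int n)) \<in> hardy2"
      "disc_ext (mult_op \<phi> (monomial (int n))) w = disc_ext (abs_l2_circle \<phi>) w * disc_ext (monomial (int n)) w"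
      by (auto simp: S_def)
    show ?case
      unfolding S_def mem_Collect_eq monomial_Suc mult_op_shift[OF \<phi>(1)]
      by (simp add: disc_ext_shift n w m shift_hardy2)
  qed
  then have "hardy2 \<subseteq> S"
    by (intro hardy2_subset_closed_csubspace S) (metis nonneg_int_cases)
  with h show ?thesis by (auto simp: S_def)
qed

subsection \<open>Coefficients\<close>

lemma power_series_summable:
  fixes a :: "nat \<Rightarrow> complex"
  assumes U: "\<And>w. cmod w < 1 \<Longrightarrow> (\<lambda>n. a n * w ^ n) sums U w" and w: "cmod w < 1"
  shows "summable (\<lambda>n. cmod (a n * w ^ n))"
proof -
  define \<rho> where "\<rho> = (1 + cmod w) / 2"
  have \<rho>: "cmod w < \<rho>" "\<rho> < 1" "0 \<le> \<rho>" using w by (auto simp: \<rho>_def)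
  have "summable (\<lambda>n. a n * of_real \<rho> ^ n)"
    using U[of "of_real \<rho>"] \<rho> by (auto simp: sums_iff)
  then show ?thesis
    using \<rho> by (intro powser_insidea[of a "of_real \<rho>" w]) auto
qed

text \<open>
  Integrate the power series term by term on the circle of radius $r$.
\<close>

lemma integral_power_series_circle:
  assumes U: "\<And>w. cmod w < 1 \<Longrightarrow> (\<lambda>n. a n * w ^ n) sums U w"
    and r: "0 \<le> r" "r < 1"
  shows "(\<integral>z. U (of_real r * z) * z powi (- k) \<partial>\<sigma>) = (if k \<ge> 0 then a (nat k) * of_real r ^ nat k else 0)"
proof -
  have s: "summable (\<lambda>n. cmod (a n * of_real r ^ n))"
    by (rule power_series_summable[OF U]) (use r in auto)
  define F where "F n z = a n * (of_real r * z) ^ n * z powi (- k)" for n and z :: complex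
  have Fi: "integrable \<sigma> (F n)" for n
    unfolding F_def by (intro continuous_imp_integrable_circle finite_measure_circle_measure continuous_intros) auto
  have Fint: "(\<integral>z. F n z \<partial>\<sigma>) = (if int n = k then a n * of_real r ^ n else 0)" for n
  proof -
    have "(\<integral>z. F n z \<partial>\<sigma>) = (\<integral>z. (a n * of_real r ^ n) * z powi (int n - k) \<partial>\<sigma>)"
    proof (rule circle_integral_cong)
      fix z :: complex assume "cmod z = 1"
      then have "z \<noteq> 0" by auto
      then show "F n z = (a n * of_real r ^ n) * z powi (int n - k)"
        by (simp add: F_def power_int_diff power_int_minus power_mult_distrib field_simps)
    qed
    also have "\<dots> = (if int n = k then a n * of_real r ^ n else 0)"
      by (simp add: integral_powi_circle)
    finally show ?thesis .
  qed
  have nF: "cmod (F n z) = cmod (a n * of_real r ^ n)" if "cmod z = 1" for n z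
    using that r by (simp add: F_def norm_mult norm_power norm_power_int)
  have "(\<lambda>n. \<integral>z. F n z \<partial>\<sigma>) sums (\<integral>z. (\<Sum>n. F n z) \<partial>\<sigma>)"
  proof (rule sums_integral[OF Fi])
    show "AE z in \<sigma>. summable (\<lambda>n. norm (F n z))"
      by (intro AE_I2) (auto simp: nF s)
    have "(\<integral>z. cmod (F n z) \<partial>\<sigma>) = (\<integral>z. cmod (a n * of_real r ^ n) \<partial>\<sigma>)" for n
      by (intro Bochner_Integration.integral_cong refl) (simp add: nF)
    then show "summable (\<lambda>n. \<integral>z. norm (F n z) \<partial>\<sigma>)"
      using s by simp
  qed
  also have "(\<integral>z. (\<Sum>n. F n z) \<partial>\<sigma>) = (\<integral>z. U (of_real r * z) * z powi (- k) \<partial>\<sigma>)"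
  proof (rule circle_integral_cong)
    fix z :: complex assume "cmod z = 1"
    then have "(\<lambda>n. a n * (of_real r * z) ^ n * z powi (- k)) sums (U (of_real r * z) * z powi (- k))"
      using r by (intro sums_mult2 U) (simp add: norm_mult)
    then show "(\<Sum>n. F n z) = U (of_real r * z) * z powi (- k)"
      by (simp add: F_def sums_iff)
  qed
  finally have 1: "(\<lambda>n. \<integral>z. F n z \<partial>\<sigma>) sums (\<integral>z. U (of_real r * z) * z powi (- k) \<partial>\<sigma>)" .
  have 2: "(\<lambda>n. \<integral>z. F n z \<partial>\<sigma>) sums (if k \<ge> 0 then a (nat k) * of_real r ^ nat k else 0)"
  proof (cases "k \<ge> 0")
    case True
    have "(\<lambda>n. if n = nat k then a n * of_real r ^ n else 0) sums (a (nat k) * of_real r ^ nat k)"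
      by (rule sums_single)
    moreover have "(int n = k) = (n = nat k)" for n using True by auto
    ultimately show ?thesis using True by (simp add: Fint)
  next
    case False
    then have "(\<integral>z. F n z \<partial>\<sigma>) = 0" for n by (simp add: Fint)
    then show ?thesis using False by simp
  qed
  show ?thesis using sums_unique2[OF 1 2] .
qed

text \<open>
  The Taylor coefficients are read off from integrals over the circle of radius $1/2$.
\<close>

lemma disc_ext_inject:
  assumes "f \<in> hardy2" "g \<in> hardy2" "\<And>w. cmod w < 1 \<Longrightarrow> disc_ext f w = disc_ext g w"
  shows "f = g"
proof (rule fourier_coeff_eqI)
  fix n :: int
  show "fourier_coeff f n = fourier_coeff g n"
  proof (cases "n \<ge> 0")
    case True
    have "(\<integral>z. disc_ext f (of_real (1/2) * z) * z powi (- n) \<partial>\<sigma>)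
        = (\<integral>z. disc_ext g (of_real (1/2) * z) * z powi (- n) \<partial>\<sigma>)"
      by (intro Bochner_Integration.integral_cong refl arg_cong2[where f = "(*)"] assms(3)) (auto simp: norm_mult)
    then show ?thesis
      using True integral_power_series_circle[OF disc_ext_sums[of _ f], of "1/2" n]
        integral_power_series_circle[OF disc_ext_sums[of _ g], of "1/2" n] by simp
  qed (use assms in \<open>auto simp: hardy2_def\<close>)
qed

subsection \<open>Radial limits\<close>

lemma tendsto_at_left_if_Cauchy:
  fixes g :: "real \<Rightarrow> complex"
  assumes "\<And>e. e > 0 \<Longrightarrow> \<exists>d<1. \<forall>r s. d < r \<and> r < 1 \<and> d < s \<and> s < 1 \<longrightarrow> cmod (g r - g s) \<le> e"
  shows "\<exists>l. (g \<longlongrightarrow> l) (at_left 1)"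
proof -
  define x where "x n = 1 - inverse (real (Suc n))" for n
  have x1: "x n < 1" for n by (simp add: x_def)
  have xl: "x \<longlonglongrightarrow> 1" unfolding x_def
    using tendsto_diff[OF tendsto_const LIMSEQ_inverse_real_of_nat, of 1] by simp
  have "Cauchy (\<lambda>n. g (x n))"
  proof (rule metric_CauchyI)
    fix e :: real assume "e > 0"
    then obtain d where d: "d < 1" "\<And>r s. d < r \<Longrightarrow> r < 1 \<Longrightarrow> d < s \<Longrightarrow> s < 1 \<Longrightarrow> cmod (g r - g s) \<le> e / 2"
      using assms[of "e / 2"] by force
    obtain N where N: "\<And>n. n \<ge> N \<Longrightarrow> d < x n"
      using order_tendstoD(1)[OF xl d(1)] by (auto simp: eventually_sequentially)
    have "dist (g (x m)) (g (x n)) < e" if "m \<ge> N" "n \<ge> N" for m n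
      using d(2)[OF N[OF that(1)] x1 N[OF that(2)] x1] \<open>e > 0\<close> by (simp add: dist_norm)
    then show "\<exists>M. \<forall>m\<ge>M. \<forall>n\<ge>M. dist (g (x m)) (g (x n)) < e" by blast
  qed
  then obtain l where l: "(\<lambda>n. g (x n)) \<longlonglongrightarrow> l"
    using Cauchy_convergent_iff convergent_def by blast
  have "(g \<longlongrightarrow> l) (at_left 1)"
  proof (rule tendstoI)
    fix e :: real assume "e > 0"
    then obtain d where d: "d < 1" "\<And>r s. d < r \<Longrightarrow> r < 1 \<Longrightarrow> d < s \<Longrightarrow> s < 1 \<Longrightarrow> cmod (g r - g s) \<le> e / 2"
      using assms[of "e / 2"] by force
    have "cmod (g r - l) \<le> e / 2" if "d < r" "r < 1" for r
    proof (rule tendsto_upperbound)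
      show "(\<lambda>n. cmod (g r - g (x n))) \<longlonglongrightarrow> cmod (g r - l)"
        by (intro tendsto_intros l)
      show "eventually (\<lambda>n. cmod (g r - g (x n)) \<le> e / 2) sequentially"
        using order_tendstoD(1)[OF xl d(1)] by eventually_elim (use d that x1 in auto)
    qed auto
    then show "eventually (\<lambda>r. dist (g r) l < e) (at_left 1)"
      using d(1) \<open>e > 0\<close> by (force simp: eventually_at_left_field dist_norm)
  qed
  then show ?thesis by blast
qed

text \<open>
  The quantifiers over \<open>k\<close> and \<open>m\<close> range over natural numbers so that the set of points with a radial limit
  becomes a countable combination of closed sets.
\<close>

lemma at_left_limit_iff_Cauchy:
  fixes g :: "real \<Rightarrow> complex"
  shows "(\<exists>l. (g \<longlongrightarrow> l) (at_left 1)) \<longleftrightarrow>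
    (\<forall>k::nat. \<exists>m::nat. \<forall>r s. 1 - 1 / real (m + 2) < r \<and> r < 1 \<and> 1 - 1 / real (m + 2) < s \<and> s < 1 \<longrightarrow>
        cmod (g r - g s) \<le> 1 / real (k + 1))" (is "?L = ?R")
proof
  assume ?L
  then obtain l where l: "(g \<longlongrightarrow> l) (at_left 1)" by blast
  show ?R
  proof
    fix k :: nat
    have "eventually (\<lambda>r. dist (g r) l < 1 / real (2 * (k + 1))) (at_left 1)"
      using l by (rule tendstoD) simp
    then obtain b where b: "b < 1" "\<And>r. b < r \<Longrightarrow> r < 1 \<Longrightarrow> dist (g r) l < 1 / real (2 * (k + 1))"
      by (auto simp: eventually_at_left_field)
    have "eventually (\<lambda>m. b < 1 - 1 / real (m + 2)) sequentially"
      using b(1) by (intro order_tendstoD(1)[of _ 1]) real_asymp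
    then obtain m where m: "b < 1 - 1 / real (m + 2)"
      by (auto simp: eventually_sequentially)
    have "cmod (g r - g s) \<le> 1 / real (k + 1)" if "b < r" "r < 1" "b < s" "s < 1" for r s
      using dist_triangle_less_add[OF b(2)[OF that(1,2)] b(2)[OF that(3,4)]] by (simp add: dist_norm field_simps)
    then show "\<exists>m::nat. \<forall>r s. 1 - 1 / real (m + 2) < r \<and> r < 1 \<and> 1 - 1 / real (m + 2) < s \<and> s < 1 \<longrightarrow>
        cmod (g r - g s) \<le> 1 / real (k + 1)"
      using m by (intro exI[of _ m]) (meson order.strict_trans)
  qed
next
  assume R: ?R
  show ?L
  proof (rule tendsto_at_left_if_Cauchy)
    fix e :: real assume "e > 0"
    then obtain k :: nat where k: "1 / real (k + 1) < e"
      using reals_Archimedean[of e] by (auto simp: inverse_eq_divide add.commute)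
    obtain m :: nat where "\<And>r s. 1 - 1 / real (m + 2) < r \<Longrightarrow> r < 1 \<Longrightarrow> 1 - 1 / real (m + 2) < s \<Longrightarrow> s < 1 \<Longrightarrow>
        cmod (g r - g s) \<le> 1 / real (k + 1)"
      using R by blast
    then show "\<exists>d<1. \<forall>r s. d < r \<and> r < 1 \<and> d < s \<and> s < 1 \<longrightarrow> cmod (g r - g s) \<le> e"
      using k by (intro exI[of _ "1 - 1 / real (m + 2)"]) force
  qed
qed

abbreviation has_radial_limit :: "(complex \<Rightarrow> complex) \<Rightarrow> complex \<Rightarrow> complex \<Rightarrow> bool" where
  "has_radial_limit u z l \<equiv> ((\<lambda>r::real. u (of_real r * z)) \<longlongrightarrow> l) (at_left 1)"

lemma radial_limit_eqI: "has_radial_limit u z l \<Longrightarrow> radial_limit u z = l"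
  unfolding radial_limit_def by (rule tendsto_Lim) auto

text \<open>
  By Fatou's theorem every element of $H^\infty$ qualifies; the condition on radial limits is separate because it
  is known beforehand for inner functions and their quotients.
\<close>

definition radially_convergent :: "(complex \<Rightarrow> complex) \<Rightarrow> bool" where
  "radially_convergent u \<longleftrightarrow> u \<in> hardy_inf \<and>
     (AE z in \<sigma>. \<exists>l. has_radial_limit u z l)"

lemma continuous_on_dilation:
  assumes "u holomorphic_on ball 0 1" "0 \<le> r" "r < 1"
  shows "continuous_on (sphere 0 1) (\<lambda>z. u (of_real r * z))"
  using assms by (intro continuous_on_compose2[OF holomorphic_on_imp_continuous_on[OF assms(1)]] continuous_intros)
    (auto simp: norm_mult)

lemma dilation_filterlim: "filterlim (\<lambda>n. 1 - 1 / real (n + 2)) (at_left 1) sequentially"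
  by real_asymp

text \<open>
  The points with a radial limit form a Borel set: for fixed \<open>k\<close> and \<open>m\<close> the Cauchy condition is an intersection
  of closed conditions, one for each pair of radii. On that set the radial limit is a limit of
  a sequence of continuous functions. Off it, \<^const>\<open>Lim\<close> is one fixed unspecified value.
\<close>

lemma radial_limit_measurable:
  assumes u: "u holomorphic_on ball 0 1"
  shows "radial_limit u \<in> borel_measurable \<sigma>"
proof -
  define d where "d m = 1 - 1 / real (m + 2)" for m
  have d: "0 \<le> d m" "d m < 1" for m by (auto simp: d_def divide_le_eq)
  define C where "C k m = {z \<in> sphere 0 1. \<forall>r s. d m < r \<and> r < 1 \<and> d m < s \<and> s < 1 \<longrightarrow>
    cmod (u (of_real r * z) - u (of_real s * z)) \<le> 1 / real (k + 1)}" for k m :: nat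
  have "closed (C k m)" for k m
  proof -
    have "C k m = sphere 0 1 \<inter> (\<Inter>r\<in>{d m<..<1}. \<Inter>s\<in>{d m<..<1}.
        {z \<in> sphere 0 1. cmod (u (of_real r * z) - u (of_real s * z)) \<le> 1 / real (k + 1)})"
      by (auto simp: C_def)
    also have "closed \<dots>"
      using d(1)[of m] by (intro closed_Int closed_INT ballI continuous_on_closed_Collect_le continuous_intros continuous_on_dilation u) auto
    finally show ?thesis .
  qed
  then have "C k m \<in> sets \<sigma>" for k m
    by (auto simp: sets_circle_measure sets_restrict_space C_def intro!: image_eqI[of _ _ "C k m"])
  define E where "E = (\<Inter>k. \<Union>m. C k m)"
  have [measurable]: "E \<in> sets \<sigma>"
    using \<open>\<And>k m. C k m \<in> sets \<sigma>\<close> by (auto simp: E_def)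
  have E: "(\<exists>l. has_radial_limit u z l) \<longleftrightarrow> z \<in> E" if "cmod z = 1" for z
    using that unfolding at_left_limit_iff_Cauchy by (simp add: E_def C_def d_def)
  have [measurable]: "(\<lambda>z. u (of_real (d n) * z)) \<in> borel_measurable \<sigma>" for n
    by (intro continuous_imp_measurable_circle continuous_on_dilation u d refl)
  have "(\<lambda>z. if z \<in> E then lim (\<lambda>n. u (of_real (d n) * z)) else (THE l. False)) \<in> borel_measurable \<sigma>"
    by measurable
  moreover have "radial_limit u z = (if z \<in> E then lim (\<lambda>n. u (of_real (d n) * z)) else (THE l. False))"
    if "z \<in> space \<sigma>" for z
  proof (cases "\<exists>l. has_radial_limit u z l")
    case True
    then obtain l where l: "has_radial_limit u z l" by blast
    have "(\<lambda>n. u (of_real (d n) * z)) \<longlonglongrightarrow> l"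
      unfolding d_def by (rule filterlim_compose[OF l dilation_filterlim])
    then show ?thesis
      using True E[of z] that radial_limit_eqI[OF l] by (simp add: limI)
  next
    case False
    then have "z \<notin> E" "(\<lambda>l. has_radial_limit u z l) = (\<lambda>l. False)" using E[of z] that by auto
    then show ?thesis
      by (simp add: radial_limit_def Topological_Spaces.Lim_def)
  qed
  ultimately show ?thesis
    by (subst measurable_cong) auto
qed

lemma radial_limit_AE:
  assumes "radially_convergent u"
  shows "AE z in \<sigma>. has_radial_limit u z (radial_limit u z)"
  using assms unfolding radially_convergent_def
  by (auto elim!: eventually_mono simp: radial_limit_eqI)

lemma radial_limit_bound:
  assumes u: "radially_convergent u" and B: "\<And>w. w \<in> ball 0 1 \<Longrightarrow> cmod (u w) \<le> B"
  shows "AE z in \<sigma>. cmod (radial_limit u z) \<le> B"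
  using radial_limit_AE[OF u] AE_space
proof eventually_elim
  case (elim z)
  show ?case
  proof (rule tendsto_upperbound)
    show "((\<lambda>r::real. cmod (u (of_real r * z))) \<longlongrightarrow> cmod (radial_limit u z)) (at_left 1)"
      by (intro tendsto_intros elim)
    have "eventually (\<lambda>r::real. r \<in> {0<..<1}) (at_left 1)"
      by (rule eventually_at_leftI[of 0]) auto
    then show "eventually (\<lambda>r::real. cmod (u (of_real r * z)) \<le> B) (at_left 1)"
      by eventually_elim (use elim B in \<open>auto simp: norm_mult\<close>)
  qed auto
qed

lemma hardy_inf_bound:
  assumes "u \<in> hardy_inf"
  obtains B where "B > 0" "\<And>w. w \<in> ball 0 1 \<Longrightarrow> cmod (u w) \<le> B"
  using assms by (auto simp: hardy_inf_def bounded_pos)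

lemma bounded_multiplier_radial_limit: "radially_convergent u \<Longrightarrow> bounded_multiplier (radial_limit u)"
proof -
  assume u: "radially_convergent u"
  then have "u \<in> hardy_inf" "u holomorphic_on ball 0 1"
    by (auto simp: radially_convergent_def hardy_inf_def)
  then obtain B where "\<And>w. w \<in> ball 0 1 \<Longrightarrow> cmod (u w) \<le> B"
    using hardy_inf_bound by blast
  then show ?thesis
    using \<open>u holomorphic_on ball 0 1\<close> by (intro bounded_multiplierI radial_limit_measurable radial_limit_bound u)
qed

definition boundary :: "(complex \<Rightarrow> complex) \<Rightarrow> l2_circle" where
  "boundary u = abs_l2_circle (radial_limit u)"

lemma rep_boundary:
  "radially_convergent u \<Longrightarrow> AE z in \<sigma>. rep (boundary u) z = radial_limit u z"
  unfolding boundary_def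
  by (intro rep_abs_l2 bounded_multiplier_square_integrable_self bounded_multiplier_radial_limit)

text \<open>
  Apply dominated convergence to the integrals over circles of radius $r < 1$ as $r \to 1$.
\<close>

lemma fourier_coeff_boundary:
  assumes u: "radially_convergent u" and a: "\<And>w. cmod w < 1 \<Longrightarrow> (\<lambda>n. a n * w ^ n) sums u w"
  shows "fourier_coeff (boundary u) k = (if k \<ge> 0 then a (nat k) else 0)"
proof -
  have hol: "u holomorphic_on ball 0 1" and "u \<in> hardy_inf"
    using u by (auto simp: radially_convergent_def hardy_inf_def)
  then obtain B where B: "B > 0" "\<And>w. w \<in> ball 0 1 \<Longrightarrow> cmod (u w) \<le> B"
    using hardy_inf_bound by blast
  define r where "r n = 1 - 1 / real (n + 2)" for n
  have r: "0 \<le> r n" "r n < 1" for n by (auto simp: r_def divide_le_eq)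
  have [measurable]: "(\<lambda>z. u (of_real (r n) * z)) \<in> borel_measurable \<sigma>" for n
    by (intro continuous_imp_measurable_circle continuous_on_dilation hol r refl)
  have [measurable]: "radial_limit u \<in> borel_measurable \<sigma>"
    by (rule radial_limit_measurable[OF hol])
  have "(\<lambda>n. \<integral>z. u (of_real (r n) * z) * z powi (- k) \<partial>\<sigma>) \<longlonglongrightarrow> (\<integral>z. radial_limit u z * z powi (- k) \<partial>\<sigma>)"
  proof (rule integral_dominated_convergence[where w = "\<lambda>_. B"])
    show "AE z in \<sigma>. (\<lambda>n. u (of_real (r n) * z) * z powi (- k)) \<longlonglongrightarrow> radial_limit u z * z powi (- k)"
      using radial_limit_AE[OF u]
    proof eventually_elim
      case (elim z)
      show ?case
        by (intro tendsto_mult_right) (use filterlim_compose[OF elim dilation_filterlim] in \<open>simp add: r_def\<close>)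
    qed
    show "AE z in \<sigma>. norm (u (of_real (r n) * z) * z powi (- k)) \<le> B" for n
      using r[of n] by (intro AE_I2) (auto simp: norm_mult norm_power_int intro!: B)
  qed auto
  also have "(\<lambda>n. \<integral>z. u (of_real (r n) * z) * z powi (- k) \<partial>\<sigma>)
      = (\<lambda>n. if k \<ge> 0 then a (nat k) * of_real (r n) ^ nat k else 0)"
    by (intro ext integral_power_series_circle a r)
  finally have 1: "(\<lambda>n. if k \<ge> 0 then a (nat k) * of_real (r n) ^ nat k else 0) \<longlonglongrightarrow> fourier_coeff (boundary u) k"
    by (simp add: fourier_coeff_eq_integral[OF rep_boundary[OF u]])
  have "r \<longlonglongrightarrow> 1" unfolding r_def by real_asymp
  then have "(\<lambda>n. a (nat k) * of_real (r n) ^ nat k) \<longlonglongrightarrow> a (nat k) * of_real 1 ^ nat k"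
    by (intro tendsto_intros)
  then have "(\<lambda>n. if k \<ge> 0 then a (nat k) * of_real (r n) ^ nat k else 0) \<longlonglongrightarrow> (if k \<ge> 0 then a (nat k) else 0)"
    by simp
  from LIMSEQ_unique[OF 1 this] show ?thesis .
qed

lemma taylor_sums_disc:
  "u holomorphic_on ball 0 1 \<Longrightarrow> cmod w < 1 \<Longrightarrow> (\<lambda>n. (deriv ^^ n) u 0 / fact n * w ^ n) sums u w"
  using holomorphic_power_series[of u 0 1 w] by simp

lemma boundary_in_hardy2: "radially_convergent u \<Longrightarrow> boundary u \<in> hardy2"
  using fourier_coeff_boundary[OF _ taylor_sums_disc[of u]]
  by (auto simp: hardy2_def radially_convergent_def hardy_inf_def)

lemma disc_ext_boundary:
  assumes "radially_convergent u" "cmod w < 1"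
  shows "disc_ext (boundary u) w = u w"
proof -
  have hol: "u holomorphic_on ball 0 1"
    using assms by (auto simp: radially_convergent_def hardy_inf_def)
  have "fourier_coeff (boundary u) (int n) = (deriv ^^ n) u 0 / fact n" for n
    using fourier_coeff_boundary[OF assms(1) taylor_sums_disc[OF hol], of "int n"] by simp
  then show ?thesis
    using sums_unique2[OF disc_ext_sums[OF assms(2)] ] taylor_sums_disc[OF hol assms(2)] by simp
qed

lemma boundary_eqI:
  assumes "radially_convergent u" "f \<in> hardy2" "\<And>w. cmod w < 1 \<Longrightarrow> disc_ext f w = u w"
  shows "boundary u = f"
  using assms by (intro disc_ext_inject boundary_in_hardy2) (auto simp: disc_ext_boundary)

section \<open>The radial maximal inequality\<close>

abbreviation circle_arc :: "complex \<Rightarrow> real \<Rightarrow> complex set" where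
  "circle_arc z \<rho> \<equiv> cball z \<rho> \<inter> sphere 0 1"

lemma arc_sets [measurable]: "circle_arc z \<rho> \<in> sets \<sigma>"
  by (simp add: sets_circle_measure sets_restrict_space) (metis borel_closed closed_cball image_eqI inf_commute)

lemma measure_arc_rotation:
  assumes z: "cmod z = 1"
  shows "emeasure \<sigma> (circle_arc z \<rho>) = emeasure \<sigma> (circle_arc 1 \<rho>)"
proof -
  have m: "(\<lambda>w. z * w) \<in> \<sigma> \<rightarrow>\<^sub>M \<sigma>"
    using z by (intro measurable_circle_self continuous_intros) (auto simp: norm_mult)
  have d: "dist z (z * w) = dist 1 w" for w
  proof -
    have "z - z * w = z * (1 - w)" by (simp add: algebra_simps)
    then show ?thesis using z by (simp add: dist_norm norm_mult)
  qed
  have "emeasure \<sigma> (circle_arc z \<rho>) = emeasure (distr \<sigma> \<sigma> (\<lambda>w. z * w)) (circle_arc z \<rho>)"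
    by (simp add: distr_rotation_circle z)
  also have "\<dots> = emeasure \<sigma> ((\<lambda>w. z * w) -` circle_arc z \<rho> \<inter> space \<sigma>)"
    by (rule emeasure_distr[OF m arc_sets])
  also have "(\<lambda>w. z * w) -` circle_arc z \<rho> \<inter> space \<sigma> = circle_arc 1 \<rho>"
    using z by (auto simp: d norm_mult)
  finally show ?thesis .
qed

lemma dist_1_cis: "dist 1 (cis t) = 2 * \<bar>sin (t / 2)\<bar>"
  using dist_exp_i_1[of t] by (simp add: cis_conv_exp dist_norm norm_minus_commute)

text \<open>
  A chord is at most as long as its arc, so the arc around $1$ contains all angles in $[0, \rho]$.
\<close>

lemma measure_arc_ge:
  assumes z: "cmod z = 1" and \<rho>: "0 \<le> \<rho>" "\<rho> \<le> 2"
  shows "\<rho> / (2 * pi) \<le> measure \<sigma> (circle_arc z \<rho>)"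
proof -
  have "ennreal (\<rho> / (2 * pi)) = emeasure lborel {0..\<rho>} / ennreal (2 * pi)"
    using \<rho> by (simp add: divide_ennreal)
  also have "\<dots> \<le> emeasure lborel ({0..2*pi} \<inter> cis -` cball 1 \<rho>) / ennreal (2 * pi)"
  proof (intro divide_right_mono_ennreal emeasure_mono)
    have "dist 1 (cis t) \<le> t" if "0 \<le> t" for t
      using abs_sin_x_le_abs_x[of "t/2"] that by (simp add: dist_1_cis)
    then show "{0..\<rho>} \<subseteq> {0..2*pi} \<inter> cis -` cball 1 \<rho>"
      using \<rho> pi_gt3 by force
    show "{0..2*pi} \<inter> cis -` cball 1 \<rho> \<in> sets lborel"
      by (simp, intro borel_closed closed_Int closed_vimage) (auto intro!: continuous_intros)
  qed
  also have "\<dots> = emeasure \<sigma> (circle_arc z \<rho>)"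
    by (simp add: measure_arc_rotation[OF z] emeasure_circle_measure)
  finally show ?thesis
    by (simp add: circle.emeasure_eq_measure)
qed

text \<open>
  The angle is at most twice the chord, by $\sin x \ge x/2$ for $0 \le x \le \pi/2$. Together with the lower bound this gives
  the doubling property that the covering argument needs; the constants are not sharp.
\<close>

lemma measure_arc_le:
  assumes z: "cmod z = 1" and \<rho>: "0 \<le> \<rho>"
  shows "measure \<sigma> (circle_arc z \<rho>) \<le> \<rho>"
proof -
  have sin_ge: "t / 4 \<le> sin (t / 2)" if "0 \<le> t" "t \<le> pi" for t :: real
  proof -
    define x where "x = t / 2"
    \<comment> \<open>$\pi/2 < 8/5$\<close>
    have x: "0 \<le> x" "x \<le> 8/5" using that pi_less_4 pi_approx by (auto simp: x_def)
    have "\<bar>sin x - x\<bar> \<le> x ^ 3 / 6"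
      using Maclaurin_sin_bound[of x 3] x by (simp add: eval_nat_numeral sin_coeff_def fact_numeral)
    moreover have "x ^ 3 \<le> 3 * x"
    proof -
      have "x ^ 2 \<le> (8/5) ^ 2" using x by (intro power_mono) auto
      then have "x * x ^ 2 \<le> x * 3" using x by (intro mult_left_mono) (auto simp: power2_eq_square)
      then show ?thesis by (simp add: eval_nat_numeral mult.commute)
    qed
    ultimately have "x / 2 \<le> sin x" by linarith
    then show ?thesis by (simp add: x_def)
  qed
  have "emeasure \<sigma> (circle_arc z \<rho>) = emeasure lborel ({0..2*pi} \<inter> cis -` cball 1 \<rho>) / ennreal (2 * pi)"
    by (simp add: measure_arc_rotation[OF z] emeasure_circle_measure)
  also have "\<dots> \<le> ennreal (2 * pi * \<rho>) / ennreal (2 * pi)"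
  proof (rule divide_right_mono_ennreal)
    have "{0..2*pi} \<inter> cis -` cball 1 \<rho> \<subseteq> {0..2*\<rho>} \<union> {2*pi - 2*\<rho>..2*pi}"
    proof
      fix t assume "t \<in> {0..2*pi} \<inter> cis -` cball 1 \<rho>"
      then have t: "0 \<le> t" "t \<le> 2 * pi" "2 * \<bar>sin (t / 2)\<bar> \<le> \<rho>"
        by (auto simp: dist_1_cis)
      show "t \<in> {0..2*\<rho>} \<union> {2*pi - 2*\<rho>..2*pi}"
      proof (cases "t \<le> pi")
        case True
        then show ?thesis using sin_ge[of t] t by auto
      next
        case False
        have "sin ((2 * pi - t) / 2) = sin (t / 2)"
          by (simp add: diff_divide_distrib)
        then show ?thesis using sin_ge[of "2 * pi - t"] t False by auto
      qed
    qed
    then have "emeasure lborel ({0..2*pi} \<inter> cis -` cball 1 \<rho>) \<le> emeasure lborel ({0..2*\<rho>} \<union> {2*pi - 2*\<rho>..2*pi})"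
      by (intro emeasure_mono) auto
    also have "\<dots> \<le> emeasure lborel {0..2*\<rho>} + emeasure lborel {2*pi - 2*\<rho>..2*pi}"
      by (rule emeasure_subadditive) auto
    also have "\<dots> = ennreal (4 * \<rho>)"
      using \<rho> by (simp flip: ennreal_plus)
    also have "\<dots> \<le> ennreal (2 * pi * \<rho>)"
      using \<rho> pi_gt3 by (intro ennreal_leI mult_right_mono) auto
    finally show "emeasure lborel ({0..2*pi} \<inter> cis -` cball 1 \<rho>) \<le> ennreal (2 * pi * \<rho>)" .
  qed
  also have "\<dots> = ennreal \<rho>"
    using \<rho> by (simp add: divide_ennreal)
  finally show ?thesis
    using \<rho> by (simp add: circle.emeasure_eq_measure)
qed

text \<open>
  Take the arcs on which \<open>\<nu>\<close> exceeds \<open>\<kappa>\<close> times arc length. By the Vitali covering lemma there are disjoint arcs among them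
  whose fivefold enlargements cover all of them, and doubling bounds the total length
  of the enlargements by a multiple of the \<open>\<nu>\<close>-mass of the disjoint arcs. Passing to the set \<open>E\<close> avoids measurability of the
  maximal function.
\<close>

lemma weak_type_maximal:
  assumes \<nu>: "finite_measure \<nu>" and sets\<nu>: "sets \<nu> = sets \<sigma>" and \<kappa>: "\<kappa> > 0"
  obtains E where "E \<in> sets \<sigma>" "measure \<sigma> E \<le> 10 * pi / \<kappa> * measure \<nu> (sphere 0 1)"
    "\<And>z \<rho>. cmod z = 1 \<Longrightarrow> z \<notin> E \<Longrightarrow> 0 < \<rho> \<Longrightarrow> \<rho> \<le> 2 \<Longrightarrow> measure \<nu> (circle_arc z \<rho>) \<le> \<kappa> * measure \<sigma> (circle_arc z \<rho>)"
proof -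
  interpret \<nu>: finite_measure \<nu> by fact
  have sp: "space \<nu> = sphere 0 1"
    using sets_eq_imp_space_eq[OF sets\<nu>] by simp
  have arc\<nu>: "circle_arc z \<rho> \<in> sets \<nu>" for z \<rho> by (simp add: sets\<nu>)
  define K where "K = {(z, \<rho>). cmod z = 1 \<and> 0 < \<rho> \<and> \<rho> \<le> 2 \<and> measure \<nu> (circle_arc z \<rho>) > \<kappa> * measure \<sigma> (circle_arc z \<rho>)}"
  have K: "0 < snd i \<and> snd i \<le> 2" if "i \<in> K" for i
    using that by (auto simp: K_def)
  obtain C where C: "countable C" "C \<subseteq> K"
     "pairwise (\<lambda>i j. disjnt (cball (fst i) (snd i)) (cball (fst j) (snd j))) C"
     "(\<Union>i\<in>K. cball (fst i) (snd i)) \<subseteq> (\<Union>i\<in>C. cball (fst i) (5 * snd i))"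
    by (rule Vitali_covering_lemma_cballs[where a = fst and r = snd, OF order_refl K]) (assumption, rule that)
  \<comment> \<open>enumerate the disjoint arcs, possibly finitely many, by natural numbers, with empty sets elsewhere\<close>
  define I where "I = to_nat_on C ` C"
  define A where "A t n = (if n \<in> I then circle_arc (fst (from_nat_into C n)) (t * snd (from_nat_into C n)) else {})" for t n
  have inC: "from_nat_into C n \<in> C" if "n \<in> I" for n
    using that C(1) by (auto simp: I_def)
  have As: "A t n \<in> sets \<sigma>" "A t n \<in> sets \<nu>" for t n
    by (auto simp: A_def sets\<nu>)
  have disj: "disjoint_family (A 1)"
  proof -
    have "A 1 m \<inter> A 1 n = {}" if "m \<noteq> n" for m n
    proof (cases "m \<in> I \<and> n \<in> I")
      case True
      then have "from_nat_into C m \<noteq> from_nat_into C n"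
        using that C(1) by (auto simp: I_def)
      then have "disjnt (cball (fst (from_nat_into C m)) (snd (from_nat_into C m)))
                        (cball (fst (from_nat_into C n)) (snd (from_nat_into C n)))"
        using C(3) inC True by (auto simp: pairwise_def)
      then show ?thesis using True by (auto simp: A_def disjnt_def)
    qed (auto simp: A_def)
    then show ?thesis by (auto simp: disjoint_family_on_def)
  qed
  define E where "E = (\<Union>n. A 5 n)"
  have Es: "E \<in> sets \<sigma>" using As by (auto simp: E_def)
  have term_le: "emeasure \<sigma> (A 5 n) \<le> ennreal (10 * pi / \<kappa>) * emeasure \<nu> (A 1 n)" for n
  proof (cases "n \<in> I")
    case True
    define z \<rho> where "z = fst (from_nat_into C n)" and "\<rho> = snd (from_nat_into C n)"
    have "(z, \<rho>) \<in> K" using inC[OF True] C(2) by (auto simp: z_def \<rho>_def)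
    then have K: "cmod z = 1" "0 < \<rho>" "\<rho> \<le> 2" "\<kappa> * measure \<sigma> (circle_arc z \<rho>) < measure \<nu> (circle_arc z \<rho>)"
      by (auto simp: K_def)
    \<comment> \<open>the length of the enlarged arc is at most $5\rho$, that of the arc itself at least $\rho/(2\pi)$\<close>
    have "measure \<sigma> (circle_arc z (5 * \<rho>)) \<le> 5 * \<rho>"
      using measure_arc_le[OF K(1)] K by simp
    also have "5 * \<rho> \<le> 10 * pi * measure \<sigma> (circle_arc z \<rho>)"
      using measure_arc_ge[OF K(1), of \<rho>] K by (simp add: field_simps)
    also have "\<dots> \<le> 10 * pi * (measure \<nu> (circle_arc z \<rho>) / \<kappa>)"
      using K(4) \<kappa> by (intro mult_left_mono) (auto simp: field_simps)
    finally have "measure \<sigma> (circle_arc z (5 * \<rho>)) \<le> 10 * pi / \<kappa> * measure \<nu> (circle_arc z \<rho>)"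
      by simp
    then have "ennreal (measure \<sigma> (circle_arc z (5 * \<rho>))) \<le> ennreal (10 * pi / \<kappa>) * ennreal (measure \<nu> (circle_arc z \<rho>))"
      using \<kappa> by (simp add: ennreal_leI flip: ennreal_mult)
    then show ?thesis
      using True by (simp add: A_def z_def \<rho>_def circle.emeasure_eq_measure \<nu>.emeasure_eq_measure)
  qed (auto simp: A_def)
  have "emeasure \<sigma> E \<le> (\<Sum>n. emeasure \<sigma> (A 5 n))"
    unfolding E_def using As by (intro emeasure_subadditive_countably) auto
  also have "\<dots> \<le> (\<Sum>n. ennreal (10 * pi / \<kappa>) * emeasure \<nu> (A 1 n))"
    by (intro suminf_le term_le) auto
  also have "\<dots> = ennreal (10 * pi / \<kappa>) * (\<Sum>n. emeasure \<nu> (A 1 n))"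
    by (rule ennreal_suminf_cmult)
  also have "(\<Sum>n. emeasure \<nu> (A 1 n)) = emeasure \<nu> (\<Union>n. A 1 n)"
    using As disj by (intro suminf_emeasure) auto
  also have "\<dots> \<le> emeasure \<nu> (sphere 0 1)"
    using emeasure_space[of \<nu>] by (simp add: sp)
  finally have "emeasure \<sigma> E \<le> ennreal (10 * pi / \<kappa>) * emeasure \<nu> (sphere 0 1)"
    by (simp add: mult_left_mono)
  then have "measure \<sigma> E \<le> 10 * pi / \<kappa> * measure \<nu> (sphere 0 1)"
    using \<kappa> by (simp add: circle.emeasure_eq_measure \<nu>.emeasure_eq_measure flip: ennreal_mult)
  moreover have "measure \<nu> (circle_arc z \<rho>) \<le> \<kappa> * measure \<sigma> (circle_arc z \<rho>)"
    if z: "cmod z = 1" "z \<notin> E" "0 < \<rho>" "\<rho> \<le> 2" for z \<rho>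
  proof (rule ccontr)
    assume "\<not> ?thesis"
    then have "(z, \<rho>) \<in> K" using z by (auto simp: K_def)
    then have "z \<in> (\<Union>i\<in>K. cball (fst i) (snd i))"
      using z by (intro UN_I[of "(z, \<rho>)"]) auto
    then obtain i where i: "i \<in> C" "z \<in> cball (fst i) (5 * snd i)"
      using C(4) by blast
    have "z \<in> A 5 (to_nat_on C i)"
      using i z C(1) by (auto simp: A_def I_def)
    then show False using z by (auto simp: E_def)
  qed
  ultimately show thesis using Es that by blast
qed

subsection \<open>The Poisson kernel\<close>

text \<open>
  The Poisson kernel at radius \<open>r\<close> as a function of the chord length $t = |\zeta - z|$. In this form it is visibly
  decreasing in \<open>t\<close>, and the balls of the Euclidean plane can serve as arcs.
\<close>

definition poisson :: "real \<Rightarrow> real \<Rightarrow> real" where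
  "poisson r t = (1 - r\<^sup>2) / ((1 - r)\<^sup>2 + r * t\<^sup>2)"

lemma poisson_denominator_pos:
  fixes r t :: real
  assumes "0 \<le> r" "r < 1"
  shows "(1 - r)\<^sup>2 + r * t\<^sup>2 > 0"
proof -
  have "(1 - r)\<^sup>2 > 0" "r * t\<^sup>2 \<ge> 0" using assms by auto
  then show ?thesis by linarith
qed

lemma poisson_nonneg: "0 \<le> r \<Longrightarrow> r < 1 \<Longrightarrow> poisson r t \<ge> 0"
  using poisson_denominator_pos[of r t] by (auto simp: poisson_def intro!: divide_nonneg_pos power_le_one)

text \<open>
  The kernel decreases with the distance, so it is a superposition of indicators of the
  intervals $[0, \tau]$, with the weight $-\partial_\tau P$ at $\tau \in [0,2]$, and of the constant $P(2)$.
\<close>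

lemma poisson_layers:
  assumes r: "0 \<le> r" "r < 1"
  obtains c w where "w \<in> borel_measurable borel" "\<And>t. w t \<ge> (0::real)" "c \<ge> (0::real)"
    "\<And>t. 0 \<le> t \<Longrightarrow> t \<le> 2 \<Longrightarrow> ennreal (poisson r t) = ennreal c + (\<integral>\<^sup>+\<tau>. ennreal (w \<tau>) * indicator {t..2} \<tau> \<partial>lborel)"
    "w 0 = 0"
proof
  \<comment> \<open>minus the derivative of the kernel; the maximum makes it nonnegative on the whole line\<close>
  define w where "w t = (1 - r\<^sup>2) * (2 * r * max 0 t) / ((1 - r)\<^sup>2 + r * t\<^sup>2)\<^sup>2" for t
  have r2: "r\<^sup>2 \<le> 1" using r by (intro power_le_one) auto
  show [measurable]: "w \<in> borel_measurable borel" unfolding w_def by measurable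
  show "w t \<ge> 0" for t unfolding w_def using r r2 by auto
  show "poisson r 2 \<ge> 0" using r by (rule poisson_nonneg)
  show "w 0 = 0" by (simp add: w_def)
  fix t :: real assume t: "0 \<le> t" "t \<le> 2"
  have "(\<integral>\<^sup>+\<tau>. ennreal (w \<tau>) * indicator {t..2} \<tau> \<partial>lborel) = ennreal (- poisson r 2 - (- poisson r t))"
  proof (rule nn_integral_FTC_Icc)
    fix x assume x: "x \<in> {t..2}"
    show "0 \<le> w x" unfolding w_def using r r2 by auto
    have p: "(1 - r)\<^sup>2 + r * x\<^sup>2 > 0" using r by (rule poisson_denominator_pos)
    have "((\<lambda>t. - ((1 - r\<^sup>2) / ((1 - r)\<^sup>2 + r * t\<^sup>2))) has_real_derivative w x) (at x)"
      using p x t by (auto intro!: derivative_eq_intros simp: w_def power2_eq_square)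
    then show "((\<lambda>t. - poisson r t) has_real_derivative w x) (at x)"
      by (simp add: poisson_def)
  qed (use t in auto)
  moreover have "poisson r 2 \<le> poisson r t"
    unfolding poisson_def using r r2 t poisson_denominator_pos[OF r, of t] poisson_denominator_pos[OF r, of 2]
    by (intro divide_left_mono add_left_mono mult_left_mono power_mono mult_pos_pos) auto
  ultimately show "ennreal (poisson r t) = ennreal (poisson r 2) + (\<integral>\<^sup>+\<tau>. ennreal (w \<tau>) * indicator {t..2} \<tau> \<partial>lborel)"
    using poisson_nonneg[OF r, of 2] by (simp flip: ennreal_plus)
qed

lemma poisson_measurable [measurable]: "poisson r \<in> borel_measurable borel"
  unfolding poisson_def by measurable

lemma dist_circle_measurable:
  assumes "sets \<mu> = sets \<sigma>"
  shows "(\<lambda>\<zeta>. cmod (\<zeta> - z)) \<in> borel_measurable \<mu>"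
  using assms by (intro continuous_imp_measurable_circle continuous_intros)

text \<open>
  Tonelli's theorem turns the superposition of indicators into a superposition of measures of arcs.
\<close>

lemma nn_integral_poisson_layers:
  assumes \<mu>: "finite_measure \<mu>" and sets: "sets \<mu> = sets \<sigma>" and z: "cmod z = 1"
    and w [measurable]: "w \<in> borel_measurable borel" and c: "c \<ge> 0"
    and eq: "\<And>t. 0 \<le> t \<Longrightarrow> t \<le> 2 \<Longrightarrow> ennreal (poisson r t) = ennreal c + (\<integral>\<^sup>+\<tau>. ennreal (w \<tau>) * indicator {t..2} \<tau> \<partial>lborel)"
  shows "(\<integral>\<^sup>+\<zeta>. ennreal (poisson r (cmod (\<zeta> - z))) \<partial>\<mu>) =
     ennreal c * emeasure \<mu> (circle_arc z 2) + (\<integral>\<^sup>+\<tau>. ennreal (w \<tau>) * indicator {0..2} \<tau> * emeasure \<mu> (circle_arc z \<tau>) \<partial>lborel)"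
proof -
  interpret \<mu>: finite_measure \<mu> by fact
  interpret pair_sigma_finite \<mu> lborel by standard
  note [measurable] = dist_circle_measurable[OF sets, of z]
  have sp: "space \<mu> = sphere 0 1"
    using sets_eq_imp_space_eq[OF sets] by simp
  have d2: "cmod (\<zeta> - z) \<le> 2" if "cmod \<zeta> = 1" for \<zeta>
    using norm_triangle_ineq4[of \<zeta> z] that z by simp
  have "circle_arc z 2 = sphere 0 1"
    using d2 by (auto simp: dist_norm norm_minus_commute)
  then have total: "emeasure \<mu> (circle_arc z 2) = emeasure \<mu> (space \<mu>)"
    by (simp add: sp)
  have m: "(\<lambda>\<zeta>. \<integral>\<^sup>+\<tau>. ennreal (w \<tau>) * indicator {cmod (\<zeta> - z)..2} \<tau> \<partial>lborel) \<in> borel_measurable \<mu>"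
    unfolding indicator_def atLeastAtMost_iff by measurable
  have "(\<integral>\<^sup>+\<zeta>. ennreal (poisson r (cmod (\<zeta> - z))) \<partial>\<mu>)
      = (\<integral>\<^sup>+\<zeta>. ennreal c + (\<integral>\<^sup>+\<tau>. ennreal (w \<tau>) * indicator {cmod (\<zeta> - z)..2} \<tau> \<partial>lborel) \<partial>\<mu>)"
    by (intro nn_integral_cong eq) (auto simp: sp d2)
  also have "\<dots> = ennreal c * emeasure \<mu> (circle_arc z 2) + (\<integral>\<^sup>+\<zeta>. (\<integral>\<^sup>+\<tau>. ennreal (w \<tau>) * indicator {cmod (\<zeta> - z)..2} \<tau> \<partial>lborel) \<partial>\<mu>)"
    using m by (subst nn_integral_add) (auto simp: total)
  also have "(\<integral>\<^sup>+\<zeta>. (\<integral>\<^sup>+\<tau>. ennreal (w \<tau>) * indicator {cmod (\<zeta> - z)..2} \<tau> \<partial>lborel) \<partial>\<mu>)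
     = (\<integral>\<^sup>+\<tau>. (\<integral>\<^sup>+\<zeta>. ennreal (w \<tau>) * indicator {cmod (\<zeta> - z)..2} \<tau> \<partial>\<mu>) \<partial>lborel)"
    by (rule Fubini'[symmetric]) (unfold indicator_def atLeastAtMost_iff, measurable)
  also have "\<dots> = (\<integral>\<^sup>+\<tau>. ennreal (w \<tau>) * indicator {0..2} \<tau> * emeasure \<mu> (circle_arc z \<tau>) \<partial>lborel)"
  proof (rule nn_integral_cong)
    fix \<tau>
    have "(\<integral>\<^sup>+\<zeta>. ennreal (w \<tau>) * indicator {cmod (\<zeta> - z)..2} \<tau> \<partial>\<mu>)
        = (\<integral>\<^sup>+\<zeta>. (ennreal (w \<tau>) * indicator {0..2} \<tau>) * indicator (circle_arc z \<tau>) \<zeta> \<partial>\<mu>)"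
      by (intro nn_integral_cong)
         (auto simp: sp indicator_def dist_norm norm_minus_commute intro: order.trans[OF norm_ge_zero])
    also have "\<dots> = ennreal (w \<tau>) * indicator {0..2} \<tau> * emeasure \<mu> (circle_arc z \<tau>)"
      by (rule nn_integral_cmult_indicator) (simp add: sets)
    finally show "(\<integral>\<^sup>+\<zeta>. ennreal (w \<tau>) * indicator {cmod (\<zeta> - z)..2} \<tau> \<partial>\<mu>)
        = ennreal (w \<tau>) * indicator {0..2} \<tau> * emeasure \<mu> (circle_arc z \<tau>)" .
  qed
  finally show ?thesis .
qed

text \<open>
  A bound of \<open>\<nu>\<close> by length on all arcs around \<open>z\<close> passes to superpositions of arcs, hence to the Poisson kernel.
\<close>

lemma poisson_domination:
  assumes \<nu>: "finite_measure \<nu>" and sets\<nu>: "sets \<nu> = sets \<sigma>" and r: "0 \<le> r" "r < 1"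
    and z: "cmod z = 1" and \<kappa>: "\<kappa> > 0"
    and arcs: "\<And>\<rho>. 0 < \<rho> \<Longrightarrow> \<rho> \<le> 2 \<Longrightarrow> measure \<nu> (circle_arc z \<rho>) \<le> \<kappa> * measure \<sigma> (circle_arc z \<rho>)"
  shows "(\<integral>\<^sup>+\<zeta>. ennreal (poisson r (cmod (\<zeta> - z))) \<partial>\<nu>)
    \<le> ennreal \<kappa> * (\<integral>\<^sup>+\<zeta>. ennreal (poisson r (cmod (\<zeta> - z))) \<partial>\<sigma>)"
proof -
  interpret \<nu>: finite_measure \<nu> by fact
  obtain c w where w [measurable]: "w \<in> borel_measurable borel" and w0: "\<And>t. w t \<ge> (0::real)" "c \<ge> (0::real)"
    and eq: "\<And>t. 0 \<le> t \<Longrightarrow> t \<le> 2 \<Longrightarrow> ennreal (poisson r t) = ennreal c + (\<integral>\<^sup>+\<tau>. ennreal (w \<tau>) * indicator {t..2} \<tau> \<partial>lborel)"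
    and w00: "w 0 = 0"
    by (rule poisson_layers[OF r]) (rule that)
  have arcs': "emeasure \<nu> (circle_arc z \<rho>) \<le> ennreal \<kappa> * emeasure \<sigma> (circle_arc z \<rho>)" if "0 < \<rho>" "\<rho> \<le> 2" for \<rho>
  proof -
    have "ennreal (measure \<nu> (circle_arc z \<rho>)) \<le> ennreal (\<kappa> * measure \<sigma> (circle_arc z \<rho>))"
      by (rule ennreal_leI[OF arcs[OF that]])
    then show ?thesis
      using \<kappa> by (simp add: circle.emeasure_eq_measure \<nu>.emeasure_eq_measure ennreal_mult)
  qed
  have meas: "(\<lambda>\<tau>. ennreal (w \<tau>) * indicator {0..2} \<tau> * emeasure \<sigma> (circle_arc z \<tau>)) \<in> borel_measurable lborel"
  proof -
    interpret pair_sigma_finite \<sigma> lborel by standard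
    note [measurable] = dist_circle_measurable[OF refl, of z]
    have "(\<lambda>\<tau>. \<integral>\<^sup>+\<zeta>. indicator {cmod (\<zeta> - z)..} \<tau> \<partial>\<sigma>) \<in> borel_measurable lborel"
      unfolding indicator_def atLeast_iff by measurable
    moreover have "(\<integral>\<^sup>+\<zeta>. indicator {cmod (\<zeta> - z)..} \<tau> \<partial>\<sigma>) = emeasure \<sigma> (circle_arc z \<tau>)" for \<tau>
    proof -
      have "(\<integral>\<^sup>+\<zeta>. indicator {cmod (\<zeta> - z)..} \<tau> \<partial>\<sigma>) = (\<integral>\<^sup>+\<zeta>. indicator (circle_arc z \<tau>) \<zeta> \<partial>\<sigma>)"
        by (intro nn_integral_cong) (auto simp: indicator_def dist_norm norm_minus_commute)
      then show ?thesis by simp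
    qed
    ultimately show ?thesis by simp
  qed
  have "(\<integral>\<^sup>+\<zeta>. ennreal (poisson r (cmod (\<zeta> - z))) \<partial>\<nu>) =
     ennreal c * emeasure \<nu> (circle_arc z 2) + (\<integral>\<^sup>+\<tau>. ennreal (w \<tau>) * indicator {0..2} \<tau> * emeasure \<nu> (circle_arc z \<tau>) \<partial>lborel)"
    by (rule nn_integral_poisson_layers[OF \<nu> sets\<nu> z w w0(2) eq])
  also have "\<dots> \<le> ennreal c * (ennreal \<kappa> * emeasure \<sigma> (circle_arc z 2)) +
      (\<integral>\<^sup>+\<tau>. ennreal \<kappa> * (ennreal (w \<tau>) * indicator {0..2} \<tau> * emeasure \<sigma> (circle_arc z \<tau>)) \<partial>lborel)"
  proof (intro add_mono mult_left_mono nn_integral_mono arcs')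
    fix \<tau> :: real
    show "ennreal (w \<tau>) * indicator {0..2} \<tau> * emeasure \<nu> (circle_arc z \<tau>)
      \<le> ennreal \<kappa> * (ennreal (w \<tau>) * indicator {0..2} \<tau> * emeasure \<sigma> (circle_arc z \<tau>))"
    proof (cases "0 < \<tau> \<and> \<tau> \<le> 2")
      case True
      then show ?thesis
        using mult_left_mono[OF arcs'[of \<tau>], of "ennreal (w \<tau>)"] by (simp add: mult_ac)
    next
      case False
      then show ?thesis
        by (cases "\<tau> = 0") (auto simp: w00 indicator_def)
    qed
  qed auto
  also have "\<dots> = ennreal \<kappa> * (ennreal c * emeasure \<sigma> (circle_arc z 2) + (\<integral>\<^sup>+\<tau>. ennreal (w \<tau>) * indicator {0..2} \<tau> * emeasure \<sigma> (circle_arc z \<tau>) \<partial>lborel))"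
    using meas by (subst nn_integral_cmult) (auto simp: distrib_left mult_ac)
  also have "\<dots> = ennreal \<kappa> * (\<integral>\<^sup>+\<zeta>. ennreal (poisson r (cmod (\<zeta> - z))) \<partial>\<sigma>)"
    using nn_integral_poisson_layers[OF finite_measure_circle_measure refl z w w0(2) eq] by simp
  finally show ?thesis .
qed

text \<open>
  With $c = \bar z \zeta$ both denominators are values of $|1 - rc|^2 = (1-r)^2 + r|\zeta - z|^2$.
\<close>

lemma poisson_geometric:
  assumes z: "cmod z = 1" and \<zeta>: "cmod \<zeta> = 1" and r: "0 \<le> r" "r < 1"
  shows "complex_of_real (poisson r (cmod (\<zeta> - z))) =
    1 / (1 - of_real r * z * cnj \<zeta>) + of_real r * cnj z * \<zeta> / (1 - of_real r * cnj z * \<zeta>)"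
proof -
  define c where "c = cnj z * \<zeta>"
  have cc: "cnj c = z * cnj \<zeta>" by (simp add: c_def)
  have c1: "cmod c = 1" using z \<zeta> by (simp add: c_def norm_mult)
  then have c2: "c * cnj c = 1" by (simp add: complex_norm_square[symmetric])
  have nz: "1 - of_real r * c \<noteq> 0" "1 - of_real r * cnj c \<noteq> 0"
  proof -
    have "cmod (of_real r * c) < 1" "cmod (of_real r * cnj c) < 1" using r c1 by (auto simp: norm_mult)
    then show "1 - of_real r * c \<noteq> 0" "1 - of_real r * cnj c \<noteq> 0" by auto
  qed
  have zz: "z * cnj z = 1" "\<zeta> * cnj \<zeta> = 1" using z \<zeta> by (simp_all add: complex_norm_square[symmetric])
  have "complex_of_real ((cmod (\<zeta> - z))\<^sup>2) = (\<zeta> - z) * cnj (\<zeta> - z)"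
    by (rule complex_norm_square)
  also have "\<dots> = 2 - c - cnj c"
    using zz by (simp add: c_def algebra_simps)
  finally have d: "complex_of_real ((cmod (\<zeta> - z))\<^sup>2) = 2 - c - cnj c" .
  have den: "complex_of_real ((1 - r)\<^sup>2 + r * (cmod (\<zeta> - z))\<^sup>2) = (1 - of_real r * c) * (1 - of_real r * cnj c)"
    unfolding of_real_add of_real_mult d using c2 by (simp add: power2_eq_square algebra_simps)
  have "1 / (1 - of_real r * cnj c) + of_real r * c / (1 - of_real r * c)
     = ((1 - of_real r * c) + of_real r * c * (1 - of_real r * cnj c)) / ((1 - of_real r * c) * (1 - of_real r * cnj c))"
    using nz by (simp add: field_simps)
  also have "(1 - of_real r * c) + of_real r * c * (1 - of_real r * cnj c) = complex_of_real (1 - r\<^sup>2)"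
  proof -
    have "(1 - of_real r * c) + of_real r * c * (1 - of_real r * cnj c) = 1 - of_real r * of_real r * (c * cnj c)"
      by (simp add: algebra_simps)
    then show ?thesis by (simp add: c2 power2_eq_square)
  qed
  also have "complex_of_real (1 - r\<^sup>2) / ((1 - of_real r * c) * (1 - of_real r * cnj c)) = complex_of_real (poisson r (cmod (\<zeta> - z)))"
    unfolding den[symmetric] poisson_def by simp
  finally show ?thesis by (simp add: cc c_def mult.assoc)
qed

text \<open>
  Expand the geometric series and integrate term by term. The cases \<open>s = 1\<close> and \<open>s = -1\<close> are the analytic and
  the conjugate analytic half of the Poisson kernel.
\<close>

lemma integral_powers_fourier:
  assumes "cmod w < 1"
  shows "(\<lambda>n. w ^ n * fourier_coeff f (s * int n)) sums
     (\<integral>\<zeta>. rep f \<zeta> * (1 / (1 - w * \<zeta> powi (- s))) \<partial>\<sigma>)"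
proof -
  define F where "F n \<zeta> = rep f \<zeta> * (w * \<zeta> powi (- s)) ^ n" for n \<zeta>
  have eqF: "F n \<zeta> = w ^ n * (rep f \<zeta> * \<zeta> powi (- (s * int n)))" for n \<zeta>
    using power_int_mult[of \<zeta> "- s" "int n"] by (simp add: F_def power_mult_distrib)
  have int: "integrable \<sigma> (\<lambda>\<zeta>. rep f \<zeta> * \<zeta> powi k)" for k
    by (rule Bochner_Integration.integrable_bound[OF integrable_rep(1)[of f]])
       (auto intro!: AE_I2 simp: norm_mult norm_power_int)
  have iF: "integrable \<sigma> (F n)" for n
    unfolding eqF using int by (intro integrable_mult_right)
  have nF: "cmod (F n \<zeta>) = cmod w ^ n * cmod (rep f \<zeta>)" if "cmod \<zeta> = 1" for n \<zeta>
    using that by (simp add: eqF norm_mult norm_power norm_power_int)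
  have geo: "summable (\<lambda>n. cmod w ^ n)" using assms by (intro summable_geometric) auto
  have "(\<lambda>n. \<integral>\<zeta>. F n \<zeta> \<partial>\<sigma>) sums (\<integral>\<zeta>. (\<Sum>n. F n \<zeta>) \<partial>\<sigma>)"
  proof (rule sums_integral[OF iF])
    show "AE \<zeta> in \<sigma>. summable (\<lambda>n. norm (F n \<zeta>))"
      by (intro AE_I2) (auto simp: nF intro!: summable_mult2 geo)
    have "(\<integral>\<zeta>. cmod (F n \<zeta>) \<partial>\<sigma>) = (\<integral>\<zeta>. cmod w ^ n * cmod (rep f \<zeta>) \<partial>\<sigma>)" for n
      by (intro Bochner_Integration.integral_cong refl) (simp add: nF)
    then show "summable (\<lambda>n. \<integral>\<zeta>. norm (F n \<zeta>) \<partial>\<sigma>)"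
      by simp (rule summable_mult2[OF geo])
  qed
  also have "(\<lambda>n. \<integral>\<zeta>. F n \<zeta> \<partial>\<sigma>) = (\<lambda>n. w ^ n * fourier_coeff f (s * int n))"
    unfolding eqF by (simp add: fourier_coeff_eq_integral[of f "rep f"])
  also have "(\<integral>\<zeta>. (\<Sum>n. F n \<zeta>) \<partial>\<sigma>) = (\<integral>\<zeta>. rep f \<zeta> * (1 / (1 - w * \<zeta> powi (- s))) \<partial>\<sigma>)"
  proof (rule circle_integral_cong)
    fix \<zeta> :: complex assume "cmod \<zeta> = 1"
    then have "cmod (w * \<zeta> powi (- s)) < 1" using assms by (simp add: norm_mult norm_power_int)
    then have "(\<lambda>n. F n \<zeta>) sums (rep f \<zeta> * (1 / (1 - w * \<zeta> powi (- s))))"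
      unfolding F_def by (intro sums_mult geometric_sums)
    then show "(\<Sum>n. F n \<zeta>) = rep f \<zeta> * (1 / (1 - w * \<zeta> powi (- s)))"
      by (simp add: sums_iff)
  qed
  finally show ?thesis .
qed

lemma integrable_rep_mult_bounded:
  assumes [measurable]: "\<phi> \<in> borel_measurable \<sigma>" and "\<And>\<zeta>. cmod \<zeta> = 1 \<Longrightarrow> cmod (\<phi> \<zeta>) \<le> K"
  shows "integrable \<sigma> (\<lambda>\<zeta>. rep f \<zeta> * \<phi> \<zeta>)"
proof (rule Bochner_Integration.integrable_bound)
  show "integrable \<sigma> (\<lambda>\<zeta>. K * cmod (rep f \<zeta>))"
    using integrable_rep(1)[of f] by auto
  show "AE \<zeta> in \<sigma>. norm (rep f \<zeta> * \<phi> \<zeta>) \<le> norm (K * cmod (rep f \<zeta>))"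
  proof (rule AE_I2)
    fix \<zeta> assume "\<zeta> \<in> space \<sigma>"
    then have "cmod (\<phi> \<zeta>) \<le> K" using assms(2) by simp
    moreover from this have "0 \<le> K" using norm_ge_zero[of "\<phi> \<zeta>"] by linarith
    ultimately show "norm (rep f \<zeta> * \<phi> \<zeta>) \<le> norm (K * cmod (rep f \<zeta>))"
      by (simp add: norm_mult mult.commute mult_right_mono)
  qed
qed measurable

text \<open>
  The analytic half of the Poisson kernel reproduces the extension. The other half sees only
  Fourier coefficients of negative index, which vanish, apart from the constant term counted twice.
\<close>

lemma disc_ext_poisson:
  assumes f: "f \<in> hardy2" and z: "cmod z = 1" and r: "0 \<le> r" "r < 1"
  shows "disc_ext f (of_real r * z) = (\<integral>\<zeta>. rep f \<zeta> * of_real (poisson r (cmod (\<zeta> - z))) \<partial>\<sigma>)"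
proof -
  define w where "w = of_real r * z"
  have w: "cmod w < 1" using z r by (simp add: w_def norm_mult)
  define k1 k2 where "k1 \<zeta> = 1 / (1 - w * \<zeta> powi (- 1))" and "k2 \<zeta> = 1 / (1 - cnj w * \<zeta> powi (- (-1)))" for \<zeta>
  have k12: "k1 \<in> borel_measurable \<sigma>" "k2 \<in> borel_measurable \<sigma>"
    unfolding k1_def k2_def by measurable
  have bound: "cmod (1 / (1 - v)) \<le> 1 / (1 - r)" if "cmod v = r" for v
  proof -
    have "1 - r \<le> cmod (1 - v)"
      using norm_triangle_ineq2[of 1 v] that by simp
    then show ?thesis using r by (simp add: norm_divide frac_le)
  qed
  have cw: "cmod w = r" using z r by (simp add: w_def norm_mult)
  have i1: "integrable \<sigma> (\<lambda>\<zeta>. rep f \<zeta> * k1 \<zeta>)"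
    by (rule integrable_rep_mult_bounded[where K = "1 / (1 - r)", OF k12(1)])
       (auto simp: k1_def norm_mult norm_inverse cw intro!: bound)
  have i2: "integrable \<sigma> (\<lambda>\<zeta>. rep f \<zeta> * k2 \<zeta>)"
    by (rule integrable_rep_mult_bounded[where K = "1 / (1 - r)", OF k12(2)])
       (auto simp: k2_def norm_mult cw intro!: bound)
  have 1: "(\<integral>\<zeta>. rep f \<zeta> * k1 \<zeta> \<partial>\<sigma>) = disc_ext f w"
    using integral_powers_fourier[OF w, where s = 1 and f = f] disc_ext_sums[OF w, of f]
    by (simp add: k1_def mult.commute[of "w ^ _"] sums_iff)
  have "(\<lambda>n. cnj w ^ n * fourier_coeff f (- 1 * int n)) sums (cnj w ^ 0 * fourier_coeff f (- 1 * int 0))"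
    using f sums_finite[of "{0}" "\<lambda>n. cnj w ^ n * fourier_coeff f (- 1 * int n)"] by (simp add: hardy2_def)
  moreover have "(\<lambda>n. cnj w ^ n * fourier_coeff f (- 1 * int n)) sums (\<integral>\<zeta>. rep f \<zeta> * k2 \<zeta> \<partial>\<sigma>)"
    unfolding k2_def by (rule integral_powers_fourier) (use w in auto)
  ultimately have 2: "(\<integral>\<zeta>. rep f \<zeta> * k2 \<zeta> \<partial>\<sigma>) = fourier_coeff f 0"
    using sums_unique2 by fastforce
  have 3: "(\<integral>\<zeta>. rep f \<zeta> \<partial>\<sigma>) = fourier_coeff f 0"
    using fourier_coeff_eq_integral[of f "rep f" 0] by simp
  have "(\<integral>\<zeta>. rep f \<zeta> * of_real (poisson r (cmod (\<zeta> - z))) \<partial>\<sigma>)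
      = (\<integral>\<zeta>. rep f \<zeta> * k1 \<zeta> + rep f \<zeta> * k2 \<zeta> - rep f \<zeta> \<partial>\<sigma>)"
  proof (rule circle_integral_cong)
    fix \<zeta> :: complex assume \<zeta>: "cmod \<zeta> = 1"
    have inv: "\<zeta> powi (- 1) = cnj \<zeta>" using cnj_powi_circle[OF \<zeta>, of 1] by simp
    have "1 - cnj w * \<zeta> \<noteq> 0"
    proof -
      have "cmod (cnj w * \<zeta>) < 1" using \<zeta> w by (simp add: norm_mult)
      then show ?thesis by auto
    qed
    then have "cnj w * \<zeta> / (1 - cnj w * \<zeta>) = k2 \<zeta> - 1"
      by (simp add: k2_def field_simps)
    then have P: "of_real (poisson r (cmod (\<zeta> - z))) = k1 \<zeta> + k2 \<zeta> - 1"
      using poisson_geometric[OF z \<zeta> r] inv by (simp add: k1_def w_def mult.assoc)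
    show "rep f \<zeta> * of_real (poisson r (cmod (\<zeta> - z))) = rep f \<zeta> * k1 \<zeta> + rep f \<zeta> * k2 \<zeta> - rep f \<zeta>"
      unfolding P by (simp add: algebra_simps)
  qed
  also have "\<dots> = disc_ext f w"
    using i1 i2 integrable_rep(1)[of f] by (simp add: 1 2 3)
  finally show ?thesis by (simp add: w_def)
qed

lemma poisson_le:
  assumes "0 \<le> r" "r < 1"
  shows "poisson r t \<le> (1 - r\<^sup>2) / (1 - r)\<^sup>2"
  unfolding poisson_def using assms poisson_denominator_pos[OF assms, of t]
  by (intro divide_left_mono) (auto intro!: mult_pos_pos power_le_one)

lemma integrable_poisson:
  assumes "0 \<le> r" "r < 1"
  shows "integrable \<sigma> (\<lambda>\<zeta>. poisson r (cmod (\<zeta> - z)))"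
proof (rule circle.integrable_const_bound[where B = "(1 - r\<^sup>2) / (1 - r)\<^sup>2"])
  show "AE \<zeta> in \<sigma>. norm (poisson r (cmod (\<zeta> - z))) \<le> (1 - r\<^sup>2) / (1 - r)\<^sup>2"
    using poisson_le[OF assms] poisson_nonneg[OF assms] by (intro AE_I2) simp
  show "(\<lambda>\<zeta>. poisson r (cmod (\<zeta> - z))) \<in> borel_measurable \<sigma>"
    using dist_circle_measurable[OF refl, of z] by measurable
qed

text \<open>
  Apply the Poisson formula to the constant function 1.
\<close>

lemma integral_poisson:
  assumes z: "cmod z = 1" and r: "0 \<le> r" "r < 1"
  shows "(\<integral>\<zeta>. poisson r (cmod (\<zeta> - z)) \<partial>\<sigma>) = 1"
proof -
  note [measurable] = dist_circle_measurable[OF refl, of z]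
  have "1 = disc_ext (monomial 0) (of_real r * z)"
    using disc_ext_monomial[of "of_real r * z" 0] z r by (simp add: norm_mult)
  also have "\<dots> = (\<integral>\<zeta>. rep (monomial 0) \<zeta> * of_real (poisson r (cmod (\<zeta> - z))) \<partial>\<sigma>)"
    by (rule disc_ext_poisson[OF _ z r]) (simp add: monomial_in_hardy2)
  also have "\<dots> = (\<integral>\<zeta>. complex_of_real (poisson r (cmod (\<zeta> - z))) \<partial>\<sigma>)"
    using rep_monomial[of 0] by (intro integral_cong_AE) (auto elim: eventually_mono)
  also have "\<dots> = of_real (\<integral>\<zeta>. poisson r (cmod (\<zeta> - z)) \<partial>\<sigma>)"
    by (rule integral_of_real) (rule integrable_poisson[OF r])
  finally show ?thesis by (metis of_real_eq_1_iff)
qed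

lemma cmod_disc_ext_le_poisson:
  assumes f: "f \<in> hardy2" and z: "cmod z = 1" and r: "0 \<le> r" "r < 1"
  shows "ennreal (cmod (disc_ext f (of_real r * z)))
    \<le> (\<integral>\<^sup>+\<zeta>. ennreal (cmod (rep f \<zeta>)) * ennreal (poisson r (cmod (\<zeta> - z))) \<partial>\<sigma>)"
proof -
  note [measurable] = dist_circle_measurable[OF refl, of z]
  have "integrable \<sigma> (\<lambda>\<zeta>. rep f \<zeta> * of_real (poisson r (cmod (\<zeta> - z))))"
    by (rule integrable_rep_mult_bounded[where K = "(1 - r\<^sup>2) / (1 - r)\<^sup>2"])
       (use poisson_le[OF r] poisson_nonneg[OF r] in auto)
  then have "ennreal (cmod (disc_ext f (of_real r * z)))
    \<le> (\<integral>\<^sup>+\<zeta>. ennreal (cmod (rep f \<zeta> * of_real (poisson r (cmod (\<zeta> - z))))) \<partial>\<sigma>)"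
    unfolding disc_ext_poisson[OF f z r] by (rule integral_norm_bound_ennreal)
  then show ?thesis
    using poisson_nonneg[OF r] by (simp add: norm_mult ennreal_mult')
qed

lemma cmod_disc_ext_le_essential_bound:
  assumes f: "f \<in> hardy2" and K: "AE \<zeta> in \<sigma>. cmod (rep f \<zeta>) \<le> K" "K \<ge> 0" and w: "cmod w < 1"
  shows "cmod (disc_ext f w) \<le> K"
proof -
  obtain r z where z: "cmod z = 1" and r: "0 \<le> r" "r < 1" and wrz: "w = of_real r * z"
  proof (cases "w = 0")
    case True
    then show ?thesis using that[of 1 0] by simp
  next
    case False
    then show ?thesis using that[of "w / of_real (cmod w)" "cmod w"] w by (simp add: norm_divide)
  qed
  note [measurable] = dist_circle_measurable[OF refl, of z]
  have "ennreal (cmod (disc_ext f w))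
    \<le> (\<integral>\<^sup>+\<zeta>. ennreal (cmod (rep f \<zeta>)) * ennreal (poisson r (cmod (\<zeta> - z))) \<partial>\<sigma>)"
    unfolding wrz by (rule cmod_disc_ext_le_poisson[OF f z r])
  also have "\<dots> \<le> (\<integral>\<^sup>+\<zeta>. ennreal K * ennreal (poisson r (cmod (\<zeta> - z))) \<partial>\<sigma>)"
    using K by (intro nn_integral_mono_AE) (auto elim!: eventually_mono intro!: mult_right_mono ennreal_leI)
  also have "\<dots> = ennreal K * (\<integral>\<^sup>+\<zeta>. ennreal (poisson r (cmod (\<zeta> - z))) \<partial>\<sigma>)"
    by (rule nn_integral_cmult) measurable
  also have "(\<integral>\<^sup>+\<zeta>. ennreal (poisson r (cmod (\<zeta> - z))) \<partial>\<sigma>) = 1"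
    using integral_poisson[OF z r] integrable_poisson[OF r, of z] poisson_nonneg[OF r] by (subst nn_integral_eq_integral) auto
  finally show ?thesis using K(2) by simp
qed

section \<open>Fatou's theorem\<close>

text \<open>
  Apply the weak type estimate to the measure with density $|f|$; on the remaining points the Poisson integral
  of $|f|$ is at most $\kappa$ times the integral of the kernel, which is 1.
\<close>

lemma radial_maximal_inequality:
  assumes f: "f \<in> hardy2" and \<kappa>: "\<kappa> > 0"
  obtains E where "E \<in> sets \<sigma>" "measure \<sigma> E \<le> 10 * pi / \<kappa> * norm f"
    "\<And>z r. cmod z = 1 \<Longrightarrow> z \<notin> E \<Longrightarrow> 0 \<le> r \<Longrightarrow> r < 1 \<Longrightarrow> cmod (disc_ext f (of_real r * z)) \<le> \<kappa>"
proof -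
  define \<nu> where "\<nu> = density \<sigma> (\<lambda>\<zeta>. ennreal (cmod (rep f \<zeta>)))"
  have sets\<nu>: "sets \<nu> = sets \<sigma>" by (simp add: \<nu>_def)
  have total: "emeasure \<nu> (sphere 0 1) = ennreal (\<integral>\<zeta>. cmod (rep f \<zeta>) \<partial>\<sigma>)"
  proof -
    have "emeasure \<nu> (space \<sigma>) = (\<integral>\<^sup>+\<zeta>. ennreal (cmod (rep f \<zeta>)) * indicator (space \<sigma>) \<zeta> \<partial>\<sigma>)"
      unfolding \<nu>_def by (rule emeasure_density) (auto simp del: space_circle_measure)
    also have "\<dots> = (\<integral>\<^sup>+\<zeta>. ennreal (cmod (rep f \<zeta>)) \<partial>\<sigma>)"
      by (intro nn_integral_cong) auto
    also have "\<dots> = ennreal (\<integral>\<zeta>. cmod (rep f \<zeta>) \<partial>\<sigma>)"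
      using integrable_rep(1)[of f] by (intro nn_integral_eq_integral) auto
    finally show ?thesis by simp
  qed
  have fin: "finite_measure \<nu>"
    by (rule finite_measureI) (use total in \<open>simp add: sets_eq_imp_space_eq[OF sets\<nu>]\<close>)
  have mtotal: "measure \<nu> (sphere 0 1) \<le> norm f"
    using integrable_rep(2)[of f] total by (simp add: Sigma_Algebra.measure_def)
  obtain E where E: "E \<in> sets \<sigma>" "measure \<sigma> E \<le> 10 * pi / \<kappa> * measure \<nu> (sphere 0 1)"
    "\<And>z \<rho>. cmod z = 1 \<Longrightarrow> z \<notin> E \<Longrightarrow> 0 < \<rho> \<Longrightarrow> \<rho> \<le> 2 \<Longrightarrow> measure \<nu> (circle_arc z \<rho>) \<le> \<kappa> * measure \<sigma> (circle_arc z \<rho>)"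
    using weak_type_maximal[OF fin sets\<nu> \<kappa>] by metis
  show thesis
  proof (rule that[OF E(1)])
    show "measure \<sigma> E \<le> 10 * pi / \<kappa> * norm f"
      by (rule order.trans[OF E(2)]) (intro mult_left_mono mtotal, use \<kappa> in auto)
    fix z r assume z: "cmod z = 1" "z \<notin> E" and r: "0 \<le> r" "r < (1::real)"
    note [measurable] = dist_circle_measurable[OF refl, of z]
    have "ennreal (cmod (disc_ext f (of_real r * z)))
      \<le> (\<integral>\<^sup>+\<zeta>. ennreal (cmod (rep f \<zeta>)) * ennreal (poisson r (cmod (\<zeta> - z))) \<partial>\<sigma>)"
      by (rule cmod_disc_ext_le_poisson[OF f z(1) r])
    also have "\<dots> = (\<integral>\<^sup>+\<zeta>. ennreal (poisson r (cmod (\<zeta> - z))) \<partial>\<nu>)"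
      unfolding \<nu>_def by (rule nn_integral_density[symmetric]) measurable
    also have "\<dots> \<le> ennreal \<kappa> * (\<integral>\<^sup>+\<zeta>. ennreal (poisson r (cmod (\<zeta> - z))) \<partial>\<sigma>)"
      by (rule poisson_domination[OF fin sets\<nu> r z(1) \<kappa> E(3)[OF z]])
    also have "(\<integral>\<^sup>+\<zeta>. ennreal (poisson r (cmod (\<zeta> - z))) \<partial>\<sigma>) = 1"
      using integral_poisson[OF z(1) r] integrable_poisson[OF r, of z] poisson_nonneg[OF r] by (subst nn_integral_eq_integral) auto
    finally show "cmod (disc_ext f (of_real r * z)) \<le> \<kappa>" using \<kappa> by simp
  qed
qed

lemma closed_csubspace_closure:
  assumes "0 \<in> T" "\<And>f g. f \<in> T \<Longrightarrow> g \<in> T \<Longrightarrow> f + g \<in> T" "\<And>c f. f \<in> T \<Longrightarrow> c *\<^sub>C f \<in> T"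
  shows "closed_csubspace (closure T)"
  unfolding closed_csubspace_def
proof (intro conjI ballI allI)
  show "0 \<in> closure T" using assms(1) closure_subset by blast
next
  fix f g assume "f \<in> closure T" "g \<in> closure T"
  then obtain x y where "\<And>n. x n \<in> T" "x \<longlonglongrightarrow> f" "\<And>n. y n \<in> T" "y \<longlonglongrightarrow> g"
    by (auto simp: closure_sequential)
  then show "f + g \<in> closure T"
    unfolding closure_sequential by (intro exI[of _ "\<lambda>n. x n + y n"]) (auto intro!: assms tendsto_intros)
next
  fix c f assume "f \<in> closure T"
  then obtain x where x: "\<And>n. x n \<in> T" "x \<longlonglongrightarrow> f"
    by (auto simp: closure_sequential)
  have "bounded_linear (\<lambda>f. c *\<^sub>C f)"
    by (rule bounded_linear_intro[where K = "cmod c"])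
       (auto simp: scaleC_add_right scaleR_conv_scaleC mult.commute)
  then have "(\<lambda>n. c *\<^sub>C x n) \<longlonglongrightarrow> c *\<^sub>C f"
    using x(2) by (rule bounded_linear.tendsto)
  then show "c *\<^sub>C f \<in> closure T"
    unfolding closure_sequential using x by (intro exI[of _ "\<lambda>n. c *\<^sub>C x n"]) (auto intro!: assms)
qed auto

lemma hardy2_dense:
  assumes "0 \<in> T" "\<And>f g. f \<in> T \<Longrightarrow> g \<in> T \<Longrightarrow> f + g \<in> T" "\<And>c f. f \<in> T \<Longrightarrow> c *\<^sub>C f \<in> T"
    and "\<And>n. n \<ge> 0 \<Longrightarrow> monomial n \<in> T" and "f \<in> hardy2" "e > 0"
  obtains p where "p \<in> T" "norm (f - p) < e"
proof -
  have "hardy2 \<subseteq> closure T"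
    using assms(4) closure_subset by (intro hardy2_subset_closed_csubspace closed_csubspace_closure assms) blast+
  then have "f \<in> closure T" using assms by blast
  then obtain p where "p \<in> T" "dist p f < e"
    using assms(6) by (auto simp: closure_approachable)
  then show thesis using that[of p] by (simp add: dist_norm norm_minus_commute)
qed

lemma AE_circle_if_small_exceptional_sets:
  assumes "\<And>e. e > 0 \<Longrightarrow> \<exists>E\<in>sets \<sigma>. measure \<sigma> E \<le> e \<and> (\<forall>z. cmod z = 1 \<longrightarrow> z \<notin> E \<longrightarrow> P z)"
  shows "AE z in \<sigma>. P z"
proof -
  have "\<forall>n. \<exists>E\<in>sets \<sigma>. measure \<sigma> E \<le> inverse (real (Suc n)) \<and> (\<forall>z. cmod z = 1 \<longrightarrow> z \<notin> E \<longrightarrow> P z)"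
    using assms by simp
  then obtain E where E: "\<And>n. E n \<in> sets \<sigma>" "\<And>n. measure \<sigma> (E n) \<le> inverse (real (Suc n))"
    "\<And>n z. cmod z = 1 \<Longrightarrow> z \<notin> E n \<Longrightarrow> P z"
    by metis
  have N: "(\<Inter>n. E n) \<in> sets \<sigma>" using E(1) by auto
  have "measure \<sigma> (\<Inter>n. E n) \<le> inverse (real (Suc n))" for n
    using order.trans[OF circle.finite_measure_mono[of "\<Inter>n. E n" "E n"] E(2)] E(1) by auto
  then have "measure \<sigma> (\<Inter>n. E n) \<le> 0"
    by (intro LIMSEQ_le_const[OF LIMSEQ_inverse_real_of_nat]) auto
  then have "measure \<sigma> (\<Inter>n. E n) = 0"
    using measure_nonneg[of \<sigma> "\<Inter>n. E n"] by linarith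
  then show ?thesis
    using E N by (intro AE_I[of _ _ "\<Inter>n. E n"]) (auto simp: circle.emeasure_eq_measure)
qed

text \<open>
  Approximate $f$ in $L^2$ by $p \in H^2$ whose extension is continuous up to the circle. Off a set of small measure
  the extension of $f - p$ is small along the entire radius, so the oscillation of $f$ along the radius is
  eventually small. As the error can be made arbitrarily small, the oscillation tends to zero almost everywhere.
\<close>

lemma AE_radial_limit_disc_ext:
  assumes f: "f \<in> hardy2"
  shows "AE z in \<sigma>. \<exists>l. has_radial_limit (disc_ext f) z l"
proof -
  \<comment> \<open>the oscillation of the extension near the end of the radius to \<open>z\<close> is at most \<open>e\<close>\<close>
  define osc where "osc e z \<longleftrightarrow> (\<exists>d<1. \<forall>r s. d < r \<and> r < 1 \<and> d < s \<and> s < (1::real) \<longrightarrow>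
     cmod (disc_ext f (of_real r * z) - disc_ext f (of_real s * z)) \<le> e)" for e z
  define T where "T = {p \<in> hardy2. \<exists>g. continuous_on UNIV g \<and> (\<forall>w. cmod w < 1 \<longrightarrow> disc_ext p w = g w)}"
  note H = closed_csubspaceD[OF hardy2_closed_csubspace]
  have TI: "p \<in> T" if "p \<in> hardy2" "continuous_on UNIV g" "\<And>w. cmod w < 1 \<Longrightarrow> disc_ext p w = g w" for p g
    using that by (auto simp: T_def)
  have T: "0 \<in> T" "\<And>f g. f \<in> T \<Longrightarrow> g \<in> T \<Longrightarrow> f + g \<in> T" "\<And>c f. f \<in> T \<Longrightarrow> c *\<^sub>C f \<in> T" "\<And>n. n \<ge> 0 \<Longrightarrow> monomial n \<in> T"
  proof -
    show "0 \<in> T" using H(2) by (rule TI[where g = "\<lambda>_. 0"]) (auto simp: disc_ext_def)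
    fix f g assume f: "f \<in> T" and g: "g \<in> T"
    obtain F where F: "continuous_on UNIV F" "\<And>w. cmod w < 1 \<Longrightarrow> disc_ext f w = F w"
      using f by (auto simp: T_def)
    obtain G where G: "continuous_on UNIV G" "\<And>w. cmod w < 1 \<Longrightarrow> disc_ext g w = G w"
      using g by (auto simp: T_def)
    have fg: "f \<in> hardy2" "g \<in> hardy2" using f g by (auto simp: T_def)
    show "f + g \<in> T"
      by (rule TI[where g = "\<lambda>w. F w + G w"]) (auto intro!: continuous_intros H F(1) G(1) fg simp: disc_ext_add F(2) G(2))
    show "c *\<^sub>C f \<in> T" for c
      by (rule TI[where g = "\<lambda>w. c * F w"]) (auto intro!: continuous_intros H F(1) fg simp: disc_ext_scaleC F(2))
  next
    fix n :: int assume "n \<ge> 0"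
    then show "monomial n \<in> T"
      using disc_ext_monomial[of _ "nat n"]
      by (intro TI[where g = "\<lambda>w. w ^ nat n"]) (auto intro!: continuous_intros monomial_in_hardy2)
  qed
  have small: "\<exists>E\<in>sets \<sigma>. measure \<sigma> E \<le> e \<and> (\<forall>z. cmod z = 1 \<longrightarrow> z \<notin> E \<longrightarrow> osc (3 * \<kappa>) z)"
    if \<kappa>: "\<kappa> > 0" and e: "e > 0" for \<kappa> e :: real
  proof -
    \<comment> \<open>an approximation this good makes the exceptional set have measure at most \<open>e\<close>\<close>
    have "e * \<kappa> / (10 * pi) > 0" using \<kappa> e by simp
    then obtain p where p: "p \<in> T" "norm (f - p) < e * \<kappa> / (10 * pi)"
      using hardy2_dense[OF T f] by metis
    have ph: "p \<in> hardy2" using p by (simp add: T_def)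
    obtain E where E: "E \<in> sets \<sigma>" "measure \<sigma> E \<le> 10 * pi / \<kappa> * norm (f - p)"
      "\<And>z r. cmod z = 1 \<Longrightarrow> z \<notin> E \<Longrightarrow> 0 \<le> r \<Longrightarrow> r < 1 \<Longrightarrow> cmod (disc_ext (f - p) (of_real r * z)) \<le> \<kappa>"
      using radial_maximal_inequality[OF H(5)[OF f ph] \<kappa>] by metis
    have "10 * pi / \<kappa> * norm (f - p) \<le> 10 * pi / \<kappa> * (e * \<kappa> / (10 * pi))"
      using p \<kappa> by (intro mult_left_mono) auto
    also have "\<dots> = e" using \<kappa> by simp
    finally have "measure \<sigma> E \<le> e" using E(2) by linarith
    moreover have "osc (3 * \<kappa>) z" if z: "cmod z = 1" "z \<notin> E" for z
    proof -
      obtain g where g: "continuous_on UNIV g" "\<And>w. cmod w < 1 \<Longrightarrow> disc_ext p w = g w"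
        using p by (auto simp: T_def)
      have "isCont (\<lambda>r. g (of_real r * z)) 1"
        using g(1) by (intro continuous_on_interior[where S = UNIV] continuous_on_compose2[OF g(1)] continuous_intros) auto
      then have "((\<lambda>r. g (of_real r * z)) \<longlongrightarrow> g z) (at_left 1)"
        unfolding isCont_def by (auto intro: filterlim_mono at_le)
      then have "eventually (\<lambda>r::real. dist (g (of_real r * z)) (g z) < \<kappa> / 2) (at_left 1)"
        by (rule tendstoD) (use \<kappa> in simp)
      then obtain b where b: "b < 1" "\<And>r. b < r \<Longrightarrow> r < 1 \<Longrightarrow> dist (g (of_real r * z)) (g z) < \<kappa> / 2"
        by (auto simp: eventually_at_left_field)
      have "cmod (disc_ext f (of_real r * z) - disc_ext f (of_real s * z)) \<le> 3 * \<kappa>"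
        if rs: "max b 0 < r" "r < 1" "max b 0 < s" "s < 1" for r s :: real
      proof -
        have d: "dist (disc_ext f (of_real t * z)) (disc_ext p (of_real t * z)) \<le> \<kappa>" if "max b 0 < t" "t < 1" for t :: real
          using E(3)[OF z, of t] that z by (simp add: dist_norm disc_ext_diff norm_mult)
        have "dist (disc_ext p (of_real r * z)) (disc_ext p (of_real s * z)) < \<kappa> / 2 + \<kappa> / 2"
          using rs z b(2)[of r] b(2)[of s] by (intro dist_triangle_less_add[of _ "g z"]) (auto simp: g(2) norm_mult)
        then have "dist (disc_ext f (of_real r * z)) (disc_ext f (of_real s * z)) \<le> \<kappa> + (\<kappa> + \<kappa>)"
          using d[OF rs(1,2)] d[OF rs(3,4)]
            dist_triangle[of "disc_ext f (of_real r * z)" "disc_ext f (of_real s * z)" "disc_ext p (of_real r * z)"]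
            dist_triangle[of "disc_ext p (of_real r * z)" "disc_ext f (of_real s * z)" "disc_ext p (of_real s * z)"]
            dist_commute[of "disc_ext p (of_real s * z)" "disc_ext f (of_real s * z)"] by linarith
        then show ?thesis by (simp add: dist_norm)
      qed
      then show ?thesis unfolding osc_def using b(1) by (intro exI[of _ "max b 0"]) auto
    qed
    ultimately show ?thesis using E(1) by blast
  qed
  have "AE z in \<sigma>. osc (3 * inverse (real (Suc k))) z" for k
    by (rule AE_circle_if_small_exceptional_sets, rule small) auto
  then have "AE z in \<sigma>. \<forall>k. osc (3 * inverse (real (Suc k))) z"
    by (simp add: AE_all_countable)
  then show ?thesis
  proof eventually_elim
    case (elim z)
    show ?case
    proof (rule tendsto_at_left_if_Cauchy)
      fix e :: real assume "e > 0"
      then obtain k where k: "inverse (real (Suc k)) < e / 3"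
        using reals_Archimedean[of "e / 3"] by auto
      from elim have "osc (3 * inverse (real (Suc k))) z" by blast
      then show "\<exists>d<1. \<forall>r s. d < r \<and> r < 1 \<and> d < s \<and> s < 1 \<longrightarrow>
          cmod (disc_ext f (of_real r * z) - disc_ext f (of_real s * z)) \<le> e"
        unfolding osc_def using k by (elim ex_forward conj_forward all_forward imp_forward) auto
    qed
  qed
qed

text \<open>
  Fatou's theorem gives the radial limits; they form an element of $H^2$ with the same extension as \<open>f\<close>, hence equal to \<open>f\<close>.
\<close>

lemma bounded_disc_ext:
  assumes f: "f \<in> hardy2" and K: "AE z in \<sigma>. cmod (rep f z) \<le> K"
  shows "radially_convergent (disc_ext f)" "boundary (disc_ext f) = f"
proof -
  have K': "AE z in \<sigma>. cmod (rep f z) \<le> max K 0"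
    using K by eventually_elim simp
  have "bounded (disc_ext f ` ball 0 1)"
    unfolding bounded_iff using cmod_disc_ext_le_essential_bound[OF f K'] by (intro exI[of _ "max K 0"]) auto
  then show rc: "radially_convergent (disc_ext f)"
    using AE_radial_limit_disc_ext[OF f] disc_ext_holomorphic[of f]
    by (simp add: radially_convergent_def hardy_inf_def)
  show "boundary (disc_ext f) = f"
    by (rule boundary_eqI[OF rc f]) simp
qed

section \<open>Inner functions and divisibility\<close>

lemma inner_function_radially_convergent: "inner_function u \<Longrightarrow> radially_convergent u"
  unfolding inner_function_def radially_convergent_def by (auto elim: eventually_mono)

lemma inner_function_holomorphic: "inner_function u \<Longrightarrow> u holomorphic_on ball 0 1"
  by (simp add: inner_function_def hardy_inf_def)

lemma inner_function_radial_limit: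
  assumes "inner_function u"
  shows "radial_limit u \<in> borel_measurable \<sigma>" "AE z in \<sigma>. cmod (radial_limit u z) = 1"
proof -
  show "radial_limit u \<in> borel_measurable \<sigma>"
    by (rule radial_limit_measurable[OF inner_function_holomorphic[OF assms]])
  have "AE z in \<sigma>. \<exists>l. has_radial_limit u z l \<and> cmod l = 1"
    using assms by (simp add: inner_function_def)
  then show "AE z in \<sigma>. cmod (radial_limit u z) = 1"
    by eventually_elim (metis radial_limit_eqI)
qed

lemmas bounded_multiplier_inner = bounded_multiplier_radial_limit[OF inner_function_radially_convergent]

lemma mult_inner:
  assumes "inner_function u"
  shows cinner_mult_inner: "cinner (mult_op (radial_limit u) f) (mult_op (radial_limit u) g) = cinner f g"
    and mult_cnj_inner_cancel: "mult_op (\<lambda>z. cnj (radial_limit u z)) (mult_op (radial_limit u) f) = f"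
    and mult_inner_cnj_cancel: "mult_op (radial_limit u) (mult_op (\<lambda>z. cnj (radial_limit u z)) f) = f"
  using cinner_mult_op_unimodular[OF inner_function_radial_limit[OF assms]] by blast+

lemma mult_radial_limit_monomial_0: "radially_convergent u \<Longrightarrow> mult_op (radial_limit u) (monomial 0) = boundary u"
  unfolding boundary_def by (rule mult_op_monomial_0[OF bounded_multiplier_radial_limit])

lemma mult_radial_limit_in_hardy2: "radially_convergent u \<Longrightarrow> h \<in> hardy2 \<Longrightarrow> mult_op (radial_limit u) h \<in> hardy2"
  using boundary_in_hardy2[of u] unfolding boundary_def
  by (intro mult_op_hardy2 bounded_multiplier_radial_limit)

lemma disc_ext_mult_radial_limit:
  "radially_convergent u \<Longrightarrow> h \<in> hardy2 \<Longrightarrow> cmod w < 1 \<Longrightarrow> disc_ext (mult_op (radial_limit u) h) w = u w * disc_ext h w"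
  using boundary_in_hardy2[of u] disc_ext_boundary[of u w] unfolding boundary_def
  by (simp add: disc_ext_mult_op bounded_multiplier_radial_limit)

lemma inner_function_disc_ext:
  assumes f: "f \<in> hardy2" and 1: "AE z in \<sigma>. cmod (rep f z) = 1"
  shows "inner_function (disc_ext f)" "boundary (disc_ext f) = f"
proof -
  have "AE z in \<sigma>. cmod (rep f z) \<le> 1"
    using 1 by eventually_elim simp
  note rc = bounded_disc_ext[OF f this]
  then show "boundary (disc_ext f) = f" by simp
  have "AE z in \<sigma>. \<exists>l. has_radial_limit (disc_ext f) z l \<and> cmod l = 1"
    using radial_limit_AE[OF rc(1)] rep_boundary[OF rc(1)] 1
    by eventually_elim (use rc(2) in auto)
  then show "inner_function (disc_ext f)"
    using rc(1) by (simp add: inner_function_def radially_convergent_def)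
qed

abbreviation inner_range :: "(complex \<Rightarrow> complex) \<Rightarrow> l2_circle set" where
  "inner_range u \<equiv> mult_op (radial_limit u) ` hardy2"

text \<open>
  A quotient that is bounded on the disc has radial limits because numerator and denominator have
  and the latter is unimodular. Conversely, a quotient in $H^2$ is unimodular on the circle, hence bounded on the disc.
\<close>

lemma inner_divides_iff:
  assumes w: "inner_function w" and u: "inner_function u"
  shows "inner_divides w u \<longleftrightarrow> boundary u \<in> inner_range w"
proof
  assume "inner_divides w u"
  then obtain h where h: "h \<in> hardy_inf" "\<And>z. z \<in> ball 0 1 \<Longrightarrow> u z = h z * w z"
    by (auto simp: inner_divides_def)
  note wc = inner_function_radially_convergent[OF w] and uc = inner_function_radially_convergent[OF u]
  have "AE z in \<sigma>. \<exists>l. has_radial_limit h z l"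
    using radial_limit_AE[OF uc] radial_limit_AE[OF wc] inner_function_radial_limit(2)[OF w] AE_space
  proof eventually_elim
    case (elim z)
    then have z: "cmod z = 1" by simp
    from elim(3) have "radial_limit w z \<noteq> 0" by auto
    have lim: "((\<lambda>r::real. u (of_real r * z) / w (of_real r * z)) \<longlongrightarrow> radial_limit u z / radial_limit w z) (at_left 1)"
      by (intro tendsto_divide elim) fact
    have "eventually (\<lambda>r::real. w (of_real r * z) \<noteq> 0) (at_left 1)"
      using tendsto_imp_eventually_ne[OF elim(2) \<open>radial_limit w z \<noteq> 0\<close>] .
    moreover have "eventually (\<lambda>r::real. r \<in> {0<..<1}) (at_left 1)"
      by (rule eventually_at_leftI[of 0]) auto
    ultimately have "eventually (\<lambda>r::real. u (of_real r * z) / w (of_real r * z) = h (of_real r * z)) (at_left 1)"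
      by eventually_elim (use z in \<open>auto simp: h norm_mult\<close>)
    with lim have "has_radial_limit h z (radial_limit u z / radial_limit w z)"
      by (rule Lim_transform_eventually)
    then show ?case by blast
  qed
  then have hc: "radially_convergent h" using h by (simp add: radially_convergent_def)
  have "boundary u = mult_op (radial_limit w) (boundary h)"
    using h(2) by (intro boundary_eqI uc mult_radial_limit_in_hardy2 wc boundary_in_hardy2 hc)
      (simp add: disc_ext_mult_radial_limit wc boundary_in_hardy2 hc disc_ext_boundary mult.commute)
  then show "boundary u \<in> inner_range w"
    using boundary_in_hardy2[OF hc] by blast
next
  assume "boundary u \<in> inner_range w"
  then obtain h where h: "h \<in> hardy2" "boundary u = mult_op (radial_limit w) h" by blast
  note wc = inner_function_radially_convergent[OF w] and uc = inner_function_radially_convergent[OF u]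
  have "AE z in \<sigma>. cmod (rep h z) = 1"
    using rep_boundary[OF uc] rep_mult_op[OF bounded_multiplier_inner[OF w], of h]
      inner_function_radial_limit(2)[OF w] inner_function_radial_limit(2)[OF u]
    by eventually_elim (use h(2) in \<open>metis mult_1 norm_mult\<close>)
  then have "disc_ext h \<in> hardy_inf"
    using inner_function_disc_ext(1)[OF h(1)] by (simp add: inner_function_def)
  moreover have "u z = disc_ext h z * w z" if "z \<in> ball 0 1" for z
    using disc_ext_boundary[OF uc, of z] disc_ext_mult_radial_limit[OF wc h(1), of z] that h(2)
    by (simp add: mult.commute)
  ultimately show "inner_divides w u" by (auto simp: inner_divides_def)
qed

lemma closed_csubspace_inner_range:
  assumes "inner_function u"
  shows "closed_csubspace (inner_range u)"
proof -
  have "inner_range u = {f. mult_op (\<lambda>z. cnj (radial_limit u z)) f \<in> hardy2}"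
  proof (intro equalityI subsetI)
    fix f assume "f \<in> {f. mult_op (\<lambda>z. cnj (radial_limit u z)) f \<in> hardy2}"
    then show "f \<in> inner_range u"
      using mult_inner_cnj_cancel[OF assms, of f] by (metis image_eqI mem_Collect_eq)
  qed (use mult_cnj_inner_cancel[OF assms] in auto)
  then show ?thesis
    using closed_csubspace_preimage_mult_op[OF bounded_multiplier_cnj[OF bounded_multiplier_inner[OF assms]] hardy2_closed_csubspace]
    by simp
qed

section \<open>Beurling's theorem\<close>

lemma AE_circle_nonzero: "AE z in \<sigma>. z \<noteq> 0"
  by (intro AE_I2) auto

lemma mult_op_powi_powi: "mult_op (\<lambda>z. z powi j) (mult_op (\<lambda>z. z powi k) f) = mult_op (\<lambda>z. z powi (j + k)) f"
proof -
  have "AE z in \<sigma>. z powi j * z powi k = z powi (j + k)"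
    using AE_circle_nonzero by eventually_elim (simp add: power_int_add)
  then show ?thesis
    using mult_op_cong[OF bounded_multiplier_mult[OF bounded_multiplier_powi bounded_multiplier_powi] bounded_multiplier_powi]
    by (simp add: mult_op_mult_op)
qed

lemma shift_mult_powi: "shift (mult_op (\<lambda>z. z powi k) f) = mult_op (\<lambda>z. z powi (k + 1)) f"
  using mult_op_powi_powi[of 1 k f] by (simp add: shift_def add.commute)

lemma funpow_shift: "(shift ^^ n) f = mult_op (\<lambda>z. z powi int n) f"
proof (induction n)
  case (Suc n)
  then show ?case
    unfolding funpow.simps comp_def Suc shift_mult_powi by (simp add: add.commute)
qed simp

lemma cinner_mult_powi: "cinner (mult_op (\<lambda>z. z powi k) f) g = cinner f (mult_op (\<lambda>z. z powi (- k)) g)"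
proof -
  have "mult_op (\<lambda>z. cnj (z powi k)) g = mult_op (\<lambda>z. z powi (- k)) g"
    by (rule mult_op_cong) (auto intro!: bounded_multiplier_cnj AE_I2 simp: cnj_powi_circle simp del: complex_cnj_power_int)
  then show ?thesis by (simp only: cinner_mult_op_left[OF bounded_multiplier_powi])
qed

text \<open>
  The inner product of $d$ with $z^k d$ is a Fourier coefficient of $|d|^2$, so $|d|^2$ has those of a constant.
\<close>

lemma AE_unimodular_if_orthogonal_to_shifts:
  assumes norm: "norm d = 1" and orth: "\<And>k. k > 0 \<Longrightarrow> cinner d (mult_op (\<lambda>z. z powi k) d) = 0"
  shows "AE z in \<sigma>. cmod (rep d z) = 1"
proof -
  define G where "G k = cinner d (mult_op (\<lambda>z. z powi k) d)" for k
  have G0: "G k = 0" if "k \<noteq> 0" for k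
  proof (cases "k > 0")
    case False
    have "G k = cnj (cinner (mult_op (\<lambda>z. z powi k) d) d)"
      unfolding G_def by (rule cinner_commute)
    also have "\<dots> = cnj (G (- k))"
      by (simp only: G_def cinner_mult_powi)
    finally show ?thesis using False that orth[of "- k"] by (simp add: G_def)
  qed (simp add: G_def orth)
  have G1: "G 0 = 1"
    using norm by (simp add: G_def cinner_self)
  have sq: "integrable \<sigma> (\<lambda>z. (cmod (rep d z))\<^sup>2)"
    using square_integrable_rep[of d] by (simp add: square_integrable_def)
  have int: "integrable \<sigma> (\<lambda>z. of_real ((cmod (rep d z))\<^sup>2) * z powi k)" for k
  proof (rule Bochner_Integration.integrable_bound[OF sq])
    show "AE z in \<sigma>. norm (of_real ((cmod (rep d z))\<^sup>2) * z powi k) \<le> norm ((cmod (rep d z))\<^sup>2)"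
      by (intro AE_I2) (auto simp: norm_mult norm_power norm_power_int)
  qed measurable
  have G: "(\<integral>z. of_real ((cmod (rep d z))\<^sup>2) * z powi k \<partial>\<sigma>) = G (- k)" for k
  proof -
    have "G (- k) = (\<integral>z. rep d z * cnj (z powi (- k) * rep d z) \<partial>\<sigma>)"
      unfolding G_def by (rule cinner_eq_integral[OF _ rep_mult_op]) auto
    also have "\<dots> = (\<integral>z. of_real ((cmod (rep d z))\<^sup>2) * z powi k \<partial>\<sigma>)"
    proof (rule circle_integral_cong)
      fix z :: complex assume "cmod z = 1"
      then have "cnj (z powi (- k)) = z powi k"
        using cnj_powi_circle[of z "- k"] by simp
      then show "rep d z * cnj (z powi (- k) * rep d z) = of_real ((cmod (rep d z))\<^sup>2) * z powi k"
        unfolding complex_cnj_mult complex_norm_square by (simp only: mult_ac)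
    qed
    finally show ?thesis by simp
  qed
  have "AE z in \<sigma>. (cmod (rep d z))\<^sup>2 - 1 = 0"
  proof (rule AE_eq_0_if_fourier_coeffs_0_real)
    show "integrable \<sigma> (\<lambda>z. (cmod (rep d z))\<^sup>2 - 1)"
      using sq by auto
    fix k :: int
    have "(\<integral>z. of_real ((cmod (rep d z))\<^sup>2 - 1) * z powi k \<partial>\<sigma>)
       = (\<integral>z. of_real ((cmod (rep d z))\<^sup>2) * z powi k - z powi k \<partial>\<sigma>)"
      by (intro Bochner_Integration.integral_cong) (auto simp: algebra_simps)
    also have "\<dots> = G (- k) - (if k = 0 then 1 else 0)"
      by (simp only: Bochner_Integration.integral_diff[OF int integrable_powi_circle] G integral_powi_circle)
    finally show "(\<integral>z. of_real ((cmod (rep d z))\<^sup>2 - 1) * z powi k \<partial>\<sigma>) = 0"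
      using G0[of "- k"] G1 by simp
  qed
  then show ?thesis
    by eventually_elim (simp add: power2_eq_1_iff, use norm_ge_zero in \<open>smt (verit)\<close>)
qed

text \<open>
  The subspace $zM$ is strictly smaller than $M$, since the smallest index of a nonzero Fourier coefficient
  increases. A unit vector $d \in M$ orthogonal to $zM$ is orthogonal to its own shifts, hence unimodular.
  Then $dH^2 \subseteq M$ by invariance; and for $f \in M$ the quotient $\bar d f$ has no Fourier coefficient of negative
  index, because $z^k f \in zM$ is orthogonal to $d$ for $k \ge 1$.
\<close>

theorem beurling:
  assumes M: "closed_csubspace M" "M \<subseteq> hardy2" "\<And>f. f \<in> M \<Longrightarrow> shift f \<in> M" and nz: "f0 \<in> M" "f0 \<noteq> 0"
  obtains d where "inner_function d" "M = inner_range d"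
proof -
  note M' = closed_csubspaceD[OF M(1)]
  have powM: "mult_op (\<lambda>z. z powi int k) f \<in> M" if "f \<in> M" for f k
    unfolding funpow_shift[symmetric] by (induction k) (use that M(3) in auto)
  \<comment> \<open>the subspace $zM$, written as a preimage so that closedness is immediate\<close>
  define N where "N = {f. mult_op (\<lambda>z. z powi (-1)) f \<in> M}"
  have N: "closed_csubspace N"
    unfolding N_def by (rule closed_csubspace_preimage_mult_op[OF bounded_multiplier_powi M(1)])
  have N_shift: "f \<in> N \<longleftrightarrow> (\<exists>g\<in>M. f = shift g)" for f
  proof
    assume "f \<in> N"
    moreover have "shift (mult_op (\<lambda>z. z powi (-1)) f) = f"
      unfolding shift_mult_powi by simp
    ultimately show "\<exists>g\<in>M. f = shift g" unfolding N_def by (metis mem_Collect_eq)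
  next
    assume "\<exists>g\<in>M. f = shift g"
    then obtain g where g: "g \<in> M" "f = shift g" by blast
    have "mult_op (\<lambda>z. z powi (-1)) (mult_op (\<lambda>z. z powi 1) g) = g"
      unfolding mult_op_powi_powi by simp
    then show "f \<in> N" using g unfolding N_def shift_eq by simp
  qed
  have fc_shift: "fourier_coeff (shift g) n = fourier_coeff g (n - 1)" for g n
    unfolding shift_eq by (rule fourier_coeff_mult_powi)
  define P where "P n \<longleftrightarrow> (\<exists>f\<in>M. fourier_coeff f (int n) \<noteq> 0)" for n
  have "\<exists>n. P n"
  proof (rule ccontr)
    assume "\<not> ?thesis"
    then have "fourier_coeff f0 n = 0" for n
      using nz M(2) by (cases "n \<ge> 0") (force simp: P_def hardy2_def elim: nonneg_int_cases)+
    then show False using eq_0_if_fourier_coeff_0 nz by blast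
  qed
  \<comment> \<open>the smallest index of a nonzero Fourier coefficient of an element of \<open>M\<close>\<close>
  define n where "n = (LEAST n. P n)"
  have "P n" unfolding n_def using \<open>\<exists>n. P n\<close> by (rule LeastI_ex)
  then obtain f1 where f1: "f1 \<in> M" "fourier_coeff f1 (int n) \<noteq> 0" by (auto simp: P_def)
  have Nn: "fourier_coeff f (int n) = 0" if f: "f \<in> N" for f
  proof -
    obtain g where g: "g \<in> M" "f = shift g" using f N_shift by blast
    show ?thesis
    proof (cases n)
      case 0
      then show ?thesis using g M(2) by (auto simp: fc_shift hardy2_def)
    next
      case (Suc m)
      then have "\<not> P m" using not_less_Least[of m P] by (simp add: n_def)
      then show ?thesis using g Suc by (auto simp: fc_shift P_def)
    qed
  qed
  define e where "e = f1 - orth_proj N f1"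
  have "fourier_coeff e (int n) \<noteq> 0"
    using f1 Nn[OF orth_proj(1)[OF N]] by (simp add: e_def fourier_coeff_diff)
  then have e0: "e \<noteq> 0" by auto
  have NM: "N \<subseteq> M" using N_shift M(3) by auto
  have eM: "e \<in> M"
    unfolding e_def using f1 NM orth_proj(1)[OF N] by (intro M'(5)) auto
  have eN: "cinner e h = 0" if "h \<in> N" for h
    unfolding e_def using orth_proj(2)[OF N that] by (simp add: cinner_diff_left)
  define d where "d = complex_of_real (1 / norm e) *\<^sub>C e"
  have dM: "d \<in> M" unfolding d_def by (rule M'(4)[OF eM])
  have dN: "cinner d h = 0" if "h \<in> N" for h
    unfolding d_def using eN[OF that] by (simp add: cinner_scaleC_left)
  have nd: "norm d = 1" using e0 by (simp add: d_def norm_divide)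
  have powN: "mult_op (\<lambda>z. z powi k) f \<in> N" if f: "f \<in> M" and k: "k > 0" for f k
  proof -
    define j where "j = nat (k - 1)"
    have j: "k = int j + 1" using k by (simp add: j_def)
    show ?thesis unfolding N_shift j using powM[OF f, of j] shift_mult_powi[of "int j" f] by metis
  qed
  have uni: "AE z in \<sigma>. cmod (rep d z) = 1"
    by (rule AE_unimodular_if_orthogonal_to_shifts[OF nd]) (intro dN powN dM)
  have dH: "d \<in> hardy2" using dM M(2) by auto
  note D = inner_function_disc_ext[OF dH uni]
  have bm: "bounded_multiplier (radial_limit (disc_ext d))" by (rule bounded_multiplier_inner[OF D(1)])
  have absd: "abs_l2_circle (radial_limit (disc_ext d)) = d" using D(2) by (simp add: boundary_def)
  have "M = inner_range (disc_ext d)"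
  proof (intro equalityI subsetI)
    fix f assume "f \<in> inner_range (disc_ext d)"
    then show "f \<in> M"
      using mult_op_hardy2_subset[OF bm M(1,3)] dM absd by auto
  next
    fix f assume f: "f \<in> M"
    define k where "k = mult_op (\<lambda>z. cnj (radial_limit (disc_ext d) z)) f"
    have "fourier_coeff k m = 0" if m: "m < 0" for m
    proof -
      have "fourier_coeff k m = cinner f (mult_op (radial_limit (disc_ext d)) (mult_op (\<lambda>z. z powi m) (monomial 0)))"
        unfolding k_def fourier_coeff_monomial_cinner mult_op_powi_monomial
        by (subst cinner_mult_op_left) (simp_all add: bounded_multiplier_cnj bm)
      also have "mult_op (radial_limit (disc_ext d)) (mult_op (\<lambda>z. z powi m) (monomial 0)) = mult_op (\<lambda>z. z powi m) d"
        by (subst mult_op_commute[OF bm bounded_multiplier_powi]) (simp only: mult_op_monomial_0[OF bm] absd)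
      also have "cinner f (mult_op (\<lambda>z. z powi m) d) = cinner (mult_op (\<lambda>z. z powi (- m)) f) d"
        by (simp only: cinner_mult_powi minus_minus)
      also have "\<dots> = cnj (cinner d (mult_op (\<lambda>z. z powi (- m)) f))"
        by (rule cinner_commute)
      also have "\<dots> = 0"
        using dN[OF powN[OF f, of "- m"]] m by simp
      finally show ?thesis .
    qed
    then have "k \<in> hardy2" by (simp add: hardy2_def)
    moreover have "f = mult_op (radial_limit (disc_ext d)) k"
      unfolding k_def using mult_inner_cnj_cancel[OF D(1)] by simp
    ultimately show "f \<in> inner_range (disc_ext d)" by blast
  qed
  then show thesis using that D(1) by blast
qed

section \<open>Greatest common divisors\<close>

lemma boundary_inner_nonzero:
  assumes "inner_function u" shows "boundary u \<noteq> 0"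
proof -
  have "norm (boundary u) = norm (mult_op (radial_limit u) (monomial 0))"
    by (simp add: mult_radial_limit_monomial_0 inner_function_radially_convergent assms)
  also have "\<dots> = 1"
    by (simp add: norm_mult_op_unimodular inner_function_radial_limit assms)
  finally show ?thesis by auto
qed

lemma mult_inner_range_shift:
  assumes "inner_function u" "f \<in> inner_range u"
  shows "shift f \<in> inner_range u"
proof -
  obtain h where h: "h \<in> hardy2" "f = mult_op (radial_limit u) h" using assms(2) by blast
  have "shift f = mult_op (radial_limit u) (shift h)"
    using mult_op_shift[OF bounded_multiplier_inner[OF assms(1)]] h(2) by simp
  then show ?thesis using shift_hardy2[OF h(1)] by blast
qed

text \<open>
  If $w$ divides $u$, then $u \in wH^2$, and $wH^2$ is closed and invariant under the shift.
\<close>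

lemma inner_range_subset:
  assumes w: "inner_function w" and u: "inner_function u" and div: "inner_divides w u"
  shows "inner_range u \<subseteq> inner_range w"
proof
  fix f assume "f \<in> inner_range u"
  then obtain h where h: "h \<in> hardy2" "f = mult_op (radial_limit u) h" by blast
  have "abs_l2_circle (radial_limit u) \<in> inner_range w"
    using div inner_divides_iff[OF w u] by (simp add: boundary_def)
  then show "f \<in> inner_range w"
    unfolding h(2) using mult_inner_range_shift[OF w]
    by (intro mult_op_hardy2_subset bounded_multiplier_inner u closed_csubspace_inner_range w h(1)) auto
qed

text \<open>
  Beurling's theorem applies to the closure $M$ of $uH^2 + vH^2$. The generator $d$ divides $u$ and $v$ as both lie in $M$;
  a common divisor $w$ has $M \subseteq wH^2$ and so divides $d$. Orthogonality to $uH^2$ and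
  $vH^2$ passes to sums and limits, hence to $dH^2$.
\<close>

lemma inner_gcd_exists:
  assumes u: "inner_function u" and v: "inner_function v"
  obtains d where "is_inner_gcd d u v"
    "\<And>g h. (\<And>h. h \<in> hardy2 \<Longrightarrow> cinner g (mult_op (radial_limit u) h) = 0) \<Longrightarrow>
          (\<And>h. h \<in> hardy2 \<Longrightarrow> cinner g (mult_op (radial_limit v) h) = 0) \<Longrightarrow>
          h \<in> hardy2 \<Longrightarrow> cinner g (mult_op (radial_limit d) h) = 0"
proof -
  let ?U = "inner_range u" and ?V = "inner_range v"
  define T where "T = {f + g |f g. f \<in> ?U \<and> g \<in> ?V}"
  define M where "M = closure T"
  note U = closed_csubspaceD[OF closed_csubspace_inner_range[OF u]]
  note V = closed_csubspaceD[OF closed_csubspace_inner_range[OF v]]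
  have TI: "f + g \<in> T" if "f \<in> ?U" "g \<in> ?V" for f g
    using that by (auto simp: T_def)
  have T0: "0 \<in> T" using TI[OF U(2) V(2)] by simp
  have Tadd: "f + g \<in> T" if "f \<in> T" "g \<in> T" for f g
  proof -
    obtain a b where ab: "f = a + b" "a \<in> ?U" "b \<in> ?V" using \<open>f \<in> T\<close> unfolding T_def by blast
    obtain a' b' where ab': "g = a' + b'" "a' \<in> ?U" "b' \<in> ?V" using \<open>g \<in> T\<close> unfolding T_def by blast
    have "f + g = (a + a') + (b + b')" by (simp add: ab ab' algebra_simps)
    then show ?thesis using TI[OF U(3)[OF ab(2) ab'(2)] V(3)[OF ab(3) ab'(3)]] by simp
  qed
  have Tscale: "c *\<^sub>C f \<in> T" if "f \<in> T" for c f
  proof -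
    obtain a b where ab: "f = a + b" "a \<in> ?U" "b \<in> ?V" using \<open>f \<in> T\<close> unfolding T_def by blast
    show ?thesis using TI[OF U(4)[OF ab(2)] V(4)[OF ab(3)]] by (simp add: ab scaleC_add_right)
  qed
  have Tshift: "shift f \<in> T" if "f \<in> T" for f
  proof -
    obtain a b where ab: "f = a + b" "a \<in> ?U" "b \<in> ?V" using \<open>f \<in> T\<close> unfolding T_def by blast
    show ?thesis
      using TI[OF mult_inner_range_shift[OF u ab(2)] mult_inner_range_shift[OF v ab(3)]]
      by (simp add: ab shift_def mult_op_add)
  qed
  have M: "closed_csubspace M"
    unfolding M_def by (rule closed_csubspace_closure[OF T0 Tadd Tscale])
  have TH: "T \<subseteq> hardy2"
    using closed_csubspaceD(3)[OF hardy2_closed_csubspace] mult_radial_limit_in_hardy2 u v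
    by (auto simp: T_def inner_function_radially_convergent)
  have MH: "M \<subseteq> hardy2"
    unfolding M_def using TH closed_csubspaceD(1)[OF hardy2_closed_csubspace] by (rule closure_minimal)
  have Mshift: "shift f \<in> M" if f: "f \<in> M" for f
  proof -
    obtain x where x: "\<And>n. x n \<in> T" "x \<longlonglongrightarrow> f"
      using f unfolding M_def closure_sequential by blast
    have "(\<lambda>n. shift (x n)) \<longlonglongrightarrow> shift f"
      unfolding shift_def by (rule bounded_linear.tendsto[OF bounded_linear_mult_op[OF bounded_multiplier_id] x(2)])
    then show ?thesis
      unfolding M_def closure_sequential using Tshift x(1) by (intro exI[of _ "\<lambda>n. shift (x n)"]) auto
  qed
  have UM: "?U \<subseteq> M" "?V \<subseteq> M"
    using TI[OF _ V(2)] TI[OF U(2)] closure_subset[of T] by (auto simp: M_def)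
  have bU: "boundary u \<in> ?U" and bV: "boundary v \<in> ?V"
    using u v mult_radial_limit_monomial_0 monomial_in_hardy2[of 0] inner_function_radially_convergent
    by (metis image_eqI order_refl)+
  obtain d where d: "inner_function d" "M = inner_range d"
    using beurling[OF M MH Mshift] bU UM boundary_inner_nonzero[OF u] by blast
  have "is_inner_gcd d u v"
    unfolding is_inner_gcd_def
  proof (intro conjI allI impI)
    show "inner_divides d u" "inner_divides d v"
      using inner_divides_iff[OF d(1) u] inner_divides_iff[OF d(1) v] UM bU bV d(2) by auto
    fix w assume w: "inner_function w \<and> inner_divides w u \<and> inner_divides w v"
    then have "f + g \<in> inner_range w" if "f \<in> ?U" "g \<in> ?V" for f g
      using inner_range_subset[of w u] inner_range_subset[of w v] u v that
      by (intro closed_csubspaceD(3)[OF closed_csubspace_inner_range]) blast+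
    then have "T \<subseteq> inner_range w"
      by (auto simp only: T_def)
    then have "M \<subseteq> inner_range w"
      unfolding M_def using closed_csubspaceD(1)[OF closed_csubspace_inner_range[of w]] w by (intro closure_minimal) auto
    moreover have "boundary d \<in> M"
      unfolding d(2) using d(1) mult_radial_limit_monomial_0 monomial_in_hardy2[of 0] inner_function_radially_convergent
      by (metis image_eqI order_refl)
    ultimately show "inner_divides w d"
      using inner_divides_iff[of w d] w d(1) by auto
  qed (rule d(1))
  moreover have "cinner g (mult_op (radial_limit d) h) = 0"
    if g: "\<And>h. h \<in> hardy2 \<Longrightarrow> cinner g (mult_op (radial_limit u) h) = 0"
      "\<And>h. h \<in> hardy2 \<Longrightarrow> cinner g (mult_op (radial_limit v) h) = 0" and h: "h \<in> hardy2" for g h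
  proof -
    have "closed {f. cinner g f = 0}"
      by (intro closed_Collect_eq bounded_linear.continuous_on[OF bounded_linear_cinner_right] continuous_intros)
    moreover have "T \<subseteq> {f. cinner g f = 0}"
      using g by (auto simp: T_def cinner_add_right)
    ultimately have "M \<subseteq> {f. cinner g f = 0}"
      unfolding M_def by (intro closure_minimal)
    then show ?thesis using h d(2) by auto
  qed
  ultimately show thesis using that by blast
qed

lemma inner_constant_range:
  assumes d: "inner_function d" "d constant_on ball 0 1" and h: "h \<in> hardy2"
  obtains c where "c \<noteq> 0" "mult_op (radial_limit d) h = c *\<^sub>C h"
proof -
  obtain c where c: "\<And>w. w \<in> ball 0 1 \<Longrightarrow> d w = c"
    using d(2) by (auto simp: constant_on_def)
  have rc: "radially_convergent d" by (rule inner_function_radially_convergent[OF d(1)])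
  have 0: "monomial 0 \<in> hardy2" by (simp add: monomial_in_hardy2)
  have "boundary d = c *\<^sub>C monomial 0"
    using c disc_ext_monomial[of _ 0] closed_csubspaceD(4)[OF hardy2_closed_csubspace 0]
    by (intro boundary_eqI rc) (auto simp: disc_ext_scaleC)
  moreover from this have "c \<noteq> 0" using boundary_inner_nonzero[OF d(1)] by auto
  moreover have "mult_op (radial_limit d) h = c *\<^sub>C h"
  proof (rule disc_ext_inject)
    show "mult_op (radial_limit d) h \<in> hardy2" "c *\<^sub>C h \<in> hardy2"
      using h rc closed_csubspaceD(4)[OF hardy2_closed_csubspace] by (auto intro: mult_radial_limit_in_hardy2)
    show "disc_ext (mult_op (radial_limit d) h) w = disc_ext (c *\<^sub>C h) w" if "cmod w < 1" for w
      using that c by (simp add: disc_ext_mult_radial_limit rc h disc_ext_scaleC)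
  qed
  ultimately show thesis using that by blast
qed

section \<open>The model operator\<close>

lemma closed_csubspace_model_space: "closed_csubspace (model_space u)"
proof -
  have "closed_csubspace {f. cinner f g = 0}" for g
    by (rule closed_csubspace_kernel[OF bounded_linear_cinner_left]) (simp add: cinner_scaleC_left)
  moreover have "model_space u = hardy2 \<inter> (\<Inter>g\<in>inner_range u. {f. cinner f g = 0})"
    by (auto simp: model_space_def)
  ultimately show ?thesis
    by (simp only: closed_csubspace_Int hardy2_closed_csubspace closed_csubspace_INT)
qed

lemma model_spaceD:
  assumes "f \<in> model_space u"
  shows "f \<in> hardy2" "h \<in> hardy2 \<Longrightarrow> cinner f (mult_op (radial_limit u) h) = 0"
    "h \<in> hardy2 \<Longrightarrow> cinner (mult_op (radial_limit u) h) f = 0"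
proof -
  show "f \<in> hardy2" using assms by (simp add: model_space_def)
  show *: "cinner f (mult_op (radial_limit u) h) = 0" if "h \<in> hardy2"
    using assms that by (auto simp: model_space_def)
  show "cinner (mult_op (radial_limit u) h) f = 0" if "h \<in> hardy2"
    using *[OF that] by (subst cinner_commute) simp
qed

text \<open>
  Multiplication by $z^{-1}$ after removal of the constant term, to stay inside $H^2$.
\<close>

definition backward_shift :: "l2_circle \<Rightarrow> l2_circle" where
  "backward_shift f = mult_op (\<lambda>z. z powi (-1)) (f - fourier_coeff f 0 *\<^sub>C monomial 0)"

lemma backward_shift_hardy2:
  assumes "f \<in> hardy2" shows "backward_shift f \<in> hardy2"
  unfolding hardy2_def
proof (intro CollectI allI impI)
  fix n :: int assume "n < 0"
  have "fourier_coeff (backward_shift f) n = fourier_coeff f (n + 1) - fourier_coeff f 0 * (if n + 1 = 0 then 1 else 0)"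
    unfolding backward_shift_def fourier_coeff_mult_powi
    by (simp add: fourier_coeff_diff fourier_coeff_scaleC fourier_coeff_monomial)
  then show "fourier_coeff (backward_shift f) n = 0"
    using assms \<open>n < 0\<close> by (cases "n = - 1") (auto simp: hardy2_def)
qed

lemma shift_backward_shift: "f = fourier_coeff f 0 *\<^sub>C monomial 0 + shift (backward_shift f)"
  unfolding backward_shift_def shift_mult_powi by simp

lemma fourier_coeff_shift_0: "f \<in> hardy2 \<Longrightarrow> fourier_coeff (shift f) 0 = 0"
  unfolding shift_eq fourier_coeff_mult_powi by (simp add: hardy2_def)

lemma cinner_monomial_0: "cinner (monomial 0) f = cnj (fourier_coeff f 0)"
  unfolding fourier_coeff_monomial_cinner by (rule cinner_commute)

lemma cinner_shift_backward_shift: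
  assumes "f \<in> hardy2"
  shows "cinner (shift f) g = cinner f (backward_shift g)"
proof -
  have "cinner f (backward_shift g) = cinner (shift f) (g - fourier_coeff g 0 *\<^sub>C monomial 0)"
    unfolding backward_shift_def shift_eq cinner_mult_powi by simp
  also have "\<dots> = cinner (shift f) g - cnj (fourier_coeff g 0) * fourier_coeff (shift f) 0"
    by (simp add: cinner_diff_right cinner_scaleC_right fourier_coeff_monomial_cinner)
  finally show ?thesis using assms by (simp add: fourier_coeff_shift_0)
qed

lemma cinner_backward_shift_left:
  "h \<in> hardy2 \<Longrightarrow> cinner (backward_shift g) h = cinner g (shift h)"
  using cinner_shift_backward_shift[of h g] by (subst (1 2) cinner_commute) simp

lemma cinner_shift_shift: "cinner (shift f) (shift g) = cinner f g"
  unfolding shift_def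
  by (rule cinner_mult_op_unimodular(1)) (auto intro!: AE_I2 simp: bounded_multiplier_measurable[OF bounded_multiplier_id])

lemma disc_ext_0: "disc_ext f 0 = fourier_coeff f 0"
  using powser_zero[of "\<lambda>n. fourier_coeff f (int n)"] by (simp add: disc_ext_def)

lemma fourier_coeff_mult_inner_0:
  assumes "inner_function u" "h \<in> hardy2"
  shows "fourier_coeff (mult_op (radial_limit u) h) 0 = u 0 * fourier_coeff h 0"
  using disc_ext_mult_radial_limit[OF inner_function_radially_convergent[OF assms(1)] assms(2), of 0]
  by (simp add: disc_ext_0)

text \<open>
  This is the reproducing kernel of $Q_u$ at the origin: pairing with $uh$ yields $\overline{u(0)h(0)}$ from both terms.
\<close>

lemma kernel_in_model_space:
  assumes u: "inner_function u"
  shows "monomial 0 - cnj (u 0) *\<^sub>C boundary u \<in> model_space u"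
proof -
  have rc: "radially_convergent u" by (rule inner_function_radially_convergent[OF u])
  have "cinner (monomial 0 - cnj (u 0) *\<^sub>C boundary u) (mult_op (radial_limit u) h) = 0" if "h \<in> hardy2" for h
  proof -
    have "cinner (boundary u) (mult_op (radial_limit u) h) = cnj (fourier_coeff h 0)"
      by (simp add: mult_radial_limit_monomial_0[OF rc, symmetric] cinner_mult_inner u cinner_monomial_0)
    then show ?thesis
      by (simp add: cinner_diff_left cinner_scaleC_left cinner_monomial_0 fourier_coeff_mult_inner_0 u that)
  qed
  then show ?thesis
    using closed_csubspaceD(4,5)[OF hardy2_closed_csubspace] boundary_in_hardy2[OF rc] monomial_in_hardy2[of 0]
    by (auto simp: model_space_def)
qed

text \<open>
  Explicitly $S_u f = zf - \langle zf, u\rangle u$. To see that the right-hand side is orthogonal to $ug$, split $g$ into $g(0)$ and a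
  multiple of $z$; the latter contributes zero as $f$ is orthogonal to $uH^2$.
\<close>

lemma model_operator:
  assumes u: "inner_function u" and f: "f \<in> model_space u"
  shows "model_operator u f \<in> model_space u"
    "shift f - model_operator u f \<in> inner_range u"
proof -
  have rc: "radially_convergent u" by (rule inner_function_radially_convergent[OF u])
  note H = closed_csubspaceD[OF hardy2_closed_csubspace]
  have m0: "monomial 0 \<in> hardy2" by (simp add: monomial_in_hardy2)
  define c where "c = cinner (shift f) (boundary u)"
  define S where "S = shift f - c *\<^sub>C boundary u"
  have SH: "S \<in> hardy2"
    unfolding S_def by (intro H shift_hardy2 model_spaceD(1)[OF f] boundary_in_hardy2[OF rc])
  have "cinner S (mult_op (radial_limit u) g) = 0" if g: "g \<in> hardy2" for g
  proof -
    define a where "a = fourier_coeff g 0"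
    have bg: "backward_shift g \<in> hardy2" by (rule backward_shift_hardy2[OF g])
    have "mult_op (radial_limit u) g = mult_op (radial_limit u) (a *\<^sub>C monomial 0 + shift (backward_shift g))"
      unfolding a_def by (subst shift_backward_shift[of g]) simp
    also have "\<dots> = a *\<^sub>C boundary u + shift (mult_op (radial_limit u) (backward_shift g))"
      using bounded_multiplier_inner[OF u]
      by (simp add: mult_op_add mult_op_scaleC mult_op_shift mult_radial_limit_monomial_0[OF rc])
    finally have "cinner (shift f) (mult_op (radial_limit u) g) = cnj a * c"
      using model_spaceD(2)[OF f bg] by (simp add: cinner_add_right cinner_scaleC_right cinner_shift_shift c_def)
    moreover have "cinner (boundary u) (mult_op (radial_limit u) g) = cnj a"
      by (simp add: mult_radial_limit_monomial_0[OF rc, symmetric] cinner_mult_inner u cinner_monomial_0 a_def)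
    ultimately show ?thesis
      by (simp add: S_def cinner_diff_left cinner_scaleC_left)
  qed
  with SH have SQ: "S \<in> model_space u" by (auto simp: model_space_def)
  have diff: "shift f - S = mult_op (radial_limit u) (c *\<^sub>C monomial 0)"
    by (simp add: S_def mult_op_scaleC bounded_multiplier_inner u mult_radial_limit_monomial_0[OF rc])
  have cm: "c *\<^sub>C monomial 0 \<in> hardy2" by (rule H(4)[OF m0])
  have eq: "model_operator u f = S"
    unfolding model_operator_def
    by (rule orth_proj_eqI[OF closed_csubspace_model_space SQ]) (simp add: diff model_spaceD(3) cm)
  show "model_operator u f \<in> model_space u" "shift f - model_operator u f \<in> inner_range u"
    unfolding eq diff using SQ cm by auto
qed

text \<open>
  The space $Q_u$ is invariant under the backward shift, the adjoint of multiplication by $z$ on $H^2$,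
  and $S_u f$ differs from $zf$ by an element of $uH^2$, which $g$ does not see.
\<close>

lemma adjoint_model_operator:
  assumes u: "inner_function u" and g: "g \<in> model_space u"
  shows "adjoint_on (model_space u) (model_operator u) g = backward_shift g"
proof (rule adjoint_on_eqI[OF closed_csubspace_model_space])
  have "cinner (backward_shift g) (mult_op (radial_limit u) h) = 0" if h: "h \<in> hardy2" for h
  proof -
    have "cinner (backward_shift g) (mult_op (radial_limit u) h) = cinner g (mult_op (radial_limit u) (shift h))"
      using cinner_backward_shift_left[OF mult_radial_limit_in_hardy2[OF inner_function_radially_convergent[OF u] h]]
      by (simp add: mult_op_shift bounded_multiplier_inner u)
    also have "\<dots> = 0" by (rule model_spaceD(2)[OF g shift_hardy2[OF h]])
    finally show ?thesis .
  qed
  then show "backward_shift g \<in> model_space u"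
    using backward_shift_hardy2[OF model_spaceD(1)[OF g]] by (auto simp: model_space_def)
  fix f assume f: "f \<in> model_space u"
  obtain h where h: "h \<in> hardy2" "shift f - model_operator u f = mult_op (radial_limit u) h"
    using model_operator(2)[OF u f] by blast
  have "cinner (shift f) g - cinner (model_operator u f) g = 0"
    using model_spaceD(3)[OF g h(1)] h(2) by (simp add: cinner_diff_left[symmetric])
  then show "cinner (model_operator u f) g = cinner f (backward_shift g)"
    using cinner_shift_backward_shift[OF model_spaceD(1)[OF f], of g] by simp
qed

lemma orth_proj_model_space_inner_range:
  "f \<in> inner_range u \<Longrightarrow> orth_proj (model_space u) f = 0"
  by (rule orth_proj_eqI[OF closed_csubspace_model_space closed_csubspaceD(2)[OF closed_csubspace_model_space]])
     (auto simp: model_spaceD(3))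

text \<open>
  The difference of $f$ and its projection is the projection to $uH^2$, a shift-invariant space that is
  orthogonal to $Q_u$.
\<close>

lemma orth_proj_model_space_shift:
  assumes u: "inner_function u" and f: "f \<in> hardy2"
  shows "orth_proj (model_space u) (shift f) = model_operator u (orth_proj (model_space u) f)"
proof -
  define q where "q = orth_proj (inner_range u) f"
  have q: "q \<in> inner_range u" "\<And>h. h \<in> inner_range u \<Longrightarrow> cinner (f - q) h = 0"
    using orth_proj(1)[OF closed_csubspace_inner_range[OF u], of f] orth_proj(2)[OF closed_csubspace_inner_range[OF u], of _ f] by (auto simp: q_def cinner_diff_left)
  have "q \<in> hardy2" using q(1) mult_radial_limit_in_hardy2[OF inner_function_radially_convergent[OF u]] by auto
  then have p: "f - q \<in> model_space u"
    using q(2) closed_csubspaceD(5)[OF hardy2_closed_csubspace f] by (auto simp: model_space_def)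
  note add = orth_proj_add[OF closed_csubspace_model_space[of u]]
  have "orth_proj (model_space u) (f - q) = f - q"
    by (rule orth_proj_eqI[OF closed_csubspace_model_space p]) simp
  then have "orth_proj (model_space u) f = f - q"
    using add[of "f - q" q] orth_proj_model_space_inner_range[OF q(1)] by simp
  moreover have "orth_proj (model_space u) (shift f) = orth_proj (model_space u) (shift (f - q))"
    using add[of "shift (f - q)" "shift q"] orth_proj_model_space_inner_range[OF mult_inner_range_shift[OF u q(1)]]
    by (simp add: shift_def mult_op_diff)
  ultimately show ?thesis by (simp add: model_operator_def)
qed

section \<open>Intertwining operators\<close>

subsection \<open>The reflected function\<close>

abbreviation reflect :: "(complex \<Rightarrow> complex) \<Rightarrow> complex \<Rightarrow> complex" where
  "reflect u \<equiv> (\<lambda>z. cnj (flip u z))"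

lemma AE_circle_cnj:
  assumes "AE z in \<sigma>. P z"
  shows "AE z in \<sigma>. P (cnj z)"
proof -
  have "cnj \<in> \<sigma> \<rightarrow>\<^sub>M \<sigma>"
    by (intro measurable_circle_self continuous_intros) auto
  moreover have "AE z in distr \<sigma> \<sigma> cnj. P z"
    unfolding distr_cnj_circle by fact
  ultimately show ?thesis by (rule AE_distrD)
qed

lemma reflect_tendsto:
  assumes "has_radial_limit u (cnj z) l"
  shows "has_radial_limit (reflect u) z (cnj l)"
  using tendsto_cnj[OF assms] by (simp add: flip_def)

lemma inner_function_reflect:
  assumes u: "inner_function u"
  shows "inner_function (reflect u)"
  unfolding inner_function_def
proof
  have hol: "u holomorphic_on cnj ` ball 0 1"
  proof -
    have "cnj ` ball 0 1 = ball 0 1"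
    proof (intro equalityI subsetI)
      fix x :: complex assume "x \<in> ball 0 1"
      then show "x \<in> cnj ` ball 0 1" by (intro image_eqI[of _ _ "cnj x"]) auto
    qed auto
    then show ?thesis using inner_function_holomorphic[OF u] by simp
  qed
  have "(cnj \<circ> u \<circ> cnj) holomorphic_on ball 0 1"
    by (rule holomorphic_on_compose_cnj_cnj[OF hol]) auto
  moreover obtain B where "\<And>w. w \<in> ball 0 1 \<Longrightarrow> cmod (u w) \<le> B"
    using hardy_inf_bound u unfolding inner_function_def by metis
  then have "bounded (reflect u ` ball 0 1)"
    unfolding bounded_iff by (intro exI[of _ B]) (auto simp: flip_def)
  ultimately show "reflect u \<in> hardy_inf"
    by (simp add: hardy_inf_def comp_def flip_def)
  have "AE z in \<sigma>. \<exists>l. has_radial_limit u z l \<and> cmod l = 1"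
    using u by (simp add: inner_function_def)
  from AE_circle_cnj[OF this]
  show "AE z in \<sigma>. \<exists>l. has_radial_limit (reflect u) z l \<and> cmod l = 1"
  proof eventually_elim
    case (elim z)
    then obtain l where l: "has_radial_limit u (cnj z) l" "cmod l = 1"
      by blast
    show ?case using reflect_tendsto[OF l(1)] l(2) by (intro exI[of _ "cnj l"]) simp
  qed
qed

lemma radial_limit_reflect:
  assumes u: "inner_function u"
  shows "AE z in \<sigma>. radial_limit (reflect u) z = cnj (radial_limit u (cnj z))"
  using AE_circle_cnj[OF radial_limit_AE[OF inner_function_radially_convergent[OF u]]]
  by eventually_elim (rule radial_limit_eqI, rule reflect_tendsto)

subsection \<open>Composition with conjugation on $L^2$\<close>

definition flip_op :: "l2_circle \<Rightarrow> l2_circle" where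
  "flip_op f = abs_l2_circle (flip (rep f))"

lemma measurable_cnj_circle [measurable]: "cnj \<in> \<sigma> \<rightarrow>\<^sub>M \<sigma>"
  by (intro measurable_circle_self continuous_intros) auto

lemma integral_flip:
  fixes F :: "complex \<Rightarrow> 'b :: {banach, second_countable_topology}"
  assumes "F \<in> borel_measurable \<sigma>"
  shows "(\<integral>z. F (cnj z) \<partial>\<sigma>) = (\<integral>z. F z \<partial>\<sigma>)"
proof -
  have "(\<integral>z. F (cnj z) \<partial>\<sigma>) = (\<integral>z. F z \<partial>distr \<sigma> \<sigma> cnj)"
    by (rule integral_distr[symmetric]) (use assms in measurable)
  then show ?thesis by (simp add: distr_cnj_circle)
qed

lemma square_integrable_flip:
  assumes "square_integrable f" shows "square_integrable (flip f)"
proof -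
  have [measurable]: "f \<in> borel_measurable \<sigma>" using assms by (simp add: square_integrable_def)
  have "integrable (distr \<sigma> \<sigma> cnj) (\<lambda>z. (cmod (f z))\<^sup>2)"
    using assms by (simp add: distr_cnj_circle square_integrable_def)
  then have "integrable \<sigma> (\<lambda>z. (cmod (f (cnj z)))\<^sup>2)"
    by (rule integrable_distr[OF measurable_cnj_circle])
  moreover have "flip f \<in> borel_measurable \<sigma>"
    unfolding flip_def by measurable
  ultimately show ?thesis by (simp add: square_integrable_def flip_def)
qed

lemma rep_flip_op: "AE z in \<sigma>. rep (flip_op f) z = rep f (cnj z)"
  using rep_abs_l2[OF square_integrable_flip[OF square_integrable_rep[of f]]]
  by (simp add: flip_op_def flip_def)

lemma flip_op_add: "flip_op (f + g) = flip_op f + flip_op g"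
  using rep_flip_op[of "f + g"] rep_flip_op[of f] rep_flip_op[of g] rep_add_l2[of "flip_op f" "flip_op g"]
    AE_circle_cnj[OF rep_add_l2[of f g]]
  by (intro l2_eqI, eventually_elim) simp

lemma flip_op_scaleC: "flip_op (c *\<^sub>C f) = c *\<^sub>C flip_op f"
  using rep_flip_op[of "c *\<^sub>C f"] rep_flip_op[of f] rep_scaleC_l2[of c "flip_op f"]
    AE_circle_cnj[OF rep_scaleC_l2[of c f]]
  by (intro l2_eqI, eventually_elim) simp

lemma norm_flip_op: "norm (flip_op f) = norm f"
proof -
  have "(norm (flip_op f))\<^sup>2 = (\<integral>z. (cmod (rep f (cnj z)))\<^sup>2 \<partial>\<sigma>)"
    unfolding norm_l2_sq using rep_flip_op[of f] by (intro integral_cong_AE) (auto elim: eventually_mono)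
  also have "\<dots> = (norm f)\<^sup>2"
    unfolding norm_l2_sq by (rule integral_flip) measurable
  finally show ?thesis by simp
qed

lemma bounded_linear_flip_op: "bounded_linear flip_op"
  by (rule bounded_linear_intro[where K = 1]) (auto simp: flip_op_add flip_op_scaleC scaleR_conv_scaleC norm_flip_op)

lemma flip_op_mult_op:
  assumes "bounded_multiplier \<phi>" "bounded_multiplier \<psi>" "AE z in \<sigma>. \<psi> z = \<phi> (cnj z)"
  shows "flip_op (mult_op \<phi> f) = mult_op \<psi> (flip_op f)"
  using rep_flip_op[of "mult_op \<phi> f"] AE_circle_cnj[OF rep_mult_op[OF assms(1), of f]]
    rep_mult_op[OF assms(2), of "flip_op f"] rep_flip_op[of f] assms(3)
  by (intro l2_eqI, eventually_elim) simp

lemma flip_op_mult_powi: "flip_op (mult_op (\<lambda>z. z powi k) f) = mult_op (\<lambda>z. z powi (- k)) (flip_op f)"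
proof (rule flip_op_mult_op)
  show "AE z in \<sigma>. z powi (- k) = cnj z powi k"
    by (intro AE_I2) (simp add: cnj_powi_circle flip: complex_cnj_power_int)
qed auto

lemma flip_op_monomial: "flip_op (monomial m) = monomial (- m)"
proof -
  have "AE z in \<sigma>. cnj z powi m = z powi (- m)"
    by (intro AE_I2) (simp add: cnj_powi_circle flip: complex_cnj_power_int)
  then show ?thesis
    using rep_flip_op[of "monomial m"] AE_circle_cnj[OF rep_monomial[of m]] rep_monomial[of "- m"]
    by (intro l2_eqI, eventually_elim) simp
qed

subsection \<open>The range of an intertwining operator\<close>

text \<open>
  Conjugation turns the inner product into a bilinear form, see the next lemma; it is needed because
  the Hankel identity is linear in the multiplier on both sides.
\<close>

definition conj_op :: "l2_circle \<Rightarrow> l2_circle" where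
  "conj_op f = abs_l2_circle (\<lambda>z. cnj (rep f z))"

lemma cinner_conj_op:
  assumes "AE z in \<sigma>. rep f z = F z" "AE z in \<sigma>. rep g z = G z"
    and [measurable]: "F \<in> borel_measurable \<sigma>" "G \<in> borel_measurable \<sigma>"
  shows "cinner f (conj_op g) = (\<integral>z. F z * G z \<partial>\<sigma>)"
proof -
  have "square_integrable (\<lambda>z. cnj (rep g z))"
    using square_integrable_rep[of g] by (simp add: square_integrable_def)
  from rep_abs_l2[OF this] have "AE z in \<sigma>. rep (conj_op g) z = cnj (G z)"
    unfolding conj_op_def using assms(2) by eventually_elim simp
  from cinner_eq_integral[OF assms(1) this] show ?thesis by simp
qed

text \<open>
  The identity $\langle \Gamma(qf), h\rangle = \langle \Gamma f, \tilde q h\rangle$ with $\tilde q(z) = \overline{q(\bar z)}$ holds for $q = z^m$ by the Hankel property. If $f$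
  and $h$ are monomials, multiplication by them is bounded on $L^2$, so both sides are continuous in $q \in H^2$ and the
  identity extends to $q = u$, where the left-hand side vanishes. Density of monomials then removes
  the restriction on $f$ and $h$.
\<close>

lemma hankel_range_orthogonal:
  assumes u: "inner_function u" and \<Gamma>: "bounded_linear \<Gamma>" and scale: "\<And>c f. \<Gamma> (c *\<^sub>C f) = c *\<^sub>C \<Gamma> f"
    and hankel: "\<And>f h. f \<in> hardy2 \<Longrightarrow> h \<in> hardy2 \<Longrightarrow> cinner (\<Gamma> (shift f)) h = cinner (\<Gamma> f) (shift h)"
    and kernel: "\<And>f. f \<in> inner_range u \<Longrightarrow> \<Gamma> f = 0"
    and f: "f \<in> hardy2" and h: "h \<in> hardy2"
  shows "cinner (\<Gamma> f) (mult_op (radial_limit (reflect u)) h) = 0"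
proof -
  let ?v = "radial_limit (reflect u)"
  note v = inner_function_reflect[OF u]
  have pow: "cinner (\<Gamma> (mult_op (\<lambda>z. z powi m) f)) h = cinner (\<Gamma> f) (mult_op (\<lambda>z. z powi m) h)"
    if "m \<ge> 0" and f: "f \<in> hardy2" and h: "h \<in> hardy2" for m f h
  proof -
    have "cinner (\<Gamma> ((shift ^^ n) f)) h = cinner (\<Gamma> f) ((shift ^^ n) h)" for n
      using h
    proof (induction n arbitrary: h)
      case (Suc n)
      have "(shift ^^ n) f \<in> hardy2"
        unfolding funpow_shift by (rule mult_powi_hardy2[OF f]) simp
      then show ?case
        using hankel[OF _ Suc.prems] Suc.IH[OF shift_hardy2[OF Suc.prems]] by (simp add: funpow_swap1[of shift n h])
    qed simp
    from this[of "nat m"] show ?thesis using that(1) by (simp add: funpow_shift)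
  qed
  have mono: "cinner (\<Gamma> (monomial a)) (mult_op ?v (monomial b)) = 0" if a: "a \<ge> 0" and b: "b \<ge> 0" for a b
  proof -
    define G where "G = mult_op (\<lambda>z. z powi (- b)) (\<Gamma> (monomial a))"
    \<comment> \<open>The difference of the two sides of the identity for $f = z^a$ and $h = z^b$;
      the right-hand side is the integral of $q(\bar z) G(z)$.\<close>
    define L where "L q = cinner (\<Gamma> (mult_op (\<lambda>z. z powi a) q)) (monomial b) - cinner (flip_op q) (conj_op G)" for q
    have "closed_csubspace {q. L q = 0}"
      unfolding L_def
      by (intro closed_csubspace_kernel bounded_linear_sub
            bounded_linear_compose[OF bounded_linear_cinner_left] bounded_linear_compose[OF \<Gamma>] bounded_linear_flip_op
            bounded_linear_mult_op bounded_multiplier_powi)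
         (simp add: mult_op_scaleC scale flip_op_scaleC cinner_scaleC_left)
    moreover have "L (monomial m) = 0" if m: "m \<ge> 0" for m
    proof -
      have "cinner (\<Gamma> (mult_op (\<lambda>z. z powi a) (monomial m))) (monomial b) = fourier_coeff (\<Gamma> (monomial a)) (m + b)"
        using pow[OF m monomial_in_hardy2[OF a] monomial_in_hardy2[OF b]]
        unfolding mult_op_powi_monomial fourier_coeff_monomial_cinner by (simp add: add.commute)
      also have "\<dots> = (\<integral>z. rep G z * z powi (- m) \<partial>\<sigma>)"
        using fourier_coeff_eq_integral[of G "rep G" m] unfolding G_def fourier_coeff_mult_powi by simp
      also have "\<dots> = cinner (flip_op (monomial m)) (conj_op G)"
        unfolding flip_op_monomial using cinner_conj_op[OF rep_monomial[of "- m"], of G "rep G"]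
        by (simp add: mult.commute)
      finally show ?thesis by (simp add: L_def)
    qed
    ultimately have "hardy2 \<subseteq> {q. L q = 0}"
      by (intro hardy2_subset_closed_csubspace) auto
    then have "L (boundary u) = 0"
      using boundary_in_hardy2[OF inner_function_radially_convergent[OF u]] by auto
    moreover have "mult_op (\<lambda>z. z powi a) (boundary u) = mult_op (radial_limit u) (monomial a)"
      unfolding mult_radial_limit_monomial_0[OF inner_function_radially_convergent[OF u], symmetric]
        mult_op_commute[OF bounded_multiplier_powi bounded_multiplier_inner[OF u]] mult_op_powi_monomial by simp
    ultimately have "cinner (flip_op (boundary u)) (conj_op G) = 0"
      using kernel[of "mult_op (radial_limit u) (monomial a)"] monomial_in_hardy2[OF a] by (simp add: L_def)
    moreover have "AE z in \<sigma>. rep (flip_op (boundary u)) z = cnj (?v z)"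
      using rep_flip_op[of "boundary u"] radial_limit_reflect[OF u]
        AE_circle_cnj[OF rep_boundary[OF inner_function_radially_convergent[OF u]]]
      by eventually_elim simp
    note cinner_conj_op[OF this, of G "rep G"]
    moreover have "cinner (\<Gamma> (monomial a)) (mult_op ?v (monomial b)) = cinner G (mult_op ?v (monomial 0))"
      unfolding G_def cinner_mult_powi mult_op_commute[OF bounded_multiplier_powi bounded_multiplier_inner[OF v]]
      by (simp add: mult_op_powi_monomial)
    moreover have "\<dots> = (\<integral>z. rep G z * cnj (?v z) \<partial>\<sigma>)"
      unfolding mult_radial_limit_monomial_0[OF inner_function_radially_convergent[OF v]]
      by (rule cinner_eq_integral[OF _ rep_boundary]) (auto intro: inner_function_radially_convergent inner_function_radial_limit v)
    ultimately show ?thesis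
      using inner_function_radial_limit(1)[OF v] by (simp add: mult.commute)
  qed
  have "hardy2 \<subseteq> {h. cinner (\<Gamma> (monomial a)) (mult_op ?v h) = 0}" if "a \<ge> 0" for a
    using mono[OF that] bounded_multiplier_inner[OF v]
    by (intro hardy2_subset_closed_csubspace closed_csubspace_kernel bounded_linear_compose[OF bounded_linear_cinner_right]
          bounded_linear_mult_op) (auto simp: mult_op_scaleC cinner_scaleC_right)
  with h have "hardy2 \<subseteq> {f. cinner (\<Gamma> f) (mult_op ?v h) = 0}"
    by (intro hardy2_subset_closed_csubspace closed_csubspace_kernel bounded_linear_compose[OF bounded_linear_cinner_left] \<Gamma>)
       (auto simp: scale cinner_scaleC_left)
  with f show ?thesis by auto
qed

text \<open>
  Extended by zero to $uH^2$, the operator $X$ is a Hankel operator on $H^2$.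
\<close>

lemma intertwining_range_orthogonal:
  assumes u: "inner_function u" and X: "X \<in> bounded_operators (model_space u)"
    and inter: "\<And>f. f \<in> model_space u \<Longrightarrow> adjoint_on (model_space u) (model_operator u) (X f) = X (model_operator u f)"
    and f: "f \<in> model_space u" and h: "h \<in> hardy2"
  shows "cinner (X f) (mult_op (radial_limit (reflect u)) h) = 0"
proof -
  let ?Q = "model_space u" and ?P = "orth_proj (model_space u)"
  note Q = closed_csubspace_model_space[of u] and P = orth_proj(1)[OF closed_csubspace_model_space[of u]]
  have XQ: "X f \<in> ?Q" if "f \<in> ?Q" for f using X that by (auto simp: bounded_operators_def)
  have Xadd: "X (f + g) = X f + X g" if "f \<in> ?Q" "g \<in> ?Q" for f g using X that by (auto simp: bounded_operators_def)
  have Xscale: "X (c *\<^sub>C f) = c *\<^sub>C X f" if "f \<in> ?Q" for c f using X that by (auto simp: bounded_operators_def)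
  obtain K where K: "\<And>f. f \<in> ?Q \<Longrightarrow> norm (X f) \<le> K * norm f" using X unfolding bounded_operators_def by blast
  have scale: "X (?P (c *\<^sub>C f)) = c *\<^sub>C X (?P f)" for c f
    by (simp add: orth_proj_scaleC[OF Q] Xscale P)
  have "cinner (X (?P f)) (mult_op (radial_limit (reflect u)) h) = 0"
  proof (rule hankel_range_orthogonal[OF u _ scale _ _ model_spaceD(1)[OF f] h])
    show "bounded_linear (\<lambda>f. X (?P f))"
    proof (rule bounded_linear_intro[where K = "\<bar>K\<bar>"])
      show "norm (X (?P f)) \<le> norm f * \<bar>K\<bar>" for f
      proof -
        have "norm (X (?P f)) \<le> \<bar>K\<bar> * norm (?P f)"
          using K[OF P[of f]] by (rule order.trans) (intro mult_right_mono, auto)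
        also have "\<dots> \<le> \<bar>K\<bar> * norm f" by (intro mult_left_mono norm_orth_proj_le[OF Q]) auto
        finally show ?thesis by (simp add: mult.commute)
      qed
    qed (auto simp: orth_proj_add[OF Q] Xadd P scale scaleR_conv_scaleC)
    fix f h assume f: "f \<in> hardy2" and h: "h \<in> hardy2"
    have "X (?P (shift f)) = backward_shift (X (?P f))"
      using inter[OF P[of f]] adjoint_model_operator[OF u XQ[OF P[of f]]] orth_proj_model_space_shift[OF u f] by simp
    then show "cinner (X (?P (shift f))) h = cinner (X (?P f)) (shift h)"
      by (simp add: cinner_backward_shift_left[OF h])
  next
    show "X (?P f) = 0" if "f \<in> inner_range u" for f
      using Xscale[OF closed_csubspaceD(2)[OF Q], of 0] by (simp add: orth_proj_model_space_inner_range[OF that])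
  qed
  moreover have "?P f = f" by (rule orth_proj_eqI[OF Q f]) simp
  ultimately show ?thesis by simp
qed

text \<open>
  A nonzero value of $X$ is orthogonal to $dH^2$, which would be all of $H^2$ if $d$ were constant.
\<close>

lemma nonconstant_gcd_if_intertwining:
  assumes u: "inner_function u" and X: "X \<in> bounded_operators (model_space u)"
    and inter: "\<And>f. f \<in> model_space u \<Longrightarrow> adjoint_on (model_space u) (model_operator u) (X f) = X (model_operator u f)"
    and f: "f \<in> model_space u" "X f \<noteq> 0"
  shows "\<exists>d. is_inner_gcd d u (reflect u) \<and> \<not> d constant_on ball 0 1"
proof -
  have XQ: "X f \<in> model_space u" using X f by (auto simp: bounded_operators_def)
  have XH: "X f \<in> hardy2" by (rule model_spaceD(1)[OF XQ])
  obtain d where d: "is_inner_gcd d u (reflect u)"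
    "\<And>g h. (\<And>h. h \<in> hardy2 \<Longrightarrow> cinner g (mult_op (radial_limit u) h) = 0) \<Longrightarrow>
          (\<And>h. h \<in> hardy2 \<Longrightarrow> cinner g (mult_op (radial_limit (reflect u)) h) = 0) \<Longrightarrow>
          h \<in> hardy2 \<Longrightarrow> cinner g (mult_op (radial_limit d) h) = 0"
    using inner_gcd_exists[OF u inner_function_reflect[OF u]] by metis
  have "\<not> d constant_on ball 0 1"
  proof
    assume "d constant_on ball 0 1"
    then obtain c where c: "c \<noteq> 0" "mult_op (radial_limit d) (X f) = c *\<^sub>C X f"
      using inner_constant_range[OF _ _ XH] d(1) unfolding is_inner_gcd_def by metis
    have "cinner (X f) (mult_op (radial_limit d) (X f)) = 0"
      by (rule d(2)[OF model_spaceD(2)[OF XQ] intertwining_range_orthogonal[OF u X inter f(1)] XH])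
    then show False using c f(2) by (simp add: cinner_scaleC_right cinner_self)
  qed
  with d(1) show ?thesis by blast
qed

subsection \<open>A Hankel operator that intertwines\<close>

text \<open>
  The operator is $X f = P_{H^2}(\psi(z) f(\bar z))$ with the kernel function $\psi = 1 - \overline{d(0)}\,d$. Everything
  rests on $\psi(z) f(\bar z)$ being orthogonal to $dH^2$ for $f \in H^2$: for $f = z^m$ this says that $\psi$ is
  orthogonal to $z^m dH^2$. If $d$ divides $u$, the values of $X$ are therefore orthogonal to $uH^2$; if $d$ divides
  $v$, replacing $f$ by $uf$ amounts to pairing with $vH^2$, so $X$ vanishes on $uH^2$.
\<close>

lemma intertwining_if_nonconstant_divisor:
  assumes u: "inner_function u" and d: "inner_function d"
    and div: "inner_divides d u" "inner_divides d (reflect u)" and nc: "\<not> d constant_on ball 0 1"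
  shows "\<exists>X \<in> bounded_operators (model_space u).
            (\<exists>f \<in> model_space u. X f \<noteq> 0) \<and>
            (\<forall>f \<in> model_space u.
               adjoint_on (model_space u) (model_operator u) (X f) = X (model_operator u f))"
proof -
  define v where "v = reflect u"
  have v: "inner_function v" unfolding v_def by (rule inner_function_reflect[OF u])
  have rcu: "radially_convergent u" and rcd: "radially_convergent d"
    using u d by (auto intro: inner_function_radially_convergent)
  let ?u = "radial_limit u" and ?d = "radial_limit d" and ?v = "radial_limit v"
  note bu = bounded_multiplier_inner[OF u] and bd = bounded_multiplier_inner[OF d] and bv = bounded_multiplier_inner[OF v]
  \<comment> \<open>the reproducing kernel of $Q_d$ at the origin\<close>
  define \<psi> where "\<psi> z = 1 - cnj (d 0) * ?d z" for z
  have b\<psi>: "bounded_multiplier \<psi>"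
  proof (rule bounded_multiplierI[where K = "1 + cmod (d 0)"])
    show "\<psi> \<in> borel_measurable \<sigma>"
      unfolding \<psi>_def using bounded_multiplier_measurable[OF bd] by measurable
    show "AE z in \<sigma>. cmod (\<psi> z) \<le> 1 + cmod (d 0)"
      using inner_function_radial_limit(2)[OF d]
    proof eventually_elim
      case (elim z)
      then show ?case
        using norm_triangle_ineq4[of 1 "cnj (d 0) * ?d z"] by (simp add: \<psi>_def norm_mult)
    qed
  qed
  have \<psi>0: "mult_op \<psi> (monomial 0) = monomial 0 - cnj (d 0) *\<^sub>C boundary d"
    using rep_mult_op[OF b\<psi>, of "monomial 0"] rep_monomial[of 0] rep_boundary[OF rcd]
      rep_scaleC_l2[of "cnj (d 0)" "boundary d"] rep_diff_l2[of "monomial 0" "cnj (d 0) *\<^sub>C boundary d"]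
    by (intro l2_eqI, eventually_elim) (simp add: \<psi>_def)
  have \<psi>Q: "mult_op \<psi> (monomial 0) \<in> model_space d"
    unfolding \<psi>0 by (rule kernel_in_model_space[OF d])
  have \<psi>_orth: "cinner (mult_op \<psi> (flip_op f)) (mult_op ?d k) = 0" if f: "f \<in> hardy2" and k: "k \<in> hardy2" for f k
  proof -
    define S where "S = {f. cinner (mult_op \<psi> (flip_op f)) (mult_op ?d k) = 0}"
    have S: "closed_csubspace S"
      unfolding S_def
      by (intro closed_csubspace_kernel bounded_linear_compose[OF bounded_linear_cinner_left]
            bounded_linear_compose[OF bounded_linear_mult_op[OF b\<psi>]] bounded_linear_flip_op)
         (simp add: flip_op_scaleC mult_op_scaleC b\<psi> cinner_scaleC_left)
    have "monomial m \<in> S" if m: "m \<ge> 0" for m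
    proof -
      have "flip_op (monomial m) = mult_op (\<lambda>z. z powi (- m)) (monomial 0)"
        by (simp add: flip_op_monomial mult_op_powi_monomial)
      then have "cinner (mult_op \<psi> (flip_op (monomial m))) (mult_op ?d k)
         = cinner (mult_op (\<lambda>z. z powi (- m)) (mult_op \<psi> (monomial 0))) (mult_op ?d k)"
        by (simp only: mult_op_commute[OF b\<psi> bounded_multiplier_powi])
      also have "\<dots> = cinner (mult_op \<psi> (monomial 0)) (mult_op ?d (mult_op (\<lambda>z. z powi m) k))"
        by (simp only: cinner_mult_powi minus_minus mult_op_commute[OF bd bounded_multiplier_powi])
      also have "\<dots> = 0"
        by (rule model_spaceD(2)[OF \<psi>Q mult_powi_hardy2[OF k m]])
      finally show ?thesis by (simp add: S_def)
    qed
    then have "hardy2 \<subseteq> S" by (rule hardy2_subset_closed_csubspace[OF S])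
    then show ?thesis using f by (auto simp: S_def)
  qed
  have \<psi>_orth': "cinner (mult_op \<psi> (flip_op f)) (mult_op (radial_limit w) k) = 0"
    if w: "inner_function w" "inner_divides d w" and f: "f \<in> hardy2" and k: "k \<in> hardy2" for w f k
  proof -
    have "mult_op (radial_limit w) k \<in> mult_op ?d ` hardy2"
      using inner_range_subset[OF d w] k by auto
    then show ?thesis using \<psi>_orth[OF f] by auto
  qed
  define X where "X f = orth_proj hardy2 (mult_op \<psi> (flip_op f))" for f
  have XH: "X f \<in> hardy2" for f unfolding X_def by (rule orth_proj(1)[OF hardy2_closed_csubspace])
  have X: "cinner (X f) k = cinner (mult_op \<psi> (flip_op f)) k" if "k \<in> hardy2" for f k
    unfolding X_def by (rule orth_proj(2)[OF hardy2_closed_csubspace that])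
  have Xadd: "X (f + g) = X f + X g" for f g
    by (simp add: X_def flip_op_add mult_op_add b\<psi> orth_proj_add hardy2_closed_csubspace)
  have Xscale: "X (c *\<^sub>C f) = c *\<^sub>C X f" for c f
    by (simp add: X_def flip_op_scaleC mult_op_scaleC b\<psi> orth_proj_scaleC hardy2_closed_csubspace)
  have XQ: "X f \<in> model_space u" if f: "f \<in> hardy2" for f
    using XH[of f] X[OF mult_radial_limit_in_hardy2[OF rcu]] \<psi>_orth'[OF u div(1) f]
    by (auto simp: model_space_def)
  have XU: "X (mult_op ?u g) = 0" if g: "g \<in> hardy2" for g
  proof (rule eq_if_cinner_eq[OF hardy2_closed_csubspace XH])
    show "0 \<in> hardy2" by (rule closed_csubspaceD(2)[OF hardy2_closed_csubspace])
    fix k assume k: "k \<in> hardy2"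
    have flip: "flip_op (mult_op ?u g) = mult_op (\<lambda>z. cnj (?v z)) (flip_op g)"
    proof (rule flip_op_mult_op[OF bu bounded_multiplier_cnj[OF bv]])
      show "AE z in \<sigma>. cnj (?v z) = ?u (cnj z)"
        using radial_limit_reflect[OF u] unfolding v_def by eventually_elim simp
    qed
    have "cinner (X (mult_op ?u g)) k = cinner (mult_op (\<lambda>z. cnj (?v z)) (mult_op \<psi> (flip_op g))) k"
      unfolding X[OF k] flip by (simp only: mult_op_commute[OF b\<psi> bounded_multiplier_cnj[OF bv]])
    also have "\<dots> = cinner (mult_op \<psi> (flip_op g)) (mult_op ?v k)"
      by (simp add: cinner_mult_op_left bounded_multiplier_cnj bv)
    also have "\<dots> = 0"
      using \<psi>_orth'[OF v _ g k] div(2) by (simp add: v_def)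
    finally show "cinner (X (mult_op ?u g)) k = cinner 0 k" by simp
  qed
  have Xshift: "X (shift f) = backward_shift (X f)" for f
  proof (rule eq_if_cinner_eq[OF hardy2_closed_csubspace XH backward_shift_hardy2[OF XH]])
    fix k assume k: "k \<in> hardy2"
    have "cinner (X (shift f)) k = cinner (mult_op \<psi> (mult_op (\<lambda>z. z powi (- 1)) (flip_op f))) k"
      unfolding X[OF k] shift_eq flip_op_mult_powi ..
    also have "\<dots> = cinner (mult_op (\<lambda>z. z powi (- 1)) (mult_op \<psi> (flip_op f))) k"
      by (simp only: mult_op_commute[OF b\<psi> bounded_multiplier_powi])
    also have "\<dots> = cinner (mult_op \<psi> (flip_op f)) (shift k)"
      unfolding cinner_mult_powi shift_eq minus_minus ..
    also have "\<dots> = cinner (backward_shift (X f)) k"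
      by (simp add: cinner_backward_shift_left k X shift_hardy2)
    finally show "cinner (X (shift f)) k = cinner (backward_shift (X f)) k" .
  qed
  have bounded: "X \<in> bounded_operators (model_space u)"
  proof -
    have 1: "X f \<in> model_space u" if "f \<in> model_space u" for f
      by (rule XQ[OF model_spaceD(1)[OF that]])
    obtain K where K: "\<And>f. norm (mult_op \<psi> f) \<le> norm f * K"
      using bounded_linear.bounded[OF bounded_linear_mult_op[OF b\<psi>]] by blast
    have "norm (X f) \<le> K * norm f" for f
      using norm_orth_proj_le[OF hardy2_closed_csubspace, of "mult_op \<psi> (flip_op f)"] K[of "flip_op f"]
      by (simp add: X_def norm_flip_op mult.commute)
    then show ?thesis unfolding bounded_operators_def using 1 Xadd Xscale by auto
  qed
  have inter: "adjoint_on (model_space u) (model_operator u) (X f) = X (model_operator u f)" if f: "f \<in> model_space u" for f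
  proof -
    obtain g where g: "g \<in> hardy2" "shift f - model_operator u f = mult_op ?u g"
      using model_operator(2)[OF u f] by blast
    have "X (shift f) = X (model_operator u f + mult_op ?u g)"
      by (simp flip: g(2))
    also have "\<dots> = X (model_operator u f)" by (simp add: Xadd XU g(1))
    finally show ?thesis
      using adjoint_model_operator[OF u XQ[OF model_spaceD(1)[OF f]]] Xshift[of f] by simp
  qed
  \<comment> \<open>$X$ does not see the multiple of $u$, so the image is that of the constant 1, which is $\psi$\<close>
  define f1 where "f1 = monomial 0 - cnj (u 0) *\<^sub>C boundary u"
  have f1: "f1 \<in> model_space u" unfolding f1_def by (rule kernel_in_model_space[OF u])
  have "X f1 \<noteq> 0"
  proof
    assume X0: "X f1 = 0"
    have "monomial 0 = f1 + cnj (u 0) *\<^sub>C mult_op ?u (monomial 0)"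
      by (simp add: f1_def mult_radial_limit_monomial_0[OF rcu])
    then have "X (monomial 0) = X f1 + cnj (u 0) *\<^sub>C X (mult_op ?u (monomial 0))"
      using Xadd Xscale by metis
    then have "X (monomial 0) = 0"
      using X0 XU[of "monomial 0"] scaleC_add_right[of "cnj (u 0)" 0 0] by (simp add: monomial_in_hardy2)
    moreover have "X (monomial 0) = mult_op \<psi> (monomial 0)"
      unfolding X_def flip_op_monomial minus_zero
      by (rule orth_proj_eqI[OF hardy2_closed_csubspace model_spaceD(1)[OF \<psi>Q]]) simp
    ultimately have eq: "monomial 0 = cnj (d 0) *\<^sub>C boundary d"
      using \<psi>0 by simp
    have "d w = 1 / cnj (d 0)" if w: "w \<in> ball 0 1" for w
    proof -
      have "1 = disc_ext (monomial 0) w" using disc_ext_monomial[of w 0] w by simp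
      also have "\<dots> = cnj (d 0) * d w"
        unfolding eq using w by (simp add: disc_ext_scaleC disc_ext_boundary rcd)
      finally have 1: "cnj (d 0) * d w = 1" by (rule sym)
      then have "cnj (d 0) \<noteq> 0" by (intro notI) simp
      with 1 show ?thesis by (simp add: nonzero_eq_divide_eq mult.commute)
    qed
    then show False using nc unfolding constant_on_def by blast
  qed
  then show ?thesis using bounded f1 inter by blast
qed

theorem theorem1p4:
  fixes u :: "complex \<Rightarrow> complex"
  assumes "inner_function u"
    and "\<not> u constant_on ball 0 1"
  shows "(\<exists>X \<in> bounded_operators (model_space u).
            (\<exists>f \<in> model_space u. X f \<noteq> 0) \<and>
            (\<forall>f \<in> model_space u.
               adjoint_on (model_space u) (model_operator u) (X f) = X (model_operator u f)))
         \<longleftrightarrow>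
         (\<exists>d. is_inner_gcd d u (\<lambda>z. cnj (flip u z)) \<and> \<not> d constant_on ball 0 1)"
proof
  assume "\<exists>X \<in> bounded_operators (model_space u).
            (\<exists>f \<in> model_space u. X f \<noteq> 0) \<and>
            (\<forall>f \<in> model_space u.
               adjoint_on (model_space u) (model_operator u) (X f) = X (model_operator u f))"
  then show "\<exists>d. is_inner_gcd d u (\<lambda>z. cnj (flip u z)) \<and> \<not> d constant_on ball 0 1"
    using nonconstant_gcd_if_intertwining[OF assms(1)] by blast
next
  assume "\<exists>d. is_inner_gcd d u (\<lambda>z. cnj (flip u z)) \<and> \<not> d constant_on ball 0 1"
  then show "\<exists>X \<in> bounded_operators (model_space u).
            (\<exists>f \<in> model_space u. X f \<noteq> 0) \<and>
            (\<forall>f \<in> model_space u.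
               adjoint_on (model_space u) (model_operator u) (X f) = X (model_operator u f))"
    using intertwining_if_nonconstant_divisor[OF assms(1)] unfolding is_inner_gcd_def by blast
qed

end
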